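(* Let $\varphi$ be an increasing concave function on $[0,1]$ with $\varphi(0)=0$ and $\delta_\varphi<1$. Then the weighted couple $(M_\varphi,M_\varphi(w))$ is $K$-monotone for some non-trivial weight $w$ on $[0,1]$ if and only if $\varphi$ is equivalent to a quasi-concave function on $[0,1]$ that is regularly varying at zero of order $\infty$.
   Context: $m$ is Lebesgue measure. For measurable $x$ on $[0,1]$, $x^*(t)=\inf\{\lambda>0: m\{|x|>\lambda\}\le t\}$ and $x^{**}(t)=\frac1t\int_0^tx^*(s)\,ds$. The Marcinkiewicz space $M_\varphi$ consists of measurable $x$ on $[0,1]$ with $\|x\|_{M_\varphi}=\sup_{0<t\le1}\varphi(t)x^{**}(t)<\infty$. The upper dilation index is $\delta_\varphi=\lim_{t\to\infty}\frac{\ln\bar\varphi(t)}{\ln t}$, where $\bar\varphi(t)=\sup\{\varphi(st)/\varphi(s): s,st\in(0,1]\}$. A function $\psi:[0,1]\to[0,\infty)$ is quasi-concave if $\psi(0)=0$, $\psi$ is non-decreasing and $\psi(t)/t$ is non-increasing on $(0,1]$. It is regularly varying at zero of order $\infty$ if $\lim_{t\to0^+}\psi(tu)/\psi(t)=1$ for all $u>0$. Two functions are equivalent if each is bounded by a constant multiple of the other. A weight on $[0,1]$ is a measurable function positive and finite a.e.; it is non-trivial if $w$ or $1/w$ is unbounded (up to null sets). $X(w)=\{x: xw\in X\}$ with $\|x\|_{X(w)}=\|xw\|_X$. For a Banach couple $(X_0,X_1)$, $K(t,x;X_0,X_1)=\inf\{\|x_0\|_{X_0}+t\|x_1\|_{X_1}: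 x=x_0+x_1,\ x_i\in X_i\}$. A Banach space $E$ with $X_0\cap X_1\subset E\subset X_0+X_1$ (continuous embeddings) is an interpolation space if every linear operator on $X_0+X_1$ that maps $X_i$ boundedly into $X_i$ for $i=0,1$ maps $E$ boundedly into $E$. $E$ is a $K$-monotone space if there is $C\ge1$ such that whenever $x\in E$, $y\in X_0+X_1$ and $K(t,y;X_0,X_1)\le K(t,x;X_0,X_1)$ for all $t>0$, then $y\in E$ and $\|y\|_E\le C\|x\|_E$. The couple is $K$-monotone if all its interpolation spaces are $K$-monotone spaces. *)

theory Defs
  imports "HOL-Analysis.Analysis"
begin

section \<open>Measurable functions on the unit interval modulo null sets\<close>

abbreviation unit_leb :: "real measure"
  where "unit_leb \<equiv> lebesgue_on {0..1}"

definition ae_eq :: "(real \<Rightarrow> real) \<Rightarrow> (real \<Rightarrow> real) \<Rightarrow> bool"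
  where "ae_eq f g \<longleftrightarrow>
    f \<in> borel_measurable unit_leb \<and> g \<in> borel_measurable unit_leb \<and> (AE t in unit_leb. f t = g t)"

text \<open>The quotient is partial: only functions that are measurable on the unit interval have a class,
  and values outside the unit interval are irrelevant.\<close>

quotient_type L0 = "real \<Rightarrow> real" / partial: ae_eq
proof (rule part_equivpI)
  show "\<exists>f. ae_eq f f"
    by (rule exI[of _ "\<lambda>_. 0"]) (simp add: ae_eq_def)
  show "symp ae_eq"
    by (auto simp: symp_def ae_eq_def elim: eventually_mono)
  show "transp ae_eq"
    unfolding transp_def ae_eq_def by (auto elim: eventually_elim2)
qed

instantiation L0 :: "{real_vector, times}"
begin

lift_definition zero_L0 :: L0 is "\<lambda>_. 0"
  by (simp add: ae_eq_def)

lift_definition plus_L0 :: "L0 \<Rightarrow> L0 \<Rightarrow> L0" is "\<lambda>f g t. f t + g t"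
  unfolding ae_eq_def by (auto elim: eventually_elim2)

lift_definition uminus_L0 :: "L0 \<Rightarrow> L0" is "\<lambda>f t. - f t"
  unfolding ae_eq_def by (auto elim: eventually_mono)

lift_definition minus_L0 :: "L0 \<Rightarrow> L0 \<Rightarrow> L0" is "\<lambda>f g t. f t - g t"
  unfolding ae_eq_def by (auto elim: eventually_elim2)

lift_definition times_L0 :: "L0 \<Rightarrow> L0 \<Rightarrow> L0" is "\<lambda>f g t. f t * g t"
  unfolding ae_eq_def by (auto elim: eventually_elim2)

lift_definition scaleR_L0 :: "real \<Rightarrow> L0 \<Rightarrow> L0" is "\<lambda>c f t. c * f t"
  unfolding ae_eq_def by (auto elim: eventually_mono)

instance
  by standard (transfer; auto simp: ae_eq_def algebra_simps)+

end

section \<open>Normed subspaces and interpolation\<close>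

text \<open>Everything takes place inside one ambient real vector space. The norm of a space is a total
  function, of which only the values on the underlying set matter.\<close>

record 'v nspace =
  pts :: "'v set"
  nrm :: "'v \<Rightarrow> real"

definition banach_space :: "'v::real_vector nspace \<Rightarrow> bool"
  where "banach_space E \<longleftrightarrow>
    subspace (pts E) \<and>
    (\<forall>x\<in>pts E. 0 \<le> nrm E x \<and> (nrm E x = 0 \<longleftrightarrow> x = 0)) \<and>
    (\<forall>c. \<forall>x\<in>pts E. nrm E (c *\<^sub>R x) = \<bar>c\<bar> * nrm E x) \<and>
    (\<forall>x\<in>pts E. \<forall>y\<in>pts E. nrm E (x + y) \<le> nrm E x + nrm E y) \<and>
    Metric_space.mcomplete (pts E) (\<lambda>x y. nrm E (x - y))"

definition K_functional :: "real \<Rightarrow> 'v::real_vector \<Rightarrow> 'v nspace \<Rightarrow> 'v nspace \<Rightarrow> real"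
  where "K_functional t x X0 X1 =
    Inf {nrm X0 x0 + t * nrm X1 x1 | x0 x1. x0 \<in> pts X0 \<and> x1 \<in> pts X1 \<and> x = x0 + x1}"

definition couple_inter :: "'v nspace \<Rightarrow> 'v nspace \<Rightarrow> 'v::real_vector nspace"
  where "couple_inter X0 X1 =
    \<lparr>pts = pts X0 \<inter> pts X1, nrm = (\<lambda>x. max (nrm X0 x) (nrm X1 x))\<rparr>"

definition couple_sum :: "'v nspace \<Rightarrow> 'v nspace \<Rightarrow> 'v::real_vector nspace"
  where "couple_sum X0 X1 =
    \<lparr>pts = {x0 + x1 | x0 x1. x0 \<in> pts X0 \<and> x1 \<in> pts X1}, nrm = (\<lambda>x. K_functional 1 x X0 X1)\<rparr>"

definition cont_embedded :: "'v nspace \<Rightarrow> 'v nspace \<Rightarrow> bool"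
  where "cont_embedded X Y \<longleftrightarrow>
    pts X \<subseteq> pts Y \<and> (\<exists>C. \<forall>x\<in>pts X. nrm Y x \<le> C * nrm X x)"

definition linear_operator_on :: "('v \<Rightarrow> 'v) \<Rightarrow> 'v::real_vector nspace \<Rightarrow> bool"
  where "linear_operator_on T X \<longleftrightarrow>
    T ` pts X \<subseteq> pts X \<and>
    (\<forall>x\<in>pts X. \<forall>y\<in>pts X. T (x + y) = T x + T y) \<and>
    (\<forall>c. \<forall>x\<in>pts X. T (c *\<^sub>R x) = c *\<^sub>R T x)"

definition maps_boundedly :: "('v \<Rightarrow> 'v) \<Rightarrow> 'v nspace \<Rightarrow> bool"
  where "maps_boundedly T X \<longleftrightarrow>
    T ` pts X \<subseteq> pts X \<and> (\<exists>C. \<forall>x\<in>pts X. nrm X (T x) \<le> C * nrm X x)"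

definition interpolation_space :: "'v::real_vector nspace \<Rightarrow> 'v nspace \<Rightarrow> 'v nspace \<Rightarrow> bool"
  where "interpolation_space E X0 X1 \<longleftrightarrow>
    banach_space E \<and>
    cont_embedded (couple_inter X0 X1) E \<and> cont_embedded E (couple_sum X0 X1) \<and>
    (\<forall>T. linear_operator_on T (couple_sum X0 X1) \<and> maps_boundedly T X0 \<and> maps_boundedly T X1
      \<longrightarrow> maps_boundedly T E)"

definition K_monotone_space :: "'v::real_vector nspace \<Rightarrow> 'v nspace \<Rightarrow> 'v nspace \<Rightarrow> bool"
  where "K_monotone_space E X0 X1 \<longleftrightarrow>
    (\<exists>C\<ge>1. \<forall>x\<in>pts E. \<forall>y\<in>pts (couple_sum X0 X1).
      (\<forall>t>0. K_functional t y X0 X1 \<le> K_functional t x X0 X1)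
      \<longrightarrow> y \<in> pts E \<and> nrm E y \<le> C * nrm E x)"

definition K_monotone_couple :: "'v::real_vector nspace \<Rightarrow> 'v nspace \<Rightarrow> bool"
  where "K_monotone_couple X0 X1 \<longleftrightarrow>
    (\<forall>E. interpolation_space E X0 X1 \<longrightarrow> K_monotone_space E X0 X1)"

section \<open>Marcinkiewicz spaces and weights\<close>

text \<open>Only the values at \<open>t > 0\<close> are meaningful: there the set is nonempty, while for \<open>t = 0\<close> and an
  unbounded function it is empty.\<close>

definition decr_rearrangement :: "(real \<Rightarrow> real) \<Rightarrow> real \<Rightarrow> real"
  where "decr_rearrangement x t = Inf {l. 0 < l \<and> measure unit_leb {s \<in> {0..1}. l < \<bar>x s\<bar>} \<le> t}"

definition maximal_rearrangement :: "(real \<Rightarrow> real) \<Rightarrow> real \<Rightarrow> ennreal"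
  where "maximal_rearrangement x t =
    ennreal (1 / t) * (\<integral>\<^sup>+ s\<in>{0<..t}. ennreal (decr_rearrangement x s) \<partial>lborel)"

lemma decr_rearrangement_cong:
  assumes "ae_eq x y"
  shows "decr_rearrangement x = decr_rearrangement y"
proof -
  have m [measurable]: "x \<in> borel_measurable unit_leb" "y \<in> borel_measurable unit_leb"
    and ae: "AE t in unit_leb. x t = y t"
    using assms by (auto simp: ae_eq_def)
  have sp: "{s \<in> {0..1}. l < \<bar>z s\<bar>} = {s \<in> space unit_leb. l < \<bar>z s\<bar>}" for l and z :: "real \<Rightarrow> real"
    by simp
  have "measure unit_leb {s \<in> {0..1}. l < \<bar>x s\<bar>} = measure unit_leb {s \<in> {0..1}. l < \<bar>y s\<bar>}" for l
    unfolding sp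
  proof (rule measure_eq_AE)
    show "AE s in unit_leb. s \<in> {s \<in> space unit_leb. l < \<bar>x s\<bar>} \<longleftrightarrow> s \<in> {s \<in> space unit_leb. l < \<bar>y s\<bar>}"
      using ae by (auto elim: eventually_mono)
  qed measurable
  then show ?thesis
    by (auto simp: decr_rearrangement_def fun_eq_iff)
qed

lift_definition marcinkiewicz_enorm :: "(real \<Rightarrow> real) \<Rightarrow> L0 \<Rightarrow> ennreal"
  is "\<lambda>\<phi> x. SUP t\<in>{0<..1}. ennreal (\<phi> t) * maximal_rearrangement x t"
  by (simp add: maximal_rearrangement_def decr_rearrangement_cong)

definition marcinkiewicz :: "(real \<Rightarrow> real) \<Rightarrow> L0 nspace"
  where "marcinkiewicz \<phi> =
    \<lparr>pts = {x. marcinkiewicz_enorm \<phi> x < \<infinity>}, nrm = (\<lambda>x. enn2real (marcinkiewicz_enorm \<phi> x))\<rparr>"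

lift_definition weight :: "L0 \<Rightarrow> bool" is "\<lambda>w. AE t in unit_leb. 0 < w t"
  unfolding ae_eq_def by (auto elim: eventually_elim2)

lift_definition ess_bounded_above :: "L0 \<Rightarrow> bool" is "\<lambda>w. \<exists>C. AE t in unit_leb. w t \<le> C"
proof -
  fix f g assume "ae_eq f g"
  then have "AE t in unit_leb. f t = g t"
    by (simp add: ae_eq_def)
  then have "(AE t in unit_leb. f t \<le> C) \<longleftrightarrow> (AE t in unit_leb. g t \<le> C)" for C
    by (auto elim: eventually_elim2)
  then show "(\<exists>C. AE t in unit_leb. f t \<le> C) \<longleftrightarrow> (\<exists>C. AE t in unit_leb. g t \<le> C)"
    by simp
qed

lift_definition reciprocal :: "L0 \<Rightarrow> L0" is "\<lambda>w t. 1 / w t"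
  unfolding ae_eq_def by (auto elim: eventually_mono)

definition nontrivial_weight :: "L0 \<Rightarrow> bool"
  where "nontrivial_weight w \<longleftrightarrow>
    weight w \<and> (\<not> ess_bounded_above w \<or> \<not> ess_bounded_above (reciprocal w))"

definition weighted :: "L0 nspace \<Rightarrow> L0 \<Rightarrow> L0 nspace"
  where "weighted X w = \<lparr>pts = {x. x * w \<in> pts X}, nrm = (\<lambda>x. nrm X (x * w))\<rparr>"

section \<open>Parameter functions\<close>

definition dilation_fun :: "(real \<Rightarrow> real) \<Rightarrow> real \<Rightarrow> real"
  where "dilation_fun \<phi> t = Sup {\<phi> (s * t) / \<phi> s | s. s \<in> {0<..1} \<and> s * t \<in> {0<..1}}"

definition upper_dilation_index :: "(real \<Rightarrow> real) \<Rightarrow> real"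
  where "upper_dilation_index \<phi> = Lim at_top (\<lambda>t. ln (dilation_fun \<phi> t) / ln t)"

definition quasi_concave :: "(real \<Rightarrow> real) \<Rightarrow> bool"
  where "quasi_concave \<psi> \<longleftrightarrow>
    (\<forall>t\<in>{0..1}. 0 \<le> \<psi> t) \<and> \<psi> 0 = 0 \<and>
    mono_on {0..1} \<psi> \<and> antimono_on {0<..1} (\<lambda>t. \<psi> t / t)"

definition regularly_varying_order_infinity :: "(real \<Rightarrow> real) \<Rightarrow> bool"
  where "regularly_varying_order_infinity \<psi> \<longleftrightarrow>
    (\<forall>u>0. ((\<lambda>t. \<psi> (t * u) / \<psi> t) \<longlongrightarrow> 1) (at_right 0))"

definition equivalent_functions :: "(real \<Rightarrow> real) \<Rightarrow> (real \<Rightarrow> real) \<Rightarrow> bool"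
  where "equivalent_functions \<phi> \<psi> \<longleftrightarrow>
    (\<exists>C. \<forall>t\<in>{0..1}. \<phi> t \<le> C * \<psi> t) \<and> (\<exists>C. \<forall>t\<in>{0..1}. \<psi> t \<le> C * \<phi> t)"

end

theory Submission
  imports Defs
begin

text \<open>Both conditions are equivalent to: for some \<open>C\<close> and every \<open>n\<close>, \<open>\<phi> (n s) \<le> C \<phi> s\<close> for all small \<open>s\<close>.
  The index condition is used only through \<open>\<integral>\<^sub>0\<^sup>t ds / \<phi> s \<le> K t / \<phi> t\<close>, which makes the norm of \<open>M\<^sub>\<phi>\<close>
  equivalent to \<open>sup \<lambda> \<phi> (m {|x| > \<lambda>})\<close>.

  Suppose the condition holds. Split the interval into blocks whose lengths decrease fast enough that \<open>M\<^sub>\<phi>\<close>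
  becomes an \<open>l\<^sub>\<infinity>\<close>-sum of its restrictions to the blocks, and let \<open>w = 2\<^sup>k\<close> on the \<open>k\<close>-th block. If
  \<open>K(t, y) \<le> K(t, x)\<close> for all \<open>t\<close>, then \<open>y\<close> restricted to block \<open>k\<close> is dominated by \<open>min 1 2\<^sup>j\<^sup>-\<^sup>k\<close> times
  \<open>x\<close> restricted to some block \<open>j\<close>, and an operator taking \<open>x\<close> to \<open>y\<close> is assembled from norming functionals.

  Suppose the condition fails. Choose pieces of widely separated levels \<open>c\<^sub>j\<close> of \<open>w\<close>, normalized indicators \<open>x\<^sub>j\<close>
  of sets with rapidly decreasing measures, whose sums stay bounded, and normalized indicators \<open>y\<^sub>j\<close> which come
  in batches of sets of equal measure, whose sums are unbounded. The elements \<open>x = \<Sum> c\<^sub>j\<^sup>-\<^sup>1\<^sup>/\<^sup>2 x\<^sub>j\<close> and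
  \<open>y = \<Sum> c\<^sub>j\<^sup>-\<^sup>1\<^sup>/\<^sup>2 y\<^sub>j\<close> have comparable K-functionals. Operators of the couple are almost diagonal with
  respect to these pieces, so a space whose norm maximizes the batch sums over all operators of norm at most
  one is an interpolation space that contains \<open>x\<close> but not \<open>y\<close>.\<close>

section \<open>Rearrangements\<close>

text \<open>K-monotonicity asks for one constant, while the interpolation property gives each
  operator its own unspecified bound on \<open>E\<close>. An operator taking x to y therefore shows
  only that y lies in \<open>E\<close>. Uniformity comes from infinitely many mutually orthogonal
  copies of such operators, combined into weighted sums; this is why each block is later cut into
  infinitely many cells.

  The critical quantity on both sides is the norm \<phi>(n s) / \<phi>(s) of a sum of n disjoint
  normalized indicators of measure s. If the condition holds, a level set spread over k + 1 blocks
  and a small tail has measure at most k + 2 times the largest share, which dictates the speed at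
  which the blocks shrink. If it fails, these quotients are the unbounded batch norms.

  The square roots come from balance: as a function of c, c^(-1/2) min(1, t c) peaks at c = 1/t. So
  each level dominates the K-functional at its own scale, and only the norms of the single pieces
  are visible to it. Wide separation serves twice: sums over levels become geometric, and
  off-diagonal entries of operators become summable.\<close>

lemma nn_integral_layer_cake:
  fixes f :: "'a \<Rightarrow> real"
  assumes "sigma_finite_measure M" and [measurable]: "f \<in> borel_measurable M"
  shows "(\<integral>\<^sup>+x. ennreal (f x) \<partial>M) = (\<integral>\<^sup>+l\<in>{0..}. emeasure M {x \<in> space M. l < f x} \<partial>lborel)"
proof -
  interpret sigma_finite_measure M by fact
  interpret pair_sigma_finite M lborel ..
  have "(\<integral>\<^sup>+x. ennreal (f x) \<partial>M) = (\<integral>\<^sup>+x. \<integral>\<^sup>+l. indicator {0..<f x} l \<partial>lborel \<partial>M)"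
  proof (intro nn_integral_cong)
    fix x show "ennreal (f x) = (\<integral>\<^sup>+l. indicator {0..<f x} l \<partial>lborel)"
      by (cases "0 \<le> f x") (auto simp: ennreal_neg)
  qed
  also have "\<dots> = (\<integral>\<^sup>+x. \<integral>\<^sup>+l. (if 0 \<le> l \<and> l < f x then 1 else 0) \<partial>lborel \<partial>M)"
    by (intro nn_integral_cong) (auto simp: indicator_def)
  also have "\<dots> = (\<integral>\<^sup>+l. \<integral>\<^sup>+x. (if 0 \<le> l \<and> l < f x then 1 else 0) \<partial>M \<partial>lborel)"
    by (rule Fubini'[symmetric]) measurable
  also have "\<dots> = (\<integral>\<^sup>+l\<in>{0..}. emeasure M {x \<in> space M. l < f x} \<partial>lborel)"
  proof (intro nn_integral_cong)
    fix l :: real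
    have "(\<integral>\<^sup>+x. (if 0 \<le> l \<and> l < f x then 1 else 0) \<partial>M)
      = (\<integral>\<^sup>+x. indicator {x \<in> space M. l < f x} x * indicator {0..} l \<partial>M)"
      by (intro nn_integral_cong) (auto simp: indicator_def)
    then show "(\<integral>\<^sup>+x. (if 0 \<le> l \<and> l < f x then 1 else 0) \<partial>M)
      = emeasure M {x \<in> space M. l < f x} * indicator {0..} l"
      by (simp add: nn_integral_multc)
  qed
  finally show ?thesis .
qed

interpretation unit_leb: finite_measure unit_leb
  by standard (simp add: emeasure_restrict_space)

lemma measure_unit_leb_space: "measure unit_leb {0..1} = 1"
  by (simp add: measure_restrict_space)

lemma measure_unit_leb_le_1: "measure unit_leb B \<le> 1"
  using unit_leb.bounded_measure[of B] measure_unit_leb_space by simp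

lemma measure_unit_leb_cbox:
  assumes "0 \<le> a" "a \<le> b" "b \<le> 1"
  shows "{a<..b} \<in> sets unit_leb" "measure unit_leb {a<..b} = b - a"
proof -
  show "{a<..b} \<in> sets unit_leb"
    using assms by (subst sets_restrict_space_iff) auto
  show "measure unit_leb {a<..b} = b - a"
    using assms by (subst measure_restrict_space) auto
qed

text \<open>The sets \<open>A \<union> (B \<inter> {0<..s})\<close> grow from \<open>A\<close> to
  almost all of \<open>B\<close>, and their measure is 1-Lipschitz in \<open>s\<close>, so the
  intermediate value theorem applies.\<close>

lemma unit_leb_exists_between:
  assumes B: "B \<in> sets unit_leb" and A: "A \<in> sets unit_leb" "A \<subseteq> B"
    and t: "measure unit_leb A \<le> t" "t \<le> measure unit_leb B"
  obtains D where "D \<in> sets unit_leb" "A \<subseteq> D" "D \<subseteq> B" "measure unit_leb D = t"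
proof -
  define D where "D s = A \<union> (B \<inter> {0<..s})" for s :: real
  have I: "{0<..s} \<inter> {0..1} \<in> sets unit_leb" for s :: real
    by (subst sets_restrict_space_iff) auto
  have D: "D s \<in> sets unit_leb" for s
  proof -
    have "D s = A \<union> (B \<inter> ({0<..s} \<inter> {0..1}))"
      using sets.sets_into_space[OF B] by (auto simp: D_def)
    then show ?thesis using A B I by auto
  qed
  define g where "g s = measure unit_leb (D s)" for s
  have lip: "\<bar>g s - g r\<bar> \<le> s - r" if "0 \<le> r" "r \<le> s" "s \<le> 1" for r s
  proof -
    have "g r \<le> g s"
      unfolding g_def by (rule unit_leb.finite_measure_mono) (use that D in \<open>auto simp: D_def\<close>)
    moreover have "g s \<le> measure unit_leb (D r \<union> {r<..s})"
      unfolding g_def using that D measure_unit_leb_cbox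
      by (intro unit_leb.finite_measure_mono) (auto simp: D_def)
    moreover have "\<dots> \<le> g r + measure unit_leb {r<..s}"
      unfolding g_def using that D measure_unit_leb_cbox by (intro measure_Un_le) auto
    ultimately show ?thesis using measure_unit_leb_cbox[OF that] by linarith
  qed
  have cont: "continuous_on {0..1} g"
    unfolding continuous_on_iff dist_real_def
  proof (intro ballI allI impI)
    fix x e :: real assume x: "x \<in> {0..1}" "0 < e"
    show "\<exists>d>0. \<forall>x'\<in>{0..1}. \<bar>x' - x\<bar> < d \<longrightarrow> \<bar>g x' - g x\<bar> < e"
    proof (intro exI[of _ e] conjI ballI impI)
      fix y assume y: "y \<in> {0..1}" "\<bar>y - x\<bar> < e"
      show "\<bar>g y - g x\<bar> < e"
        using lip[of x y] lip[of y x] x y by (cases "x \<le> y") auto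
    qed (use x in auto)
  qed
  have 0: "g 0 \<le> t"
    using t by (simp add: g_def D_def)
  have "measure unit_leb B \<le> g 1"
  proof -
    \<comment> \<open>The half-open intervals never reach the point 0; it is absorbed as a null
      set.\<close>
    have "B \<subseteq> D 1 \<union> {0}" "{0::real} \<in> sets unit_leb"
      using sets.sets_into_space[OF B] by (auto simp: D_def sets_restrict_space_iff)
    then have "measure unit_leb B \<le> measure unit_leb (D 1 \<union> {0})"
      using D by (intro unit_leb.finite_measure_mono sets.Un) auto
    also have "\<dots> \<le> g 1 + measure unit_leb {0}"
      unfolding g_def using D \<open>{0} \<in> sets unit_leb\<close> by (intro measure_Un_le) auto
    also have "measure unit_leb {0::real} = 0"
      by (subst measure_restrict_space) auto
    finally show ?thesis by simp
  qed
  then have 1: "t \<le> g 1" using t by linarith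
  obtain s where "0 \<le> s" "s \<le> 1" "g s = t"
    using IVT'[OF 0 1 _ cont] by auto
  then show ?thesis
    using that[of "D s"] D A by (auto simp: g_def D_def)
qed

section \<open>Distribution functions and decreasing rearrangements\<close>

definition distr_fn :: "(real \<Rightarrow> real) \<Rightarrow> real \<Rightarrow> real"
  where "distr_fn f l = measure unit_leb {s \<in> {0..1}. l < \<bar>f s\<bar>}"

lemma sets_greater_unit_leb:
  "f \<in> borel_measurable unit_leb \<Longrightarrow> {s \<in> {0..1}. l < \<bar>f s\<bar>} \<in> sets unit_leb" for f :: "real \<Rightarrow> real"
proof -
  assume [measurable]: "f \<in> borel_measurable unit_leb"
  have "{s \<in> space unit_leb. l < \<bar>f s\<bar>} \<in> sets unit_leb" by measurable
  then show ?thesis by simp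
qed

lemma distr_fn_antimono:
  assumes "f \<in> borel_measurable unit_leb" "l \<le> k"
  shows "distr_fn f k \<le> distr_fn f l"
  unfolding distr_fn_def
  by (rule unit_leb.finite_measure_mono) (use assms sets_greater_unit_leb in auto)

lemma distr_fn_nonneg [simp]: "0 \<le> distr_fn f l"
  by (simp add: distr_fn_def)

text \<open>Continuity of the measure from below along the levels \<open>l + 1 / Suc n\<close>,
  phrased as persistence of a strict inequality.\<close>

lemma distr_fn_right_continuous:
  assumes f: "f \<in> borel_measurable unit_leb" and s: "s < distr_fn f l"
  obtains k where "l < k" "s < distr_fn f k"
proof -
  let ?A = "\<lambda>n::nat. {s \<in> {0..1}. l + 1 / Suc n < \<bar>f s\<bar>}"
  have "(\<lambda>n. measure unit_leb (?A n)) \<longlonglongrightarrow> measure unit_leb (\<Union>n. ?A n)"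
  proof (rule unit_leb.finite_Lim_measure_incseq)
    show "range ?A \<subseteq> sets unit_leb" using sets_greater_unit_leb[OF f] by auto
    show "incseq ?A"
    proof (rule monoI, safe)
      fix m n :: nat and t assume "m \<le> n" "l + 1 / Suc m < \<bar>f t\<bar>"
      moreover have "1 / real (Suc n) \<le> 1 / Suc m" using \<open>m \<le> n\<close> by (simp add: frac_le)
      ultimately show "l + 1 / Suc n < \<bar>f t\<bar>" by linarith
    qed
  qed
  also have "(\<Union>n. ?A n) = {s \<in> {0..1}. l < \<bar>f s\<bar>}"
  proof safe
    fix t assume "t \<in> {0..1}" "l < \<bar>f t\<bar>"
    then obtain n where "1 / Suc n < \<bar>f t\<bar> - l"
      using nat_approx_posE[of "\<bar>f t\<bar> - l"] by auto
    then show "t \<in> (\<Union>n. ?A n)" using \<open>t \<in> {0..1}\<close> by (auto intro!: exI[of _ n])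
  next
    fix t n assume "l + 1 / Suc n < \<bar>f t\<bar>"
    moreover have "0 < 1 / real (Suc n)" by simp
    ultimately show "l < \<bar>f t\<bar>" by linarith
  qed
  finally have "(\<lambda>n::nat. distr_fn f (l + 1 / Suc n)) \<longlonglongrightarrow> distr_fn f l"
    unfolding distr_fn_def .
  then have "\<forall>\<^sub>F n in sequentially. s < distr_fn f (l + 1 / Suc n)"
    using s by (rule order_tendstoD)
  then obtain n where "s < distr_fn f (l + 1 / Suc n)"
    by (auto simp: eventually_sequentially)
  then show ?thesis using that[of "l + 1 / Suc n"] by simp
qed

lemma distr_fn_vanishes:
  assumes f: "f \<in> borel_measurable unit_leb" and s: "0 < s"
  obtains l where "0 < l" "distr_fn f l \<le> s"
proof -
  let ?A = "\<lambda>n::nat. {s \<in> {0..1}. real (Suc n) < \<bar>f s\<bar>}"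
  have "(\<lambda>n. measure unit_leb (?A n)) \<longlonglongrightarrow> measure unit_leb (\<Inter>n. ?A n)"
    by (rule unit_leb.finite_Lim_measure_decseq) (use sets_greater_unit_leb[OF f] in \<open>auto simp: decseq_def\<close>)
  also have "(\<Inter>n. ?A n) = {}"
  proof -
    have "\<exists>n. \<not> real (Suc n) < \<bar>f t\<bar>" for t
      using reals_Archimedean2[of "\<bar>f t\<bar>"] by (metis less_SucI less_imp_of_nat_less not_less order.strict_trans2 less_eq_real_def of_nat_Suc lessI)
    then show ?thesis by blast
  qed
  finally have "(\<lambda>n::nat. distr_fn f (Suc n)) \<longlonglongrightarrow> 0"
    unfolding distr_fn_def by simp
  then have "\<forall>\<^sub>F n in sequentially. distr_fn f (Suc n) < s"
    using s by (rule order_tendstoD)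
  then obtain n where "distr_fn f (Suc n) < s"
    by (auto simp: eventually_sequentially)
  then show ?thesis using that[of "Suc n"] by simp
qed

lemma decr_rearrangement_bdd: "bdd_below {l. 0 < l \<and> distr_fn f l \<le> t}"
  by (rule bdd_belowI[of _ 0]) auto

text \<open>The rearrangement is the generalized inverse of the distribution function. Right
  continuity makes the equivalence hold for strict inequalities; positivity of \<open>s\<close>
  guarantees that the infimum ranges over a nonempty set.\<close>

lemma less_decr_rearrangement_iff:
  assumes f: "f \<in> borel_measurable unit_leb" and s: "0 < s" and l: "0 \<le> l"
  shows "l < decr_rearrangement f s \<longleftrightarrow> s < distr_fn f l"
proof
  have eq: "decr_rearrangement f s = Inf {l. 0 < l \<and> distr_fn f l \<le> s}"
    by (simp add: decr_rearrangement_def distr_fn_def)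
  have ne: "{l. 0 < l \<and> distr_fn f l \<le> s} \<noteq> {}"
    using distr_fn_vanishes[OF f s] by blast
  show "l < decr_rearrangement f s" if large: "s < distr_fn f l"
  proof -
    obtain k where k: "l < k" "s < distr_fn f k"
      by (rule distr_fn_right_continuous[OF f large])
    have "k \<le> decr_rearrangement f s"
      unfolding eq
    proof (rule cInf_greatest[OF ne])
      fix m assume m: "m \<in> {l. 0 < l \<and> distr_fn f l \<le> s}"
      then show "k \<le> m" using k distr_fn_antimono[OF f, of m k] by (cases "k \<le> m") auto
    qed
    with k show ?thesis by simp
  qed
  show "s < distr_fn f l" if "l < decr_rearrangement f s"
  proof (rule ccontr)
    assume n: "\<not> s < distr_fn f l"
    define k where "k = (l + decr_rearrangement f s) / 2"
    have k: "0 < k" "l < k" "k < decr_rearrangement f s"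
      using that l by (auto simp: k_def)
    have "distr_fn f k \<le> s" using distr_fn_antimono[OF f, of l k] n k by simp
    then have "decr_rearrangement f s \<le> k"
      unfolding eq using k by (intro cInf_lower decr_rearrangement_bdd) auto
    with k show False by simp
  qed
qed

lemma decr_rearrangement_nonneg:
  assumes "f \<in> borel_measurable unit_leb" "0 < s"
  shows "0 \<le> decr_rearrangement f s"
  unfolding decr_rearrangement_def
  by (rule cInf_greatest) (use distr_fn_vanishes[OF assms] in \<open>auto simp: distr_fn_def\<close>)

lemma decr_rearrangement_antimono:
  assumes "f \<in> borel_measurable unit_leb" "0 < s" "s \<le> r"
  shows "decr_rearrangement f r \<le> decr_rearrangement f s"
proof (rule ccontr)
  assume "\<not> ?thesis"
  then have "r < distr_fn f (decr_rearrangement f s)"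
    using less_decr_rearrangement_iff[of f r "decr_rearrangement f s"] decr_rearrangement_nonneg assms by auto
  then show False
    using less_decr_rearrangement_iff[of f s "decr_rearrangement f s"] decr_rearrangement_nonneg assms by auto
qed

lemma borel_measurable_decr_rearrangement:
  assumes "f \<in> borel_measurable unit_leb"
  shows "(\<lambda>s. decr_rearrangement f s * indicator {0<..t} s) \<in> borel_measurable borel"
proof -
  have "mono_on {0<..t} (\<lambda>s. - decr_rearrangement f s)"
    by (auto intro!: mono_onI decr_rearrangement_antimono assms)
  then have "(\<lambda>s. - (- decr_rearrangement f s)) \<in> borel_measurable (restrict_space borel {0<..t})"
    by (intro borel_measurable_uminus borel_measurable_mono_on_fnc)
  then show ?thesis
    by (subst (asm) borel_measurable_restrict_space_iff) (auto simp: mult.commute)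
qed

text \<open>Layer cake on the left-hand side: the points of \<open>{0<..t}\<close> where the
  rearrangement exceeds \<open>l\<close> form an interval of length
  \<open>min t (distr_fn f l)\<close>.\<close>

lemma nn_integral_decr_rearrangement:
  assumes f: "f \<in> borel_measurable unit_leb" and t: "0 < t"
  shows "(\<integral>\<^sup>+s\<in>{0<..t}. ennreal (decr_rearrangement f s) \<partial>lborel)
    = (\<integral>\<^sup>+l\<in>{0..}. ennreal (min t (distr_fn f l)) \<partial>lborel)"
proof -
  have "(\<integral>\<^sup>+s\<in>{0<..t}. ennreal (decr_rearrangement f s) \<partial>lborel)
    = (\<integral>\<^sup>+s. ennreal (decr_rearrangement f s * indicator {0<..t} s) \<partial>lborel)"
    by (intro nn_integral_cong) (auto simp: indicator_def)
  also have "\<dots> = (\<integral>\<^sup>+l\<in>{0..}. emeasure lborel {s \<in> space lborel. l < decr_rearrangement f s * indicator {0<..t} s} \<partial>lborel)"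
    by (intro nn_integral_layer_cake sigma_finite_lborel) (use borel_measurable_decr_rearrangement[OF f] in auto)
  also have "\<dots> = (\<integral>\<^sup>+l\<in>{0..}. ennreal (min t (distr_fn f l)) \<partial>lborel)"
  proof (intro nn_integral_cong)
    fix l :: real
    have "emeasure lborel {s \<in> space lborel. l < decr_rearrangement f s * indicator {0<..t} s} = ennreal (min t (distr_fn f l))"
      if l: "0 \<le> l"
    proof -
      have eq: "{s \<in> space lborel. l < decr_rearrangement f s * indicator {0<..t} s} = {s. 0 < s \<and> s \<le> t \<and> s < distr_fn f l}"
        using less_decr_rearrangement_iff[OF f _ l] l by (auto simp: indicator_def split: if_splits)
      show ?thesis
      proof (cases "t < distr_fn f l")
        case True
        then have "{s. 0 < s \<and> s \<le> t \<and> s < distr_fn f l} = {0<..t}" by auto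
        then show ?thesis using True t unfolding eq by simp
      next
        case False
        then have "{s. 0 < s \<and> s \<le> t \<and> s < distr_fn f l} = {0<..<distr_fn f l}" by auto
        then show ?thesis using False unfolding eq by simp
      qed
    qed
    then show "emeasure lborel {s \<in> space lborel. l < decr_rearrangement f s * indicator {0<..t} s} * indicator {0..} l
      = ennreal (min t (distr_fn f l)) * indicator {0..} l"
      by (auto simp: indicator_def)
  qed
  finally show ?thesis .
qed

section \<open>Integrals over sets compared with integrals of the rearrangement\<close>

lemma set_nn_integral_layer_cake:
  assumes [measurable]: "f \<in> borel_measurable unit_leb" and B[measurable]: "B \<in> sets unit_leb"
  shows "(\<integral>\<^sup>+t\<in>B. ennreal \<bar>f t\<bar> \<partial>unit_leb)
    = (\<integral>\<^sup>+l\<in>{0..}. ennreal (measure unit_leb (B \<inter> {s \<in> {0..1}. l < \<bar>f s\<bar>})) \<partial>lborel)"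
proof -
  have "(\<integral>\<^sup>+t\<in>B. ennreal \<bar>f t\<bar> \<partial>unit_leb) = (\<integral>\<^sup>+t. ennreal (\<bar>f t\<bar> * indicator B t) \<partial>unit_leb)"
    by (intro nn_integral_cong) (auto simp: indicator_def)
  also have "\<dots> = (\<integral>\<^sup>+l\<in>{0..}. emeasure unit_leb {t \<in> space unit_leb. l < \<bar>f t\<bar> * indicator B t} \<partial>lborel)"
    using assms by (intro nn_integral_layer_cake borel_measurable_times borel_measurable_abs borel_measurable_indicator)
      unfold_locales
  also have "\<dots> = (\<integral>\<^sup>+l\<in>{0..}. ennreal (measure unit_leb (B \<inter> {s \<in> {0..1}. l < \<bar>f s\<bar>})) \<partial>lborel)"
  proof (intro nn_integral_cong)
    fix l :: real
    have "{t \<in> space unit_leb. l < \<bar>f t\<bar> * indicator B t} = B \<inter> {s \<in> {0..1}. l < \<bar>f s\<bar>}" if "0 \<le> l"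
      using that sets.sets_into_space[OF B] by (auto simp: indicator_def split: if_splits)
    then show "emeasure unit_leb {t \<in> space unit_leb. l < \<bar>f t\<bar> * indicator B t} * indicator {0..} l
      = ennreal (measure unit_leb (B \<inter> {s \<in> {0..1}. l < \<bar>f s\<bar>})) * indicator {0..} l"
      by (auto simp: indicator_def unit_leb.emeasure_eq_measure)
  qed
  finally show ?thesis .
qed

lemma set_nn_integral_le_decr_rearrangement:
  assumes f: "f \<in> borel_measurable unit_leb" and B: "B \<in> sets unit_leb" and t: "0 < t" "measure unit_leb B \<le> t"
  shows "(\<integral>\<^sup>+s\<in>B. ennreal \<bar>f s\<bar> \<partial>unit_leb) \<le> (\<integral>\<^sup>+s\<in>{0<..t}. ennreal (decr_rearrangement f s) \<partial>lborel)"
  unfolding nn_integral_decr_rearrangement[OF f t(1)] set_nn_integral_layer_cake[OF f B]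
proof (intro nn_integral_mono mult_right_mono ennreal_leI)
  fix l :: real
  have "measure unit_leb (B \<inter> {s \<in> {0..1}. l < \<bar>f s\<bar>}) \<le> measure unit_leb B"
    "measure unit_leb (B \<inter> {s \<in> {0..1}. l < \<bar>f s\<bar>}) \<le> distr_fn f l"
    unfolding distr_fn_def
    by (rule unit_leb.finite_measure_mono; use B sets_greater_unit_leb[OF f] in auto)+
  then show "measure unit_leb (B \<inter> {s \<in> {0..1}. l < \<bar>f s\<bar>}) \<le> min t (distr_fn f l)"
    using t by auto
qed auto

text \<open>With \<open>r\<close> the rearrangement at \<open>t\<close>, any set of measure
  \<open>t\<close> between \<open>{|f| > r}\<close> and \<open>{|f| \<ge> r}\<close> is extremal: it
  lies inside every superlevel set of level below \<open>r\<close> and contains every superlevel set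
  of level at least \<open>r\<close>.\<close>

lemma exists_set_nn_integral_decr_rearrangement:
  assumes f[measurable]: "f \<in> borel_measurable unit_leb" and t: "0 < t" "t \<le> 1"
  obtains B where "B \<in> sets unit_leb" "measure unit_leb B = t"
    "(\<integral>\<^sup>+s\<in>{0<..t}. ennreal (decr_rearrangement f s) \<partial>lborel) \<le> (\<integral>\<^sup>+s\<in>B. ennreal \<bar>f s\<bar> \<partial>unit_leb)"
proof -
  define r where "r = decr_rearrangement f t"
  have r: "0 \<le> r" using decr_rearrangement_nonneg[OF f t(1)] by (simp add: r_def)
  let ?A = "{s \<in> {0..1}. r < \<bar>f s\<bar>}" and ?G = "{s \<in> {0..1}. r \<le> \<bar>f s\<bar>}"
  have "{s \<in> space unit_leb. r \<le> \<bar>f s\<bar>} \<in> sets unit_leb" by measurable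
  then have G: "?G \<in> sets unit_leb" by simp
  have A: "measure unit_leb ?A \<le> t"
    using less_decr_rearrangement_iff[OF f t(1) r] by (auto simp: r_def distr_fn_def)
  have big: "t \<le> measure unit_leb ?G"
  proof (cases "r = 0")
    case True
    then have "?G = {0..1}" by auto
    then show ?thesis using t measure_unit_leb_space by metis
  next
    case False
    then have r0: "0 < r" using r by simp
    \<comment> \<open>The set \<open>{|f| \<ge> r}\<close> is the decreasing limit of these
      superlevel sets. Each has measure above \<open>t\<close> because its level lies strictly below
      the rearrangement at \<open>t\<close>.\<close>
    let ?H = "\<lambda>n::nat. {s \<in> {0..1}. r - r / Suc n < \<bar>f s\<bar>}"
    have "(\<lambda>n. measure unit_leb (?H n)) \<longlonglongrightarrow> measure unit_leb (\<Inter>n. ?H n)"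
    proof (rule unit_leb.finite_Lim_measure_decseq)
      show "range ?H \<subseteq> sets unit_leb" using sets_greater_unit_leb[OF f] by auto
      show "decseq ?H"
      proof (rule antimonoI, safe)
        fix m n :: nat and u assume "m \<le> n" "r - r / Suc n < \<bar>f u\<bar>"
        moreover have "r / real (Suc n) \<le> r / Suc m" using \<open>m \<le> n\<close> r0 by (simp add: frac_le)
        ultimately show "r - r / Suc m < \<bar>f u\<bar>" by linarith
      qed
    qed
    also have "(\<Inter>n. ?H n) = ?G"
    proof safe
      fix u assume u: "u \<in> (\<Inter>n. ?H n)"
      then show "r \<le> \<bar>f u\<bar>"
      proof -
        have "(\<lambda>n. r - r * (1 / Suc n)) \<longlonglongrightarrow> r - r * 0"
          by (intro tendsto_intros LIMSEQ_Suc lim_1_over_n)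
        moreover have "r - r * (1 / Suc n) \<le> \<bar>f u\<bar>" for n using u by (auto intro: less_imp_le)
        ultimately show ?thesis by (intro LIMSEQ_le_const2[of _ r]) auto
      qed
    next
      fix u n assume "r \<le> \<bar>f u\<bar>"
      moreover have "0 < r / real (Suc n)" using r0 by simp
      ultimately show "r - r / Suc n < \<bar>f u\<bar>" by linarith
    qed auto
    finally have lim: "(\<lambda>n. measure unit_leb (?H n)) \<longlonglongrightarrow> measure unit_leb ?G" .
    have "t \<le> measure unit_leb (?H n)" for n
    proof -
      have "0 \<le> r - r / Suc n" "r - r / Suc n < decr_rearrangement f t"
        using r0 by (auto simp: r_def field_simps)
      then show ?thesis
        using less_decr_rearrangement_iff[OF f t(1)] by (simp add: distr_fn_def less_imp_le)
    qed
    then show ?thesis using lim by (intro LIMSEQ_le_const) auto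
  qed
  obtain B where B: "B \<in> sets unit_leb" "?A \<subseteq> B" "B \<subseteq> ?G" "measure unit_leb B = t"
    by (rule unit_leb_exists_between[OF G sets_greater_unit_leb[OF f] _ A big]) auto
  have "(\<integral>\<^sup>+s\<in>{0<..t}. ennreal (decr_rearrangement f s) \<partial>lborel) \<le> (\<integral>\<^sup>+s\<in>B. ennreal \<bar>f s\<bar> \<partial>unit_leb)"
    unfolding nn_integral_decr_rearrangement[OF f t(1)] set_nn_integral_layer_cake[OF f B(1)]
  proof (intro nn_integral_mono mult_right_mono ennreal_leI)
    fix l :: real
    show "min t (distr_fn f l) \<le> measure unit_leb (B \<inter> {s \<in> {0..1}. l < \<bar>f s\<bar>})"
    proof (cases "l < r")
      case True
      then have "B \<inter> {s \<in> {0..1}. l < \<bar>f s\<bar>} = B" using B(3) by auto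
      then show ?thesis using B by simp
    next
      case False
      then have "B \<inter> {s \<in> {0..1}. l < \<bar>f s\<bar>} = {s \<in> {0..1}. l < \<bar>f s\<bar>}" using B(2) by auto
      then show ?thesis by (simp add: distr_fn_def)
    qed
  qed auto
  then show ?thesis using B that by blast
qed

section \<open>The Marcinkiewicz norm\<close>

lemma rep_L0_measurable [measurable]: "rep_L0 x \<in> borel_measurable unit_leb"
  using Quotient_rep_reflp[OF Quotient_L0, of x] by (simp add: ae_eq_def)

lemma rep_abs_L0:
  assumes "f \<in> borel_measurable unit_leb"
  shows "AE t in unit_leb. rep_L0 (abs_L0 f) t = f t"
proof -
  have "ae_eq (rep_L0 (abs_L0 f)) f"
    by (rule Quotient_rep_abs[OF Quotient_L0]) (use assms in \<open>simp add: ae_eq_def\<close>)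
  then show ?thesis by (simp add: ae_eq_def)
qed

lemma abs_rep_L0: "abs_L0 (rep_L0 x) = x"
  by (rule Quotient_abs_rep[OF Quotient_L0])

lemma ae_eq_rep_L0: "ae_eq (rep_L0 x) (rep_L0 x)"
  by (simp add: ae_eq_def rep_L0_measurable)

lemma L0_eqI:
  assumes "AE t in unit_leb. rep_L0 x t = rep_L0 y t"
  shows "x = y"
  using Quotient_rel_rep[OF Quotient_L0, of x y] assms by (simp add: ae_eq_def rep_L0_measurable)

lemma rep_L0_zero: "AE t in unit_leb. rep_L0 0 t = 0"
  unfolding zero_L0_def by (rule rep_abs_L0) auto

lemma rep_L0_plus: "AE t in unit_leb. rep_L0 (x + y) t = rep_L0 x t + rep_L0 y t"
  using rep_abs_L0[of "\<lambda>t. rep_L0 x t + rep_L0 y t"] plus_L0.abs_eq[OF ae_eq_rep_L0[of x] ae_eq_rep_L0[of y]]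
  by (simp add: abs_rep_L0)

lemma rep_L0_minus: "AE t in unit_leb. rep_L0 (x - y) t = rep_L0 x t - rep_L0 y t"
  using rep_abs_L0[of "\<lambda>t. rep_L0 x t - rep_L0 y t"] minus_L0.abs_eq[OF ae_eq_rep_L0[of x] ae_eq_rep_L0[of y]]
  by (simp add: abs_rep_L0)

lemma rep_L0_times: "AE t in unit_leb. rep_L0 (x * y) t = rep_L0 x t * rep_L0 y t"
  using rep_abs_L0[of "\<lambda>t. rep_L0 x t * rep_L0 y t"] times_L0.abs_eq[OF ae_eq_rep_L0[of x] ae_eq_rep_L0[of y]]
  by (simp add: abs_rep_L0)

lemma rep_L0_scaleR: "AE t in unit_leb. rep_L0 (c *\<^sub>R x) t = c * rep_L0 x t"
  using rep_abs_L0[of "\<lambda>t. c * rep_L0 x t"] scaleR_L0.abs_eq[OF ae_eq_rep_L0[of x], of c]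
  by (simp add: abs_rep_L0)

lemma rep_L0_sum: "finite F \<Longrightarrow> AE t in unit_leb. rep_L0 (\<Sum>i\<in>F. x i) t = (\<Sum>i\<in>F. rep_L0 (x i) t)"
proof (induction F rule: finite_induct)
  case empty
  show ?case using rep_L0_zero by simp
next
  case (insert i F)
  show ?case
    using insert.IH rep_L0_plus[of "x i" "\<Sum>i\<in>F. x i"] insert.hyps
    by (auto elim: eventually_elim2)
qed

instance L0 :: comm_ring
  by standard (transfer; auto simp: ae_eq_def algebra_simps)+

instance L0 :: real_algebra
  by standard (transfer; auto simp: ae_eq_def algebra_simps)+

lemma weight_iff: "weight w \<longleftrightarrow> (AE t in unit_leb. 0 < rep_L0 w t)"
  using weight.abs_eq[OF ae_eq_rep_L0[of w]] by (simp add: abs_rep_L0)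

lemma ess_bounded_above_iff: "ess_bounded_above w \<longleftrightarrow> (\<exists>C. AE t in unit_leb. rep_L0 w t \<le> C)"
  using ess_bounded_above.abs_eq[OF ae_eq_rep_L0[of w]] by (simp add: abs_rep_L0)

lemma rep_L0_reciprocal: "AE t in unit_leb. rep_L0 (reciprocal w) t = 1 / rep_L0 w t"
  using rep_abs_L0[of "\<lambda>t. 1 / rep_L0 w t"] reciprocal.abs_eq[OF ae_eq_rep_L0[of w]]
  by (simp add: abs_rep_L0)

definition ind :: "real set \<Rightarrow> L0"
  where "ind A = abs_L0 (indicator A)"

lemma rep_L0_ind: "A \<in> sets unit_leb \<Longrightarrow> AE t in unit_leb. rep_L0 (ind A) t = indicator A t"
  unfolding ind_def by (rule rep_abs_L0) (rule borel_measurable_indicator)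

lemma ind_mult_ind:
  assumes "A \<in> sets unit_leb" "B \<in> sets unit_leb"
  shows "ind A * ind B = ind (A \<inter> B)"
  by (rule L0_eqI)
    (use rep_L0_times[of "ind A" "ind B"] rep_L0_ind[OF assms(1)] rep_L0_ind[OF assms(2)]
      rep_L0_ind[OF sets.Int[OF assms]] in eventually_elim; auto simp: indicator_def)

lemma ind_empty: "ind {} = 0"
  by (rule L0_eqI) (use rep_L0_ind[of "{}"] rep_L0_zero in \<open>auto elim: eventually_elim2\<close>)

text \<open>Summed pointwise with the total \<open>suminf\<close>; the value is informative only
  where the series of representatives converges.\<close>

definition L0_sum :: "(nat \<Rightarrow> L0) \<Rightarrow> L0"
  where "L0_sum z = abs_L0 (\<lambda>t. \<Sum>n. rep_L0 (z n) t)"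

lemma rep_L0_sum_inf: "AE t in unit_leb. rep_L0 (L0_sum z) t = (\<Sum>n. rep_L0 (z n) t)"
  unfolding L0_sum_def by (rule rep_abs_L0) measurable

text \<open>The Marcinkiewicz norm with averages over arbitrary measurable sets in place of averages
  of the rearrangement; see \<open>N_eq_set_norm\<close>. In this form subadditivity is immediate,
  even for countable sums.\<close>

definition set_norm :: "(real \<Rightarrow> real) \<Rightarrow> (real \<Rightarrow> ennreal) \<Rightarrow> ennreal"
  where "set_norm \<phi> g = (SUP B\<in>{B \<in> sets unit_leb. 0 < measure unit_leb B}.
    ennreal (\<phi> (measure unit_leb B) / measure unit_leb B) * (\<integral>\<^sup>+t\<in>B. g t \<partial>unit_leb))"

lemma set_norm_upper:
  assumes "B \<in> sets unit_leb" "0 < measure unit_leb B"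
  shows "ennreal (\<phi> (measure unit_leb B) / measure unit_leb B) * (\<integral>\<^sup>+t\<in>B. g t \<partial>unit_leb) \<le> set_norm \<phi> g"
  unfolding set_norm_def by (rule SUP_upper) (use assms in auto)

lemma set_norm_least:
  assumes "\<And>B. B \<in> sets unit_leb \<Longrightarrow> 0 < measure unit_leb B \<Longrightarrow>
    ennreal (\<phi> (measure unit_leb B) / measure unit_leb B) * (\<integral>\<^sup>+t\<in>B. g t \<partial>unit_leb) \<le> c"
  shows "set_norm \<phi> g \<le> c"
  unfolding set_norm_def by (rule SUP_least) (use assms in auto)

lemma set_norm_mono:
  assumes "AE t in unit_leb. f t \<le> g t"
  shows "set_norm \<phi> f \<le> set_norm \<phi> g"
proof (rule set_norm_least)
  fix B assume B: "B \<in> sets unit_leb" "0 < measure unit_leb B"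
  have "(\<integral>\<^sup>+t\<in>B. f t \<partial>unit_leb) \<le> (\<integral>\<^sup>+t\<in>B. g t \<partial>unit_leb)"
    by (rule nn_integral_mono_AE) (use assms in \<open>auto elim!: eventually_mono intro: mult_right_mono\<close>)
  then show "ennreal (\<phi> (measure unit_leb B) / measure unit_leb B) * (\<integral>\<^sup>+t\<in>B. f t \<partial>unit_leb) \<le> set_norm \<phi> g"
    using set_norm_upper[OF B] by (meson dual_order.trans mult_left_mono zero_le)
qed

lemma set_norm_suminf:
  assumes [measurable]: "\<And>n. g n \<in> borel_measurable unit_leb"
  shows "set_norm \<phi> (\<lambda>t. \<Sum>n. g n t) \<le> (\<Sum>n. set_norm \<phi> (g n))"
proof (rule set_norm_least)
  fix B assume B: "B \<in> sets unit_leb" "0 < measure unit_leb B"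
  have "(\<integral>\<^sup>+t\<in>B. (\<Sum>n. g n t) \<partial>unit_leb) = (\<Sum>n. \<integral>\<^sup>+t\<in>B. g n t \<partial>unit_leb)"
    unfolding ennreal_suminf_multc[symmetric]
    by (rule nn_integral_suminf) (use B in \<open>auto intro!: borel_measurable_times borel_measurable_indicator\<close>)
  then have "ennreal (\<phi> (measure unit_leb B) / measure unit_leb B) * (\<integral>\<^sup>+t\<in>B. (\<Sum>n. g n t) \<partial>unit_leb)
    = (\<Sum>n. ennreal (\<phi> (measure unit_leb B) / measure unit_leb B) * (\<integral>\<^sup>+t\<in>B. g n t \<partial>unit_leb))"
    by (simp only: ennreal_suminf_cmult)
  also have "\<dots> \<le> (\<Sum>n. set_norm \<phi> (g n))"
    by (intro suminf_le set_norm_upper[OF B]) auto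
  finally show "ennreal (\<phi> (measure unit_leb B) / measure unit_leb B) * (\<integral>\<^sup>+t\<in>B. (\<Sum>n. g n t) \<partial>unit_leb)
    \<le> (\<Sum>n. set_norm \<phi> (g n))" .
qed

locale parameter_fn =
  fixes \<phi> :: "real \<Rightarrow> real"
  assumes mono_phi: "mono_on {0..1} \<phi>"
    and concave_phi: "concave_on {0..1} \<phi>"
    and phi_0: "\<phi> 0 = 0"
    and phi_pos: "\<forall>t\<in>{0<..1}. 0 < \<phi> t"
begin

abbreviation N :: "L0 \<Rightarrow> ennreal" where "N \<equiv> marcinkiewicz_enorm \<phi>"

lemma phi_le: "0 \<le> s \<Longrightarrow> s \<le> t \<Longrightarrow> t \<le> 1 \<Longrightarrow> \<phi> s \<le> \<phi> t"
  using mono_phi by (auto simp: mono_on_def)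

lemma phi_nonneg: "0 \<le> s \<Longrightarrow> s \<le> 1 \<Longrightarrow> 0 \<le> \<phi> s"
  using phi_le[of 0 s] phi_0 by simp

lemma phi_gt_0: "0 < s \<Longrightarrow> s \<le> 1 \<Longrightarrow> 0 < \<phi> s"
  using phi_pos by simp

lemma phi_ratio:
  assumes "0 < s" "s \<le> t" "t \<le> 1"
  shows "\<phi> t / t \<le> \<phi> s / s"
proof -
  have "(1 - s/t) * \<phi> 0 + (s/t) * \<phi> t \<le> \<phi> ((1 - s/t) *\<^sub>R 0 + (s/t) *\<^sub>R t)"
  proof -
    have "0 \<in> {0..1::real}" "t \<in> {0..1}" "0 \<le> 1 - s/t" "0 \<le> s/t" "(1 - s/t) + s/t = 1"
      using assms by auto
    then show ?thesis
      using concave_phi unfolding concave_on_iff by blast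
  qed
  then show ?thesis using assms by (simp add: phi_0 field_simps)
qed

lemma phi_scale:
  assumes "0 \<le> s" "1 \<le> c" "c * s \<le> 1"
  shows "\<phi> (c * s) \<le> c * \<phi> s"
proof (cases "s = 0")
  case False
  then have "\<phi> (c * s) / (c * s) \<le> \<phi> s / s"
    using assms by (intro phi_ratio) (auto simp: mult_le_cancel_right1)
  then show ?thesis using False assms by (simp add: field_simps)
qed (simp add: phi_0)

text \<open>Over sets of measure \<open>t\<close> the largest integral of |x| equals the integral of
  the rearrangement over \<open>{0<..t}\<close>: one inequality is the bound valid for every set,
  the other is the extremal set.\<close>

lemma N_eq_set_norm: "N x = set_norm \<phi> (\<lambda>t. ennreal \<bar>rep_L0 x t\<bar>)"
proof -
  have eq: "N x = (SUP t\<in>{0<..1}. ennreal (\<phi> t) * maximal_rearrangement (rep_L0 x) t)"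
    using marcinkiewicz_enorm.abs_eq[OF ae_eq_rep_L0[of x], of \<phi>] by (simp add: abs_rep_L0)
  have mr: "ennreal (\<phi> t) * maximal_rearrangement (rep_L0 x) t
    = ennreal (\<phi> t / t) * (\<integral>\<^sup>+ s\<in>{0<..t}. ennreal (decr_rearrangement (rep_L0 x) s) \<partial>lborel)" if "0 < t" "t \<le> 1" for t
    using that phi_nonneg[of t] by (simp add: maximal_rearrangement_def mult.assoc[symmetric] ennreal_mult[symmetric])
  show ?thesis
  proof (rule antisym)
    show "N x \<le> set_norm \<phi> (\<lambda>t. ennreal \<bar>rep_L0 x t\<bar>)"
      unfolding eq
    proof (rule SUP_least)
      fix t :: real assume "t \<in> {0<..1}"
      then have t: "0 < t" "t \<le> 1" by auto
      obtain B where B: "B \<in> sets unit_leb" "measure unit_leb B = t"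
        "(\<integral>\<^sup>+s\<in>{0<..t}. ennreal (decr_rearrangement (rep_L0 x) s) \<partial>lborel) \<le> (\<integral>\<^sup>+s\<in>B. ennreal \<bar>rep_L0 x s\<bar> \<partial>unit_leb)"
        by (rule exists_set_nn_integral_decr_rearrangement[OF rep_L0_measurable t])
      have "ennreal (\<phi> t) * maximal_rearrangement (rep_L0 x) t
        \<le> ennreal (\<phi> t / t) * (\<integral>\<^sup>+s\<in>B. ennreal \<bar>rep_L0 x s\<bar> \<partial>unit_leb)"
        unfolding mr[OF t] using B(3) by (rule mult_left_mono) simp
      also have "\<dots> \<le> set_norm \<phi> (\<lambda>t. ennreal \<bar>rep_L0 x t\<bar>)"
        using set_norm_upper[OF B(1), of \<phi>] B(2) t by simp
      finally show "ennreal (\<phi> t) * maximal_rearrangement (rep_L0 x) t \<le> set_norm \<phi> (\<lambda>t. ennreal \<bar>rep_L0 x t\<bar>)" .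
    qed
    show "set_norm \<phi> (\<lambda>t. ennreal \<bar>rep_L0 x t\<bar>) \<le> N x"
    proof (rule set_norm_least)
      fix B assume B: "B \<in> sets unit_leb" "0 < measure unit_leb B"
      define t where "t = measure unit_leb B"
      have t: "0 < t" "t \<le> 1" using B measure_unit_leb_le_1 by (auto simp: t_def)
      have "ennreal (\<phi> t / t) * (\<integral>\<^sup>+s\<in>B. ennreal \<bar>rep_L0 x s\<bar> \<partial>unit_leb)
        \<le> ennreal (\<phi> t) * maximal_rearrangement (rep_L0 x) t"
        unfolding mr[OF t]
        by (intro mult_left_mono set_nn_integral_le_decr_rearrangement) (use B t in \<open>auto simp: t_def rep_L0_measurable\<close>)
      also have "\<dots> \<le> N x"
        unfolding eq by (rule SUP_upper) (use t in auto)
      finally show "ennreal (\<phi> (measure unit_leb B) / measure unit_leb B) * (\<integral>\<^sup>+s\<in>B. ennreal \<bar>rep_L0 x s\<bar> \<partial>unit_leb) \<le> N x"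
        by (simp add: t_def)
    qed
  qed
qed

lemma N_solid:
  assumes "AE t in unit_leb. \<bar>rep_L0 x t\<bar> \<le> \<bar>rep_L0 y t\<bar>"
  shows "N x \<le> N y"
  unfolding N_eq_set_norm by (rule set_norm_mono) (use assms in \<open>auto elim!: eventually_mono intro: ennreal_leI\<close>)

text \<open>Countable subadditivity combined with monotonicity; the triangle inequality and all
  later estimates of infinite sums come from it.\<close>

lemma N_suminf_le:
  assumes "AE t in unit_leb. ennreal \<bar>rep_L0 x t\<bar> \<le> (\<Sum>n. ennreal \<bar>rep_L0 (y n) t\<bar>)"
  shows "N x \<le> (\<Sum>n. N (y n))"
proof -
  have "N x \<le> set_norm \<phi> (\<lambda>t. \<Sum>n. ennreal \<bar>rep_L0 (y n) t\<bar>)"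
    unfolding N_eq_set_norm using assms by (rule set_norm_mono)
  also have "\<dots> \<le> (\<Sum>n. N (y n))"
    unfolding N_eq_set_norm by (rule set_norm_suminf) measurable
  finally show ?thesis .
qed

lemma N_zero [simp]: "N 0 = 0"
proof -
  have "N 0 \<le> set_norm \<phi> (\<lambda>_. 0)"
    unfolding N_eq_set_norm
    by (rule set_norm_mono) (use rep_L0_zero in \<open>auto elim: eventually_mono\<close>)
  moreover have "set_norm \<phi> (\<lambda>_. 0) \<le> 0"
    by (rule set_norm_least) simp
  ultimately show ?thesis using order_trans[of "N 0" _ 0] by simp
qed

lemma N_triangle: "N (x + y) \<le> N x + N y"
proof -
  \<comment> \<open>Two summands are treated as a countable sum padded with zeros.\<close>
  let ?z = "\<lambda>n::nat. if n = 0 then x else if n = 1 then y else 0"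
  have s: "(\<Sum>n. g n) = g 0 + g 1" if "\<And>n. n \<noteq> 0 \<Longrightarrow> n \<noteq> 1 \<Longrightarrow> g n = 0" for g :: "nat \<Rightarrow> ennreal"
    using suminf_finite[of "{0,1}" g] that by auto
  have "N (x + y) \<le> (\<Sum>n. N (?z n))"
  proof (rule N_suminf_le)
    show "AE t in unit_leb. ennreal \<bar>rep_L0 (x + y) t\<bar> \<le> (\<Sum>n. ennreal \<bar>rep_L0 (?z n) t\<bar>)"
      using rep_L0_plus[of x y] rep_L0_zero
      by eventually_elim (subst s; auto simp: ennreal_plus[symmetric] simp del: ennreal_plus intro!: ennreal_leI)
  qed
  also have "\<dots> = N x + N y"
    by (subst s) auto
  finally show ?thesis .
qed

lemma N_scaleR: "N (c *\<^sub>R x) = ennreal \<bar>c\<bar> * N x"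
proof -
  \<comment> \<open>Applied to \<open>1 / c\<close> and \<open>c *\<^sub>R x\<close>, this
    inequality also gives the reverse one.\<close>
  have le: "N (c *\<^sub>R x) \<le> ennreal \<bar>c\<bar> * N x" for c x
    unfolding N_eq_set_norm[of "c *\<^sub>R x"]
  proof (rule set_norm_least)
    fix B assume B: "B \<in> sets unit_leb" "0 < measure unit_leb B"
    have "(\<integral>\<^sup>+t\<in>B. ennreal \<bar>rep_L0 (c *\<^sub>R x) t\<bar> \<partial>unit_leb) = (\<integral>\<^sup>+t. ennreal \<bar>c\<bar> * (ennreal \<bar>rep_L0 x t\<bar> * indicator B t) \<partial>unit_leb)"
      using rep_L0_scaleR[of c x]
      by (intro nn_integral_cong_AE) (auto elim!: eventually_mono simp: abs_mult ennreal_mult mult.assoc)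
    also have "\<dots> = ennreal \<bar>c\<bar> * (\<integral>\<^sup>+t\<in>B. ennreal \<bar>rep_L0 x t\<bar> \<partial>unit_leb)"
      by (intro nn_integral_cmult borel_measurable_times_ennreal borel_measurable_indicator B) measurable
    finally have "ennreal (\<phi> (measure unit_leb B) / measure unit_leb B) * (\<integral>\<^sup>+t\<in>B. ennreal \<bar>rep_L0 (c *\<^sub>R x) t\<bar> \<partial>unit_leb)
      = ennreal \<bar>c\<bar> * (ennreal (\<phi> (measure unit_leb B) / measure unit_leb B) * (\<integral>\<^sup>+t\<in>B. ennreal \<bar>rep_L0 x t\<bar> \<partial>unit_leb))"
      by (simp add: ac_simps)
    also have "\<dots> \<le> ennreal \<bar>c\<bar> * N x"
      unfolding N_eq_set_norm by (intro mult_left_mono set_norm_upper B) simp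
    finally show "ennreal (\<phi> (measure unit_leb B) / measure unit_leb B) * (\<integral>\<^sup>+t\<in>B. ennreal \<bar>rep_L0 (c *\<^sub>R x) t\<bar> \<partial>unit_leb) \<le> ennreal \<bar>c\<bar> * N x" .
  qed
  show ?thesis
  proof (cases "c = 0")
    case False
    have "ennreal \<bar>c\<bar> * N x = ennreal \<bar>c\<bar> * N ((1 / c) *\<^sub>R (c *\<^sub>R x))" using False by simp
    also have "\<dots> \<le> ennreal \<bar>c\<bar> * (ennreal \<bar>1 / c\<bar> * N (c *\<^sub>R x))" by (intro mult_left_mono le) simp
    also have "\<dots> = N (c *\<^sub>R x)" using False by (simp add: mult.assoc[symmetric] ennreal_mult[symmetric])
    finally show ?thesis using le[of c x] by simp
  qed simp
qed

lemma N_sum_le: "finite F \<Longrightarrow> N (\<Sum>i\<in>F. x i) \<le> (\<Sum>i\<in>F. N (x i))"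
proof (induction F rule: finite_induct)
  case (insert i F)
  then show ?case using N_triangle[of "x i" "sum x F"] by (auto intro: order_trans add_left_mono)
qed simp

lemma N_minus_commute: "N (x - y) = N (y - x)"
  using N_scaleR[of "-1" "x - y"] by simp

lemma nn_integral_le_N: "ennreal (\<phi> 1) * (\<integral>\<^sup>+t. ennreal \<bar>rep_L0 x t\<bar> \<partial>unit_leb) \<le> N x"
proof -
  have "{0..1} \<in> sets unit_leb" by (simp add: sets_restrict_space_iff)
  then have "ennreal (\<phi> 1) * (\<integral>\<^sup>+t\<in>{0..1}. ennreal \<bar>rep_L0 x t\<bar> \<partial>unit_leb) \<le> N x"
    using set_norm_upper[of "{0..1}" \<phi>] measure_unit_leb_space unfolding N_eq_set_norm by simp
  moreover have "(\<integral>\<^sup>+t\<in>{0..1}. ennreal \<bar>rep_L0 x t\<bar> \<partial>unit_leb) = (\<integral>\<^sup>+t. ennreal \<bar>rep_L0 x t\<bar> \<partial>unit_leb)"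
    by (intro nn_integral_cong) auto
  ultimately show ?thesis by simp
qed

lemma N_eq_0_iff: "N x = 0 \<longleftrightarrow> x = 0"
proof
  assume "N x = 0"
  then have "ennreal (\<phi> 1) * (\<integral>\<^sup>+t. ennreal \<bar>rep_L0 x t\<bar> \<partial>unit_leb) = 0"
    using nn_integral_le_N[of x] by simp
  then have "(\<integral>\<^sup>+t. ennreal \<bar>rep_L0 x t\<bar> \<partial>unit_leb) = 0"
    using phi_gt_0[of 1] by (auto simp: ennreal_eq_0_iff)
  then have "AE t in unit_leb. ennreal \<bar>rep_L0 x t\<bar> = 0"
    by (subst (asm) nn_integral_0_iff_AE) auto
  then show "x = 0"
    using rep_L0_zero by (intro L0_eqI) (auto elim: eventually_elim2)
qed simp

text \<open>The norm dominates \<open>\<phi> 1\<close> times the integral, so the weighted series is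
  finite almost everywhere, and a positive factor does not affect convergence. The free weight
  \<open>v\<close> later measures convergence in the sum of the couple.\<close>

lemma AE_summable_L0:
  assumes "weight v" and fin: "(\<Sum>n. N (v * z n)) < \<infinity>"
  shows "AE t in unit_leb. summable (\<lambda>n. \<bar>rep_L0 (z n) t\<bar>)"
proof -
  have "ennreal (\<phi> 1) * (\<integral>\<^sup>+t. (\<Sum>n. ennreal \<bar>rep_L0 (v * z n) t\<bar>) \<partial>unit_leb)
    = (\<Sum>n. ennreal (\<phi> 1) * (\<integral>\<^sup>+t. ennreal \<bar>rep_L0 (v * z n) t\<bar> \<partial>unit_leb))"
    by (subst nn_integral_suminf) auto
  also have "\<dots> \<le> (\<Sum>n. N (v * z n))"
    by (intro suminf_le nn_integral_le_N) auto
  finally have "ennreal (\<phi> 1) * (\<integral>\<^sup>+t. (\<Sum>n. ennreal \<bar>rep_L0 (v * z n) t\<bar>) \<partial>unit_leb) < \<infinity>"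
    using fin by (rule le_less_trans)
  then have "(\<integral>\<^sup>+t. (\<Sum>n. ennreal \<bar>rep_L0 (v * z n) t\<bar>) \<partial>unit_leb) \<noteq> \<infinity>"
    using phi_gt_0[of 1] by (auto simp: ennreal_mult_less_top)
  then have "AE t in unit_leb. (\<Sum>n. ennreal \<bar>rep_L0 (v * z n) t\<bar>) \<noteq> \<infinity>"
    by (intro nn_integral_PInf_AE) auto
  moreover have "AE t in unit_leb. \<forall>n. rep_L0 (v * z n) t = rep_L0 v t * rep_L0 (z n) t"
    by (subst AE_all_countable) (auto intro: rep_L0_times)
  moreover have "AE t in unit_leb. 0 < rep_L0 v t"
    using assms(1) by (simp add: weight_iff)
  ultimately show ?thesis
  proof eventually_elim
    fix t assume t: "(\<Sum>n. ennreal \<bar>rep_L0 (v * z n) t\<bar>) \<noteq> \<infinity>"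
      "\<forall>n. rep_L0 (v * z n) t = rep_L0 v t * rep_L0 (z n) t" "0 < rep_L0 v t"
    have "summable (\<lambda>n. \<bar>rep_L0 (v * z n) t\<bar>)"
      using t(1) by (intro summable_suminf_not_top) auto
    then show "summable (\<lambda>n. \<bar>rep_L0 (z n) t\<bar>)"
      using t(2,3) by (simp add: abs_mult summable_cmult_iff)
  qed
qed

text \<open>The limit is formed pointwise, without reference to a norm, so one limit can be
  estimated with different multipliers \<open>u\<close>: indicators, the weight, or products of
  both.\<close>

lemma N_L0_sum_le:
  assumes "AE t in unit_leb. summable (\<lambda>n. \<bar>rep_L0 (z n) t\<bar>)"
  shows "N (u * (L0_sum z - (\<Sum>j<m. z j))) \<le> (\<Sum>j. N (u * z (j + m)))"
proof (rule N_suminf_le)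
  have "AE t in unit_leb. \<forall>j. rep_L0 (u * z (j + m)) t = rep_L0 u t * rep_L0 (z (j + m)) t"
    by (subst AE_all_countable) (auto intro: rep_L0_times)
  then show "AE t in unit_leb. ennreal \<bar>rep_L0 (u * (L0_sum z - (\<Sum>j<m. z j))) t\<bar>
    \<le> (\<Sum>j. ennreal \<bar>rep_L0 (u * z (j + m)) t\<bar>)"
    using assms rep_L0_times[of u "L0_sum z - (\<Sum>j<m. z j)"] rep_L0_minus[of "L0_sum z" "\<Sum>j<m. z j"]
      rep_L0_sum[of "{..<m}" z, OF finite_lessThan] rep_L0_sum_inf[of z]
  proof eventually_elim
    case (elim t)
    have s: "summable (\<lambda>n. rep_L0 (z n) t)"
      using elim(2) by (rule summable_rabs_cancel)
    have s': "summable (\<lambda>j. \<bar>rep_L0 (z (j + m)) t\<bar>)"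
      using elim(2) by (rule summable_ignore_initial_segment)
    have "rep_L0 (u * (L0_sum z - (\<Sum>j<m. z j))) t = rep_L0 u t * (\<Sum>j. rep_L0 (z (j + m)) t)"
      using elim suminf_split_initial_segment[OF s, of m] by simp
    then have "\<bar>rep_L0 (u * (L0_sum z - (\<Sum>j<m. z j))) t\<bar> \<le> \<bar>rep_L0 u t\<bar> * (\<Sum>j. \<bar>rep_L0 (z (j + m)) t\<bar>)"
      using summable_rabs[OF s'] by (simp add: abs_mult mult_left_mono)
    also have "\<dots> = (\<Sum>j. \<bar>rep_L0 u t\<bar> * \<bar>rep_L0 (z (j + m)) t\<bar>)"
      by (rule suminf_mult[symmetric, OF s'])
    finally have "ennreal \<bar>rep_L0 (u * (L0_sum z - (\<Sum>j<m. z j))) t\<bar> \<le> ennreal (\<Sum>j. \<bar>rep_L0 u t\<bar> * \<bar>rep_L0 (z (j + m)) t\<bar>)"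
      by (rule ennreal_leI)
    also have "\<dots> = (\<Sum>j. ennreal (\<bar>rep_L0 u t\<bar> * \<bar>rep_L0 (z (j + m)) t\<bar>))"
      by (rule suminf_ennreal2[symmetric]) (use s' in \<open>auto intro: summable_mult\<close>)
    finally show ?case using elim(1) by (simp add: abs_mult)
  qed
qed

end

section \<open>Almost slowly varying functions\<close>

definition almost_slowly_varying :: "(real \<Rightarrow> real) \<Rightarrow> bool"
  where "almost_slowly_varying \<phi> \<longleftrightarrow>
    (\<exists>C. \<forall>n::nat. \<exists>d>0. \<forall>s::real. 0 < s \<longrightarrow> s \<le> d \<longrightarrow> n * s \<le> 1 \<longrightarrow> \<phi> (n * s) \<le> C * \<phi> s)"

context parameter_fn
begin

text \<open>A quotient tending to 1 is eventually below 2, and passing from \<phi> to \<psi> and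
  back costs the factor \<open>C1 * C2\<close>, which does not depend on \<open>n\<close>.\<close>

lemma almost_slowly_varying_if_regularly_varying:
  assumes "quasi_concave \<psi>" "regularly_varying_order_infinity \<psi>" "equivalent_functions \<phi> \<psi>"
  shows "almost_slowly_varying \<phi>"
proof -
  obtain C1 C2 where C1: "\<And>t. t \<in> {0..1} \<Longrightarrow> \<phi> t \<le> C1 * \<psi> t" and C2: "\<And>t. t \<in> {0..1} \<Longrightarrow> \<psi> t \<le> C2 * \<phi> t"
    using assms(3) unfolding equivalent_functions_def by blast
  have psi: "0 \<le> \<psi> t" if "t \<in> {0..1}" for t using assms(1) that by (auto simp: quasi_concave_def)
  have C1_pos: "0 < C1"
  proof (rule ccontr)
    assume "\<not> 0 < C1"
    then have "C1 * \<psi> 1 \<le> 0" using psi[of 1] by (simp add: mult_nonpos_nonneg)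
    then show False using C1[of 1] phi_gt_0[of 1] by simp
  qed
  have psi_pos: "0 < \<psi> t" if "0 < t" "t \<le> 1" for t
    using C1[of t] phi_gt_0[of t] psi[of t] that by (cases "\<psi> t = 0") auto
  show ?thesis
    unfolding almost_slowly_varying_def
  proof (rule exI[of _ "C1 * 2 * C2"], rule allI)
    fix n :: nat
    show "\<exists>d>0. \<forall>s::real. 0 < s \<longrightarrow> s \<le> d \<longrightarrow> n * s \<le> 1 \<longrightarrow> \<phi> (n * s) \<le> C1 * 2 * C2 * \<phi> s"
    proof (cases "n = 0")
      case True
      have "0 < C2 * \<phi> 1" using C2[of 1] psi_pos[of 1] by simp
      then have "0 < C2" using phi_gt_0[of 1] by (simp add: zero_less_mult_iff)
      show ?thesis
        using True phi_nonneg \<open>0 < C2\<close> C1_pos phi_0 by (intro exI[of _ 1]) auto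
    next
      case False
      then have "((\<lambda>t::real. \<psi> (t * n) / \<psi> t) \<longlongrightarrow> 1) (at_right 0)"
        using assms(2) by (simp add: regularly_varying_order_infinity_def)
      then have "\<forall>\<^sub>F t::real in at_right 0. \<psi> (t * n) / \<psi> t < 2"
        by (rule order_tendstoD) simp
      then obtain d where d: "0 < d" "\<And>t::real. 0 < t \<Longrightarrow> t < d \<Longrightarrow> \<psi> (t * n) / \<psi> t < 2"
        by (auto simp: eventually_at_right_field)
      show ?thesis
      proof (intro exI[of _ "min (d/2) 1"] conjI allI impI)
        fix s :: real assume s: "0 < s" "s \<le> min (d/2) 1" "real n * s \<le> 1"
        have "\<psi> (n * s) \<le> 2 * \<psi> s"
          using d(2)[of s] s d(1) psi_pos[of s] by (simp add: field_simps)
        moreover have "\<phi> (n * s) \<le> C1 * \<psi> (n * s)" using C1[of "n * s"] s by auto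
        moreover have "\<psi> s \<le> C2 * \<phi> s" using C2[of s] s by auto
        ultimately have "\<phi> (n * s) \<le> C1 * (2 * (C2 * \<phi> s))"
          using C1_pos by (smt (verit) mult_left_mono)
        then show "\<phi> (n * s) \<le> C1 * 2 * C2 * \<phi> s" by (simp add: mult.assoc)
      qed (use d in auto)
    qed
  qed
qed

text \<open>For given \<open>a\<close> take \<open>n\<close> with \<open>C \<le> n powr a\<close>
  and iterate \<open>\<phi> s \<le> C * \<phi> (s / n)\<close>. The cost \<open>C\<close> of a full
  step is absorbed by the growth of \<open>(s / t) powr a\<close>; only the last partial step leaves
  a factor \<open>C\<close>, so the constant is independent of \<open>a\<close>.\<close>

lemma almost_slowly_varying_power_bound:
  assumes "almost_slowly_varying \<phi>"
  obtains C where "1 \<le> C"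
    "\<And>a. 0 < a \<Longrightarrow> \<exists>d>0. d \<le> 1 \<and> (\<forall>s t. 0 < t \<longrightarrow> t \<le> s \<longrightarrow> s \<le> d \<longrightarrow> \<phi> s \<le> C * (s / t) powr a * \<phi> t)"
proof -
  obtain C0 where C0: "\<And>n::nat. \<exists>d>0. \<forall>s::real. 0 < s \<longrightarrow> s \<le> d \<longrightarrow> n * s \<le> 1 \<longrightarrow> \<phi> (n * s) \<le> C0 * \<phi> s"
    using assms unfolding almost_slowly_varying_def by blast
  define C where "C = max C0 1"
  have "\<exists>d>0. d \<le> 1 \<and> (\<forall>s t. 0 < t \<longrightarrow> t \<le> s \<longrightarrow> s \<le> d \<longrightarrow> \<phi> s \<le> C * (s / t) powr a * \<phi> t)" if a: "0 < a" for a :: real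
  proof -
    obtain n0 :: nat where n0: "C powr (1 / a) < n0" using reals_Archimedean2 by blast
    define n where "n = max n0 2"
    have n: "2 \<le> n" "C powr (1 / a) \<le> n" using n0 by (auto simp: n_def)
    have nC: "C \<le> n powr a"
    proof -
      have "(C powr (1 / a)) powr a \<le> n powr a" using n a by (intro powr_mono2) auto
      then show ?thesis using a by (simp add: powr_powr C_def)
    qed
    from C0[of n] obtain d where
      d0: "d > 0 \<and> (\<forall>s::real. 0 < s \<longrightarrow> s \<le> d \<longrightarrow> n * s \<le> 1 \<longrightarrow> \<phi> (n * s) \<le> C0 * \<phi> s)" by (rule exE)
    then have d: "0 < d" "\<And>s::real. 0 < s \<Longrightarrow> s \<le> d \<Longrightarrow> n * s \<le> 1 \<Longrightarrow> \<phi> (n * s) \<le> C0 * \<phi> s"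
      by simp_all
    have d': "\<phi> s \<le> C * \<phi> (s / n)" if "0 < s" "s \<le> min d 1" for s
    proof -
      have sn: "0 < s / n" "s / n \<le> s" using n that by (auto simp: field_simps)
      then have "\<phi> (n * (s / n)) \<le> C0 * \<phi> (s / n)" using that n by (intro d) auto
      also have "\<dots> \<le> C * \<phi> (s / n)" using sn that by (intro mult_right_mono phi_nonneg) (auto simp: C_def)
      finally show ?thesis using n by simp
    qed
    \<comment> \<open>Induction on the number of scales of ratio \<open>n\<close> that separate
      \<open>t\<close> from \<open>s\<close>.\<close>
    have bd: "\<phi> s \<le> C * (s / t) powr a * \<phi> t" if "0 < t" "t \<le> s" "s \<le> min d 1" "s < n ^ j * t" for s t :: real and j
      using that
    proof (induction j arbitrary: s)
      case 0 then show ?case by simp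
    next
      case (Suc j)
      have t: "0 \<le> \<phi> t" using Suc.prems by (intro phi_nonneg) auto
      show ?case
      proof (cases "s \<le> n * t")
        case True
        have "\<phi> s \<le> C * \<phi> (s / n)" using Suc.prems by (intro d') auto
        also have "\<dots> \<le> C * \<phi> t"
          using True n Suc.prems by (intro mult_left_mono phi_le) (auto simp: field_simps C_def)
        also have "C * \<phi> t \<le> C * (s / t) powr a * \<phi> t"
        proof -
          have "1 \<le> (s / t) powr a" using Suc.prems a by (intro ge_one_powr_ge_zero) auto
          then have "C * 1 \<le> C * (s / t) powr a" by (intro mult_left_mono) (auto simp: C_def)
          then show ?thesis using t by (intro mult_right_mono) auto
        qed
        finally show ?thesis .
      next
        case False
        have "\<phi> s \<le> C * \<phi> (s / n)" using Suc.prems by (intro d') auto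
        also have "\<dots> \<le> C * (C * (s / n / t) powr a * \<phi> t)"
        proof (intro mult_left_mono Suc.IH)
          have "s / n \<le> s / 1" using Suc.prems n by (intro divide_left_mono) auto
          then show "s / n \<le> min d 1" using Suc.prems by simp
        qed (use Suc.prems False n in \<open>auto simp: field_simps C_def\<close>)
        also have "(s / n / t) powr a = (s / t) powr a / n powr a"
          using Suc.prems n by (simp add: powr_divide powr_mult field_simps)
        also have "C * (C * ((s / t) powr a / n powr a) * \<phi> t) \<le> C * (s / t) powr a * \<phi> t"
        proof -
          have "C / n powr a \<le> 1" using nC n by simp
          then have "(C / n powr a) * (C * (s / t) powr a * \<phi> t) \<le> 1 * (C * (s / t) powr a * \<phi> t)"
            using t by (intro mult_right_mono) (auto simp: C_def)
          then show ?thesis by (simp add: mult_ac)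
        qed
        finally show ?thesis .
      qed
    qed
    show ?thesis
    proof (intro exI[of _ "min d 1"] conjI allI impI)
      fix s t assume st: "0 < t" "t \<le> s" "s \<le> min d 1"
      obtain j where "s / t < real n ^ j" using real_arch_pow[of n "s/t"] n by auto
      then show "\<phi> s \<le> C * (s / t) powr a * \<phi> t" using st by (intro bd[of t s j]) (auto simp: field_simps)
    qed (use d in auto)
  qed
  then show ?thesis using that[of C] by (simp add: C_def)
qed

text \<open>\<psi> is the supremum of \<open>\<phi> s * min 1 ((t / s) powr al k)\<close> over all
  \<open>k\<close> and all \<open>s \<le> \<tau> k\<close>, where \<open>\<tau> k\<close> delimits
  the range on which the power bound with exponent \<open>al k = 1 / (k + 1)\<close> is available.
  That bound keeps \<psi> below \<open>C * \<phi>\<close>, and exponents at most 1 make \<psi>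
  quasi-concave. Near zero only terms with large \<open>k\<close> matter, and a dilation by
  \<open>u\<close> raises these by at most \<open>u powr al k\<close>, which tends to 1.\<close>

lemma regularly_varying_if_almost_slowly_varying:
  assumes "almost_slowly_varying \<phi>"
  obtains \<psi> where "quasi_concave \<psi>" "regularly_varying_order_infinity \<psi>" "equivalent_functions \<phi> \<psi>"
proof -
  obtain C where C1: "1 \<le> C" and
    C: "\<And>a. 0 < a \<Longrightarrow> \<exists>d>0. d \<le> 1 \<and> (\<forall>s t. 0 < t \<longrightarrow> t \<le> s \<longrightarrow> s \<le> d \<longrightarrow> \<phi> s \<le> C * (s / t) powr a * \<phi> t)"
    using almost_slowly_varying_power_bound[OF assms] by blast
  define al :: "nat \<Rightarrow> real" where "al k = 1 / (k + 1)" for k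
  have al: "0 < al k" "al k \<le> 1" for k by (auto simp: al_def)
  have al_anti: "al k \<le> al j" if "j \<le> k" for j k using that by (auto simp: al_def frac_le)
  \<comment> \<open>The bound with exponent 1 is concavity itself and holds on the whole interval.
    Hence \<open>\<tau> 0 = 1\<close> is possible, and the term with \<open>k = 0\<close> and
    \<open>s = t\<close> gives \<open>\<phi> t \<le> \<psi> t\<close>.\<close>
  have "\<exists>d. 0 < d \<and> d \<le> 1 \<and> (k = 0 \<longrightarrow> d = 1) \<and>
    (\<forall>s t. 0 < t \<longrightarrow> t \<le> s \<longrightarrow> s \<le> d \<longrightarrow> \<phi> s \<le> C * (s / t) powr al k * \<phi> t)" for k
  proof (cases k)
    case 0
    have "\<phi> s \<le> C * (s / t) powr al 0 * \<phi> t" if "0 < t" "t \<le> s" "s \<le> 1" for s t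
    proof -
      have "\<phi> s \<le> 1 * ((s / t) * \<phi> t)" using phi_ratio[of t s] that by (simp add: field_simps)
      also have "\<dots> \<le> C * ((s / t) * \<phi> t)" using C1 that phi_nonneg[of t] by (intro mult_right_mono) auto
      finally show ?thesis using that by (simp add: al_def mult_ac)
    qed
    then show ?thesis using 0 by (intro exI[of _ 1]) auto
  qed (use C[OF al(1)] in auto)
  then obtain \<tau> where \<tau>: "\<And>k. 0 < \<tau> k" "\<And>k. \<tau> k \<le> 1" "\<tau> 0 = 1"
    "\<And>k s t. 0 < t \<Longrightarrow> t \<le> s \<Longrightarrow> s \<le> \<tau> k \<Longrightarrow> \<phi> s \<le> C * (s / t) powr al k * \<phi> t"
    by metis
  define e where "e k s t = \<phi> s * min 1 ((t / s) powr al k)" for k s t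
  define S where "S t = {e k s t | k s. 0 < s \<and> s \<le> \<tau> k}" for t
  define \<psi> where "\<psi> t = Sup (S t)" for t
  have phi0: "0 \<le> \<phi> s" if "0 < s" "s \<le> \<tau> k" for s k using that \<tau>(2)[of k] by (intro phi_nonneg) auto
  have bdd: "bdd_above (S t)" for t
  proof (rule bdd_aboveI[of _ "\<phi> 1"])
    fix x assume "x \<in> S t"
    then obtain k s where ks: "x = e k s t" "0 < s" "s \<le> \<tau> k" by (auto simp: S_def)
    have "x \<le> \<phi> s * 1" unfolding ks e_def by (rule mult_left_mono) (use phi0[OF ks(2,3)] in auto)
    also have "\<dots> \<le> \<phi> 1" using ks \<tau>(2)[of k] phi_le[of s 1] by simp
    finally show "x \<le> \<phi> 1" .
  qed
  have ne: "S t \<noteq> {}" for t using \<tau>(1) by (auto simp: S_def)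
  have up: "e k s t \<le> \<psi> t" if "0 < s" "s \<le> \<tau> k" for k s t
    unfolding \<psi>_def by (rule cSup_upper[OF _ bdd]) (use that in \<open>auto simp: S_def\<close>)
  have least: "\<psi> t \<le> c" if "\<And>k s. 0 < s \<Longrightarrow> s \<le> \<tau> k \<Longrightarrow> e k s t \<le> c" for t c
    unfolding \<psi>_def by (rule cSup_least[OF ne]) (use that in \<open>auto simp: S_def\<close>)
  have ge: "\<phi> t \<le> \<psi> t" if "0 < t" "t \<le> 1" for t
    using up[of t 0 t] that \<tau>(3) by (simp add: e_def)
  have le: "\<psi> t \<le> C * \<phi> t" if t: "0 < t" "t \<le> 1" for t
  proof (rule least)
    fix k s assume s: "0 < s" "s \<le> \<tau> k"
    show "e k s t \<le> C * \<phi> t"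
    proof (cases "s \<le> t")
      case True
      have "e k s t \<le> \<phi> s * 1" unfolding e_def by (rule mult_left_mono) (use phi0 s in auto)
      also have "\<dots> \<le> 1 * \<phi> t" using True s t phi_le by simp
      also have "\<dots> \<le> C * \<phi> t" using C1 phi_nonneg[of t] t by (intro mult_right_mono) auto
      finally show ?thesis .
    next
      case False
      have "e k s t \<le> \<phi> s * (t / s) powr al k" unfolding e_def by (rule mult_left_mono) (use phi0 s in auto)
      also have "\<dots> \<le> (C * (s / t) powr al k * \<phi> t) * (t / s) powr al k"
        using \<tau>(4)[of t s k] False s t by (intro mult_right_mono) auto
      also have "\<dots> = C * \<phi> t * ((s / t) powr al k * (t / s) powr al k)" by simp
      also have "(s / t) powr al k * (t / s) powr al k = 1"
        using s t by (simp add: powr_mult[symmetric])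
      finally show ?thesis by simp
    qed
  qed
  have psi0: "\<psi> 0 = 0"
    using least[of 0 0] up[of "\<tau> 0" 0 0] \<tau>(1) by (auto simp: e_def intro: antisym)
  have psi_pos: "0 < \<psi> t" if "0 < t" "t \<le> 1" for t
    using ge[OF that] phi_gt_0[OF that] by simp
  have psi_mono: "\<psi> s \<le> \<psi> t" if "0 \<le> s" "s \<le> t" for s t
  proof (rule least)
    fix k r assume r: "0 < r" "r \<le> \<tau> k"
    have "(s / r) powr al k \<le> (t / r) powr al k"
      using that r al[of k] by (intro powr_mono2) (auto simp: divide_right_mono)
    then have "e k r s \<le> e k r t"
      unfolding e_def by (intro mult_left_mono phi0[OF r]) auto
    also have "\<dots> \<le> \<psi> t" by (rule up[OF r])
    finally show "e k r s \<le> \<psi> t" .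
  qed
  have e_scale: "e k r (u * s) \<le> u powr al k * e k r s" if "0 < s" "1 \<le> u" "0 < r" "r \<le> \<tau> k" for k r u s
  proof -
    have u: "1 \<le> u powr al k" using that al[of k] by (intro ge_one_powr_ge_zero) auto
    have "(u * s / r) powr al k = u powr al k * (s / r) powr al k"
      using that by (simp add: powr_mult[symmetric])
    then have "min 1 ((u * s / r) powr al k) \<le> u powr al k * min 1 ((s / r) powr al k)"
      using u mult_mono[of 1 "u powr al k" 1 "(s / r) powr al k"] by (auto simp: min_def)
    then show ?thesis
      using mult_left_mono[OF _ phi0[OF that(3,4)]] by (simp add: e_def mult.left_commute)
  qed
  have qc: "quasi_concave \<psi>"
    unfolding quasi_concave_def
  proof (intro conjI ballI)
    show "0 \<le> \<psi> t" if "t \<in> {0..1}" for t using psi_mono[of 0 t] psi0 that by simp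
    show "\<psi> 0 = 0" by (rule psi0)
    show "mono_on {0..1} \<psi>" by (auto intro!: mono_onI psi_mono)
    show "antimono_on {0<..1} (\<lambda>t. \<psi> t / t)"
      unfolding monotone_on_def
    proof (intro ballI impI)
      fix s t :: real assume st: "s \<in> {0<..1}" "t \<in> {0<..1}" "s \<le> t"
      have "\<psi> t \<le> (t / s) * \<psi> s"
      proof (rule least)
        fix k r assume r: "0 < r" "r \<le> \<tau> k"
        have "e k r t = e k r ((t / s) * s)" using st by simp
        also have "\<dots> \<le> (t / s) powr al k * e k r s" by (rule e_scale) (use st r in auto)
        also have "\<dots> \<le> (t / s) powr 1 * e k r s"
          using st al[of k] phi0[OF r] by (intro mult_right_mono powr_mono) (auto simp: e_def)
        also have "\<dots> \<le> (t / s) * \<psi> s"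
          using st up[OF r, of s] by (auto intro: mult_left_mono divide_right_mono)
        finally show "e k r t \<le> (t / s) * \<psi> s" .
      qed
      then show "\<psi> t / t \<le> \<psi> s / s" using st by (simp add: field_simps)
    qed
  qed
  have equiv: "equivalent_functions \<phi> \<psi>"
    unfolding equivalent_functions_def
  proof (intro conjI exI ballI)
    fix t :: real assume t: "t \<in> {0..1}"
    show "\<phi> t \<le> 1 * \<psi> t" using ge[of t] t by (cases "t = 0") (auto simp: phi_0 psi0)
    show "\<psi> t \<le> C * \<phi> t" using le[of t] t by (cases "t = 0") (auto simp: phi_0 psi0)
  qed
  have small: "\<forall>\<^sub>F t in at_right 0. \<psi> (t * u) \<le> (1 + \<epsilon>) * \<psi> t" if u: "1 \<le> u" and eps: "0 < \<epsilon>" for u \<epsilon> :: real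
  proof -
    have "((\<lambda>k. u powr al k) \<longlongrightarrow> u powr 0) sequentially"
      unfolding al_def using u by (intro tendsto_powr tendsto_const) (auto intro!: LIMSEQ_Suc[OF lim_1_over_n, simplified] simp: add.commute)
    then have "\<forall>\<^sub>F k in sequentially. u powr al k < 1 + \<epsilon>"
      by (rule order_tendstoD) (use u eps in auto)
    then obtain K0 where K0: "\<And>k. K0 \<le> k \<Longrightarrow> u powr al k < 1 + \<epsilon>"
      by (auto simp: eventually_sequentially)
    \<comment> \<open>One index is kept in reserve: a term with \<open>k \<le> K0\<close> and
      \<open>s > \<tau> K\<close> is at most of order \<open>t powr al K0\<close>, negligible
      against \<open>\<phi> t\<close>, which is at least of order \<open>t powr al K\<close>. The
      constants of the two orders are \<open>A\<close> and \<open>B\<close>.\<close>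
    define K where "K = Suc K0"
    have K: "u powr al k < 1 + \<epsilon>" if "K \<le> k" for k using K0 that by (simp add: K_def)
    define A where "A = \<phi> 1 * (u / \<tau> K) powr al K0"
    define B where "B = \<phi> (\<tau> K) / (C * \<tau> K powr al K)"
    have tK: "0 < \<tau> K" "\<tau> K \<le> 1" using \<tau> by auto
    have B0: "0 < B" using C1 phi_gt_0[OF tK] tK by (auto simp: B_def)
    have "al K < al K0" by (auto simp: K_def al_def frac_less2)
    then have "((\<lambda>t. A * t powr (al K0 - al K)) \<longlongrightarrow> A * 0) (at_right 0)"
      by (intro tendsto_mult tendsto_const tendsto_zero_powrI[where b = "al K0 - al K"])
        (auto intro!: tendsto_ident_at eventually_at_right_less[THEN eventually_mono] simp: less_imp_le)
    then have "\<forall>\<^sub>F t in at_right 0. A * t powr (al K0 - al K) < B"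
      by (rule order_tendstoD) (use B0 in auto)
    moreover have "\<forall>\<^sub>F t in at_right 0. 0 < t \<and> t < \<tau> K / u"
      unfolding eventually_at_right_field using tK u by (intro exI[of _ "\<tau> K / u"]) auto
    ultimately show ?thesis
    proof eventually_elim
      fix t assume t1: "A * t powr (al K0 - al K) < B" and t2: "0 < t \<and> t < \<tau> K / u"
      then have t: "0 < t" "t * u < \<tau> K" using u by (auto simp: field_simps)
      have tle: "t \<le> \<tau> K" using t mult_left_mono[OF u, of t] by linarith
      have psi_t: "0 < \<psi> t" using t tle tK by (intro psi_pos) auto
      have main: "e k s (t * u) \<le> (1 + \<epsilon>) * \<psi> t" if s: "0 < s" "s \<le> \<tau> k" and k: "K \<le> k" for k s
      proof -
        have "e k s (t * u) \<le> u powr al k * e k s t"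
          using e_scale[of t u s k] s t u by (simp add: mult.commute)
        also have "\<dots> \<le> (1 + \<epsilon>) * \<psi> t"
          using K[OF k] up[OF s, of t] phi0[OF s] eps by (intro mult_mono) (auto simp: e_def)
        finally show ?thesis .
      qed
      show "\<psi> (t * u) \<le> (1 + \<epsilon>) * \<psi> t"
      proof (rule least)
        fix k s assume s: "0 < s" "s \<le> \<tau> k"
        have tus: "0 \<le> t * u / s" using t u s by simp
        consider "K \<le> k" | "k < K" "s \<le> \<tau> K" | "k < K" "\<tau> K < s" by linarith
        then show "e k s (t * u) \<le> (1 + \<epsilon>) * \<psi> t"
        proof cases
          case 1 then show ?thesis using main s by blast
        next
          \<comment> \<open>For \<open>s \<le> \<tau> K\<close> the pair of \<open>K\<close> and
            \<open>s\<close> takes part in the supremum as well, and its smaller exponent gives the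
            larger term.\<close>
          case 2
          have "min 1 ((t * u / s) powr al k) \<le> min 1 ((t * u / s) powr al K)"
          proof (cases "t * u / s \<le> 1")
            case True
            then have "(t * u / s) powr al k \<le> (t * u / s) powr al K"
              using 2 al_anti[of k K] tus by (intro powr_mono') auto
            then show ?thesis by auto
          next
            case False
            then have "1 \<le> (t * u / s) powr al K" using al[of K] by (intro ge_one_powr_ge_zero) auto
            then show ?thesis by auto
          qed
          then have "e k s (t * u) \<le> e K s (t * u)"
            unfolding e_def using phi0[OF s] by (intro mult_left_mono) auto
          also have "\<dots> \<le> (1 + \<epsilon>) * \<psi> t" using main[of s K] 2 s by simp
          finally show ?thesis .
        next
          case 3
          have "e k s (t * u) \<le> \<phi> s * (t * u / s) powr al k"
            unfolding e_def by (rule mult_left_mono) (use phi0 s in auto)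
          also have "\<dots> \<le> \<phi> 1 * (t * u / \<tau> K) powr al K0"
          proof (intro mult_mono)
            show "\<phi> s \<le> \<phi> 1" using s \<tau>(2)[of k] by (intro phi_le) auto
            have "(t * u / s) powr al k \<le> (t * u / s) powr al K0"
              using 3 al_anti[of k K0] tus t s by (intro powr_mono') (auto simp: K_def divide_le_eq_1)
            also have "\<dots> \<le> (t * u / \<tau> K) powr al K0"
              using 3 tus t u tK al[of K0] by (intro powr_mono2 divide_left_mono) (auto intro: less_imp_le)
            finally show "(t * u / s) powr al k \<le> (t * u / \<tau> K) powr al K0" .
          qed (use phi_nonneg[of 1] in auto)
          also have "\<dots> = A * t powr (al K0 - al K) * t powr al K"
            using t u tK by (simp add: A_def powr_add[symmetric] powr_mult powr_divide)
          also have "\<dots> \<le> B * t powr al K"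
            using t1 by (intro mult_right_mono) auto
          also have "\<dots> \<le> \<phi> t"
          proof -
            have "\<phi> (\<tau> K) \<le> C * (\<tau> K / t) powr al K * \<phi> t" using \<tau>(4)[of t "\<tau> K" K] t tle by auto
            then show ?thesis
              using C1 tK t by (simp add: B_def powr_divide field_simps)
          qed
          also have "\<dots> \<le> 1 * \<psi> t" using ge[of t] t tle tK by auto
          also have "\<dots> \<le> (1 + \<epsilon>) * \<psi> t" using eps psi_t by (intro mult_right_mono) auto
          finally show ?thesis .
        qed
      qed
    qed
  qed
  have lim1: "((\<lambda>t. \<psi> (t * u) / \<psi> t) \<longlongrightarrow> 1) (at_right 0)" if u: "1 \<le> u" for u
  proof (rule tendstoI)
    fix \<epsilon> :: real assume eps: "0 < \<epsilon>"
    have "\<forall>\<^sub>F t in at_right (0::real). 0 < t \<and> t < 1"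
      unfolding eventually_at_right_field by (intro exI[of _ 1]) auto
    moreover have "\<forall>\<^sub>F t in at_right 0. \<psi> (t * u) \<le> (1 + \<epsilon>/2) * \<psi> t" by (rule small[OF u]) (use eps in auto)
    ultimately show "\<forall>\<^sub>F t in at_right 0. dist (\<psi> (t * u) / \<psi> t) 1 < \<epsilon>"
    proof eventually_elim
      fix t assume t: "0 < t \<and> t < 1" "\<psi> (t * u) \<le> (1 + \<epsilon>/2) * \<psi> t"
      have p: "0 < \<psi> t" using t by (intro psi_pos) auto
      have "\<psi> t \<le> \<psi> (t * u)" using t u mult_left_mono[of 1 u t] by (intro psi_mono) auto
      then have "1 \<le> \<psi> (t * u) / \<psi> t" using p by simp
      moreover have "\<psi> (t * u) / \<psi> t \<le> 1 + \<epsilon>/2" using p t by (simp add: divide_le_eq)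
      ultimately show "dist (\<psi> (t * u) / \<psi> t) 1 < \<epsilon>" using eps by (simp add: dist_real_def)
    qed
  qed
  have "regularly_varying_order_infinity \<psi>"
    unfolding regularly_varying_order_infinity_def
  proof (intro allI impI)
    fix u :: real assume u: "0 < u"
    show "((\<lambda>t. \<psi> (t * u) / \<psi> t) \<longlongrightarrow> 1) (at_right 0)"
    proof (cases "1 \<le> u")
      \<comment> \<open>For \<open>u < 1\<close>, replace \<open>t\<close> by \<open>t * u\<close>
        in the limit for \<open>1 / u\<close> and invert.\<close>
      case False
      then have "((\<lambda>t. \<psi> (t * (1/u)) / \<psi> t) \<longlongrightarrow> 1) (at_right 0)" using u by (intro lim1) auto
      moreover have "filterlim (\<lambda>t. t * u) (at_right 0) (at_right 0)"
        unfolding filterlim_at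
      proof
        show "\<forall>\<^sub>F x in at_right 0. x * u \<in> {0<..} \<and> x * u \<noteq> 0"
          using eventually_at_right_less[of 0] by eventually_elim (use u in auto)
        show "((\<lambda>t. t * u) \<longlongrightarrow> 0) (at_right 0)" by (auto intro!: tendsto_eq_intros)
      qed
      ultimately have "((\<lambda>t. \<psi> (t * u * (1/u)) / \<psi> (t * u)) \<longlongrightarrow> 1) (at_right 0)"
        by (rule filterlim_compose)
      then have "((\<lambda>t. inverse (\<psi> (t * u * (1/u)) / \<psi> (t * u))) \<longlongrightarrow> inverse 1) (at_right 0)"
        by (rule tendsto_inverse) simp
      then show ?thesis using u by simp
    qed (rule lim1)
  qed
  then show ?thesis using that qc equiv by blast
qed

end

section \<open>The weak-type estimate\<close>

locale parameter_fn_index = parameter_fn +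
  assumes index: "upper_dilation_index \<phi> < 1"
begin

text \<open>Concavity bounds the dilation function by \<open>t\<close> for \<open>t > 1\<close>. If
  it were equal to \<open>t\<close> throughout, the quotient of logarithms would be constantly 1 and
  so would the index. A single \<open>t\<close> with strict inequality suffices, with
  \<open>r = 1 / t\<close>.\<close>

lemma dilation_contraction:
  obtains r \<theta> where "0 < r" "r < 1" "0 < \<theta>" "\<theta> < 1"
    "\<And>s. 0 < s \<Longrightarrow> s \<le> 1 \<Longrightarrow> \<phi> s \<le> \<theta> / r * \<phi> (r * s)"
proof -
  let ?S = "\<lambda>t. {\<phi> (s * t) / \<phi> s | s. s \<in> {0<..1} \<and> s * t \<in> {0<..1}}"
  have ub: "q \<le> t" if q: "q \<in> ?S t" and t: "1 < t" for q t :: real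
  proof -
    obtain s where s: "q = \<phi> (s * t) / \<phi> s" "0 < s" "s \<le> 1" "s * t \<le> 1" using q by auto
    have "\<phi> (t * s) \<le> t * \<phi> s" using s t by (intro phi_scale) (auto simp: mult.commute)
    then show ?thesis using s phi_gt_0[of s] by (simp add: divide_le_eq mult.commute)
  qed
  have bdd: "bdd_above (?S t)" if "1 < t" for t by (rule bdd_aboveI) (use ub that in blast)
  have le: "dilation_fun \<phi> t \<le> t" if t: "1 < t" for t
    unfolding dilation_fun_def
  proof (rule cSup_least)
    have "1 / t \<in> {0<..1} \<and> (1 / t) * t \<in> {0<..1}" using t by auto
    then show "?S t \<noteq> {}" by blast
  qed (use ub t in blast)
  have "\<exists>t>1. dilation_fun \<phi> t < t"
  proof (rule ccontr)
    assume "\<not> ?thesis"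
    then have eq: "dilation_fun \<phi> t = t" if "1 < t" for t using le that by (meson antisym not_less)
    have "\<forall>\<^sub>F t in at_top. ln (dilation_fun \<phi> t) / ln t = 1"
      using eventually_gt_at_top[of "1::real"] by eventually_elim (simp add: eq)
    then have "((\<lambda>t. ln (dilation_fun \<phi> t) / ln t) \<longlongrightarrow> 1) at_top"
      by (rule tendsto_eventually)
    then have "upper_dilation_index \<phi> = 1"
      unfolding upper_dilation_index_def by (intro tendsto_Lim) auto
    then show False using index by simp
  qed
  then obtain t where t: "1 < t" "dilation_fun \<phi> t < t" by blast
  have el: "\<phi> (s * t) / \<phi> s \<le> dilation_fun \<phi> t" if "0 < s" "s * t \<le> 1" for s
    unfolding dilation_fun_def
  proof (rule cSup_upper[OF _ bdd[OF t(1)]])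
    have "s * 1 \<le> s * t" using t that by (intro mult_left_mono) auto
    then have "s \<le> 1" using that by linarith
    then show "\<phi> (s * t) / \<phi> s \<in> ?S t" using that t by (auto intro!: exI[of _ s])
  qed
  \<comment> \<open>The maximum with 1/2 keeps \<theta> positive.\<close>
  define \<theta> where "\<theta> = max (dilation_fun \<phi> t / t) (1/2)"
  show ?thesis
  proof (rule that[of "1 / t" \<theta>])
    show "0 < 1 / t" "1 / t < 1" "0 < \<theta>" "\<theta> < 1" using t by (auto simp: \<theta>_def)
    fix s :: real assume s: "0 < s" "s \<le> 1"
    have st: "0 < s / t" "s / t \<le> 1" using s t by (auto simp: field_simps intro: order_trans)
    have "\<phi> s / \<phi> (s / t) \<le> dilation_fun \<phi> t" using el[of "s / t"] s t by simp
    also have "\<dots> \<le> \<theta> * t" using t by (auto simp: \<theta>_def field_simps max_def)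
    finally show "\<phi> s \<le> \<theta> / (1 / t) * \<phi> (1 / t * s)"
      using phi_gt_0[OF st] by (simp add: field_simps)
  qed
qed

text \<open>On the k-th interval of ratio \<open>r\<close> below \<open>t\<close>, the contraction
  iterated \<open>k + 1\<close> times bounds \<open>1 / \<phi> s\<close> by
  \<open>(\<theta> / r) ^ Suc k / \<phi> t\<close>. The length is at most \<open>r ^ k * t\<close>,
  so the powers of \<open>r\<close> cancel up to one factor and a geometric series in \<theta>
  remains.\<close>

lemma nn_integral_inverse_phi:
  obtains K where "0 < K"
    "\<And>t. 0 < t \<Longrightarrow> t \<le> 1 \<Longrightarrow> (\<integral>\<^sup>+s\<in>{0<..t}. ennreal (1 / \<phi> s) \<partial>lborel) \<le> ennreal (K * t / \<phi> t)"
proof -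
  obtain r \<theta> where r: "0 < r" "r < 1" and th: "0 < \<theta>" "\<theta> < 1"
    and c: "\<And>s. 0 < s \<Longrightarrow> s \<le> 1 \<Longrightarrow> \<phi> s \<le> \<theta> / r * \<phi> (r * s)"
    using dilation_contraction by metis
  define K where "K = \<theta> / r / (1 - \<theta>)"
  show ?thesis
  proof (rule that[of K])
    show "0 < K" using r th by (simp add: K_def)
    fix t :: real assume t: "0 < t" "t \<le> 1"
    have rt: "0 < r ^ k * t" "r ^ k * t \<le> 1" for k
    proof -
      show "0 < r ^ k * t" using r t by simp
      have "r ^ k * t \<le> 1 * 1" using r t by (intro mult_mono power_le_one) auto
      then show "r ^ k * t \<le> 1" by simp
    qed
    have pw: "\<phi> t \<le> (\<theta> / r) ^ k * \<phi> (r ^ k * t)" for k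
    proof (induction k)
      case (Suc k)
      have "\<phi> t \<le> (\<theta> / r) ^ k * \<phi> (r ^ k * t)" by (rule Suc.IH)
      also have "\<dots> \<le> (\<theta> / r) ^ k * (\<theta> / r * \<phi> (r * (r ^ k * t)))"
        using rt[of k] th r by (intro mult_left_mono c) auto
      finally show ?case by (simp add: mult_ac)
    qed simp
    define h where "h k = {r ^ Suc k * t<..r ^ k * t}" for k
    have "(\<integral>\<^sup>+s\<in>{0<..t}. ennreal (1 / \<phi> s) \<partial>lborel)
      \<le> (\<integral>\<^sup>+s. (\<Sum>k. ennreal ((\<theta> / r) ^ Suc k / \<phi> t) * indicator (h k) s) \<partial>lborel)"
    proof (rule nn_integral_mono)
      fix s :: real
      show "ennreal (1 / \<phi> s) * indicator {0<..t} s \<le> (\<Sum>k. ennreal ((\<theta> / r) ^ Suc k / \<phi> t) * indicator (h k) s)"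
      proof (cases "s \<in> {0<..t}")
        case True
        then have s: "0 < s" "s \<le> t" by auto
        obtain n0 where n0: "r ^ n0 < s / t" using real_arch_pow_inv[of "s / t" r] s t r by auto
        define n where "n = (LEAST n. r ^ n < s / t)"
        have n: "r ^ n < s / t" unfolding n_def by (rule LeastI[where P = "\<lambda>n. r ^ n < s / t", OF n0])
        have "n \<noteq> 0" using n s t by (auto simp: field_simps intro: ccontr)
        then obtain k where k: "n = Suc k" by (cases n) auto
        have "\<not> r ^ k < s / t" using not_less_Least[of k "\<lambda>n. r ^ n < s / t"] k by (simp add: n_def)
        then have sk: "s \<in> h k" using n k t by (auto simp: h_def field_simps)
        have "\<phi> t \<le> (\<theta> / r) ^ Suc k * \<phi> (r ^ Suc k * t)" by (rule pw)
        also have "\<dots> \<le> (\<theta> / r) ^ Suc k * \<phi> s"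
          using sk rt[of "Suc k"] s t th r by (intro mult_left_mono phi_le) (auto simp: h_def)
        finally have le: "\<phi> t \<le> (\<theta> / r) ^ Suc k * \<phi> s" .
        have "\<phi> t / (\<phi> s * \<phi> t) \<le> (\<theta> / r) ^ Suc k * \<phi> s / (\<phi> s * \<phi> t)"
          using phi_gt_0[of s] phi_gt_0[of t] s t by (intro divide_right_mono le) auto
        then have "1 / \<phi> s \<le> (\<theta> / r) ^ Suc k / \<phi> t"
          using phi_gt_0[of s] phi_gt_0[of t] s t by simp
        then have "ennreal (1 / \<phi> s) * indicator {0<..t} s \<le> ennreal ((\<theta> / r) ^ Suc k / \<phi> t) * indicator (h k) s"
          using sk by (auto simp: indicator_def intro!: ennreal_leI)
        also have "\<dots> \<le> (\<Sum>k. ennreal ((\<theta> / r) ^ Suc k / \<phi> t) * indicator (h k) s)"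
        proof -
          have "(\<Sum>i\<in>{k}. g i) \<le> (\<Sum>i. g i)" for g :: "nat \<Rightarrow> ennreal"
            by (rule sum_le_suminf) auto
          from this[of "\<lambda>k. ennreal ((\<theta> / r) ^ Suc k / \<phi> t) * indicator (h k) s"]
          show ?thesis by (simp only: sum.insert finite.emptyI empty_iff not_False_eq_True sum.empty add_0_right)
        qed
        finally show ?thesis .
      qed simp
    qed
    also have "\<dots> = (\<Sum>k. ennreal ((\<theta> / r) ^ Suc k / \<phi> t) * emeasure lborel (h k))"
      by (subst nn_integral_suminf) (auto simp: h_def nn_integral_cmult)
    also have "\<dots> \<le> (\<Sum>k. ennreal (\<theta> / r * t / \<phi> t * \<theta> ^ k))"
    proof (intro suminf_le)
      fix k
      have p: "0 < \<phi> t" by (rule phi_gt_0[OF t])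
      have "emeasure lborel (h k) \<le> ennreal (r ^ k * t)"
      proof -
        have "r ^ Suc k * t \<le> r ^ k * t" using r t by (simp add: power_decreasing)
        then have "emeasure lborel (h k) = ennreal (r ^ k * t - r ^ Suc k * t)" by (simp add: h_def)
        then show ?thesis using r t by (auto intro!: ennreal_leI)
      qed
      then have "ennreal ((\<theta> / r) ^ Suc k / \<phi> t) * emeasure lborel (h k) \<le> ennreal ((\<theta> / r) ^ Suc k / \<phi> t) * ennreal (r ^ k * t)"
        by (rule mult_left_mono) simp
      also have "\<dots> = ennreal ((\<theta> / r) ^ Suc k / \<phi> t * (r ^ k * t))"
        using p r t th by (subst ennreal_mult) auto
      also have "(\<theta> / r) ^ Suc k / \<phi> t * (r ^ k * t) = \<theta> / r * t / \<phi> t * \<theta> ^ k"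
        using r p by (simp add: power_divide field_simps)
      finally show "ennreal ((\<theta> / r) ^ Suc k / \<phi> t) * emeasure lborel (h k) \<le> ennreal (\<theta> / r * t / \<phi> t * \<theta> ^ k)" .
    qed auto
    also have "\<dots> = ennreal (\<Sum>k. \<theta> / r * t / \<phi> t * \<theta> ^ k)"
      using th r t phi_gt_0[OF t] by (intro suminf_ennreal2) (auto intro!: summable_mult summable_geometric)
    also have "(\<Sum>k. \<theta> / r * t / \<phi> t * \<theta> ^ k) = K * t / \<phi> t"
      using th by (subst suminf_mult) (auto simp: suminf_geometric K_def intro!: summable_geometric)
    finally show "(\<integral>\<^sup>+s\<in>{0<..t}. ennreal (1 / \<phi> s) \<partial>lborel) \<le> ennreal (K * t / \<phi> t)" .
  qed
qed

text \<open>The hypothesis says that the rearrangement is at most \<open>q / \<phi> s\<close>, and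
  the integral bound for \<open>1 / \<phi>\<close> turns this into a bound on averages. The converse
  estimate is \<open>N_lower\<close>.\<close>

lemma N_weak_type:
  obtains K where "0 < K"
    "\<And>x q. 0 \<le> q \<Longrightarrow> (\<And>l. 0 < l \<Longrightarrow> l * \<phi> (distr_fn (rep_L0 x) l) \<le> q) \<Longrightarrow> N x \<le> ennreal (K * q)"
proof -
  obtain K where K: "0 < K"
    "\<And>t. 0 < t \<Longrightarrow> t \<le> 1 \<Longrightarrow> (\<integral>\<^sup>+s\<in>{0<..t}. ennreal (1 / \<phi> s) \<partial>lborel) \<le> ennreal (K * t / \<phi> t)"
    using nn_integral_inverse_phi by blast
  show ?thesis
  proof (rule that[OF K(1)])
    fix x q assume q: "0 \<le> q" and w: "\<And>l. 0 < l \<Longrightarrow> l * \<phi> (distr_fn (rep_L0 x) l) \<le> q"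
    let ?f = "rep_L0 x"
    have star: "decr_rearrangement ?f s \<le> q / \<phi> s" if s: "0 < s" "s \<le> 1" for s
    proof (rule ccontr)
      assume "\<not> ?thesis"
      then obtain l where l: "q / \<phi> s < l" "l < decr_rearrangement ?f s" using dense not_le by blast
      have p: "0 < \<phi> s" by (rule phi_gt_0[OF s])
      have l0: "0 < l" using l(1) q p by (meson divide_nonneg_pos le_less_trans)
      have "s < distr_fn ?f l" using less_decr_rearrangement_iff[OF rep_L0_measurable s(1), of l] l l0 by simp
      then have "l * \<phi> s \<le> l * \<phi> (distr_fn ?f l)"
        using s l0 measure_unit_leb_le_1 by (intro mult_left_mono phi_le) (auto simp: distr_fn_def)
      also have "\<dots> \<le> q" by (rule w[OF l0])
      finally show False using l(1) p by (simp add: field_simps)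
    qed
    show "N x \<le> ennreal (K * q)"
      unfolding N_eq_set_norm
    proof (rule set_norm_least)
      fix B assume B: "B \<in> sets unit_leb" "0 < measure unit_leb B"
      define t where "t = measure unit_leb B"
      have t: "0 < t" "t \<le> 1" using B measure_unit_leb_le_1 by (auto simp: t_def)
      have p: "0 < \<phi> t" by (rule phi_gt_0[OF t])
      have meas: "(\<lambda>s. 1 / \<phi> s * indicator {0<..t} s) \<in> borel_measurable borel"
      proof -
        have "mono_on {0<..t} (\<lambda>s. - (1 / \<phi> s))"
          using t phi_gt_0 by (intro mono_onI) (auto intro!: divide_left_mono phi_le mult_pos_pos)
        then have "(\<lambda>s. - (- (1 / \<phi> s))) \<in> borel_measurable (restrict_space borel {0<..t})"
          by (intro borel_measurable_uminus borel_measurable_mono_on_fnc)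
        then show ?thesis
          by (subst (asm) borel_measurable_restrict_space_iff) (auto simp: mult.commute)
      qed
      have "(\<integral>\<^sup>+s\<in>B. ennreal \<bar>?f s\<bar> \<partial>unit_leb) \<le> (\<integral>\<^sup>+s\<in>{0<..t}. ennreal (decr_rearrangement ?f s) \<partial>lborel)"
        by (rule set_nn_integral_le_decr_rearrangement[OF rep_L0_measurable B(1) t(1)]) (simp add: t_def)
      also have "\<dots> \<le> (\<integral>\<^sup>+s. ennreal q * ennreal (1 / \<phi> s * indicator {0<..t} s) \<partial>lborel)"
      proof (rule nn_integral_mono)
        fix s show "ennreal (decr_rearrangement ?f s) * indicator {0<..t} s \<le> ennreal q * ennreal (1 / \<phi> s * indicator {0<..t} s)"
          using star[of s] t phi_gt_0[of s] q
          by (auto simp: indicator_def ennreal_mult[symmetric] intro!: ennreal_leI)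
      qed
      also have "\<dots> = ennreal q * (\<integral>\<^sup>+s. ennreal (1 / \<phi> s * indicator {0<..t} s) \<partial>lborel)"
        using meas by (intro nn_integral_cmult) auto
      also have "(\<integral>\<^sup>+s. ennreal (1 / \<phi> s * indicator {0<..t} s) \<partial>lborel) = (\<integral>\<^sup>+s\<in>{0<..t}. ennreal (1 / \<phi> s) \<partial>lborel)"
        by (intro nn_integral_cong) (auto simp: indicator_def)
      also have "ennreal q * \<dots> \<le> ennreal q * ennreal (K * t / \<phi> t)"
        by (intro mult_left_mono K(2) t) simp
      finally have "ennreal (\<phi> t / t) * (\<integral>\<^sup>+s\<in>B. ennreal \<bar>?f s\<bar> \<partial>unit_leb) \<le> ennreal (\<phi> t / t) * (ennreal q * ennreal (K * t / \<phi> t))"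
        by (intro mult_left_mono) auto
      also have "\<dots> = ennreal (K * q)"
        using p t q K(1) by (simp add: ennreal_mult[symmetric])
      finally show "ennreal (\<phi> (measure unit_leb B) / measure unit_leb B) * (\<integral>\<^sup>+s\<in>B. ennreal \<bar>?f s\<bar> \<partial>unit_leb) \<le> ennreal (K * q)"
        by (simp add: t_def)
    qed
  qed
qed

end

section \<open>Indicators and norming functionals\<close>

context parameter_fn
begin

lemma N_lower:
  assumes B: "B \<in> sets unit_leb" and l: "0 \<le> l" and ge: "\<And>t. t \<in> B \<Longrightarrow> l \<le> \<bar>rep_L0 x t\<bar>"
  shows "ennreal (l * \<phi> (measure unit_leb B)) \<le> N x"
proof (cases "measure unit_leb B = 0")
  case False
  define t where "t = measure unit_leb B"
  have t: "0 < t" "t \<le> 1" using False measure_unit_leb_le_1 by (auto simp: t_def less_le)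
  have "ennreal l * ennreal t \<le> (\<integral>\<^sup>+s\<in>B. ennreal \<bar>rep_L0 x s\<bar> \<partial>unit_leb)"
  proof -
    have "ennreal l * ennreal t = (\<integral>\<^sup>+s. ennreal l * indicator B s \<partial>unit_leb)"
      using B by (subst nn_integral_cmult_indicator) (auto simp: t_def unit_leb.emeasure_eq_measure)
    also have "\<dots> \<le> (\<integral>\<^sup>+s\<in>B. ennreal \<bar>rep_L0 x s\<bar> \<partial>unit_leb)"
      by (rule nn_integral_mono) (auto simp: indicator_def intro!: ennreal_leI ge)
    finally show ?thesis .
  qed
  then have "ennreal (\<phi> t / t) * (ennreal l * ennreal t) \<le> ennreal (\<phi> t / t) * (\<integral>\<^sup>+s\<in>B. ennreal \<bar>rep_L0 x s\<bar> \<partial>unit_leb)"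
    by (rule mult_left_mono) simp
  also have "\<dots> \<le> N x" unfolding N_eq_set_norm using set_norm_upper[of B \<phi>] B t by (simp add: t_def)
  also have "ennreal (\<phi> t / t) * (ennreal l * ennreal t) = ennreal (l * \<phi> t)"
    using t l phi_nonneg[of t] by (simp add: ennreal_mult[symmetric])
  finally show ?thesis by (simp add: t_def)
qed (simp add: phi_0)

lemma integrable_L0:
  assumes "N z < \<infinity>"
  shows "integrable unit_leb (rep_L0 z)"
proof (rule integrableI_bounded)
  have "ennreal (\<phi> 1) * (\<integral>\<^sup>+t. ennreal \<bar>rep_L0 z t\<bar> \<partial>unit_leb) < \<infinity>"
    using nn_integral_le_N assms by (rule le_less_trans)
  then show "(\<integral>\<^sup>+t. ennreal (norm (rep_L0 z t)) \<partial>unit_leb) < \<infinity>"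
    using phi_gt_0[of 1] by (auto simp: ennreal_mult_less_top)
qed (rule rep_L0_measurable)

text \<open>For a test set of measure \<open>b\<close> meeting \<open>A\<close> in measure
  \<open>c\<close>, \<open>\<phi> b / b\<close> is at most \<open>\<phi> c / c\<close>, so the
  intersection does at least as well; \<open>A\<close> itself attains the value.\<close>

lemma N_ind:
  assumes A: "A \<in> sets unit_leb"
  shows "N (ind A) = ennreal (\<phi> (measure unit_leb A))"
proof (rule antisym)
  show "N (ind A) \<le> ennreal (\<phi> (measure unit_leb A))"
    unfolding N_eq_set_norm
  proof (rule set_norm_least)
    fix B assume B: "B \<in> sets unit_leb" "0 < measure unit_leb B"
    define a b c where "a = measure unit_leb A" and "b = measure unit_leb B" and "c = measure unit_leb (A \<inter> B)"
    have le: "0 \<le> c" "c \<le> a" "c \<le> b" "0 < b" "b \<le> 1" "a \<le> 1"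
      using A B unit_leb.finite_measure_mono[of "A \<inter> B"] measure_unit_leb_le_1 by (auto simp: a_def b_def c_def)
    have "(\<integral>\<^sup>+t\<in>B. ennreal \<bar>rep_L0 (ind A) t\<bar> \<partial>unit_leb) = (\<integral>\<^sup>+t. indicator (A \<inter> B) t \<partial>unit_leb)"
      using rep_L0_ind[OF A] by (intro nn_integral_cong_AE) (auto elim!: eventually_mono simp: indicator_def)
    also have "\<dots> = ennreal c"
      using A B by (subst nn_integral_indicator) (auto simp: c_def unit_leb.emeasure_eq_measure)
    finally have "ennreal (\<phi> b / b) * (\<integral>\<^sup>+t\<in>B. ennreal \<bar>rep_L0 (ind A) t\<bar> \<partial>unit_leb) = ennreal (\<phi> b / b * c)"
      using le phi_nonneg[of b] by (subst ennreal_mult) auto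
    also have "\<phi> b / b * c \<le> \<phi> a"
    proof (cases "c = 0")
      case False
      have "\<phi> b / b * c \<le> \<phi> c / c * c" using le False by (intro mult_right_mono phi_ratio) auto
      also have "\<dots> \<le> \<phi> a" using False le by (simp add: phi_le)
      finally show ?thesis .
    qed (use le phi_nonneg in auto)
    finally show "ennreal (\<phi> (measure unit_leb B) / measure unit_leb B) * (\<integral>\<^sup>+t\<in>B. ennreal \<bar>rep_L0 (ind A) t\<bar> \<partial>unit_leb)
      \<le> ennreal (\<phi> (measure unit_leb A))"
      by (simp add: a_def b_def ennreal_leI)
  qed
  have eq: "N (ind A) = set_norm \<phi> (\<lambda>t. ennreal (indicator A t))"
    unfolding N_eq_set_norm
    by (intro antisym set_norm_mono; use rep_L0_ind[OF A] in \<open>auto elim: eventually_mono\<close>)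
  show "ennreal (\<phi> (measure unit_leb A)) \<le> N (ind A)"
  proof (cases "measure unit_leb A = 0")
    case False
    then have pos: "0 < measure unit_leb A" by (simp add: less_le)
    have "(\<integral>\<^sup>+t\<in>A. ennreal (indicator A t) \<partial>unit_leb) = (\<integral>\<^sup>+t. indicator A t \<partial>unit_leb)"
      by (intro nn_integral_cong) (auto simp: indicator_def)
    also have "\<dots> = ennreal (measure unit_leb A)"
      using A by (subst nn_integral_indicator) (auto simp: unit_leb.emeasure_eq_measure)
    finally have "ennreal (\<phi> (measure unit_leb A) / measure unit_leb A) * (\<integral>\<^sup>+t\<in>A. ennreal (indicator A t) \<partial>unit_leb)
      = ennreal (\<phi> (measure unit_leb A))"
      using pos phi_nonneg measure_unit_leb_le_1 by (simp add: ennreal_mult[symmetric])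
    then show ?thesis using set_norm_upper[OF A pos, of \<phi>] unfolding eq by metis
  qed (simp add: phi_0)
qed

end

context parameter_fn_index
begin

text \<open>The functional is explicit. The weak-type estimate yields a level \<open>l\<close> such
  that \<open>B\<close>, the part of \<open>A\<close> where |x| exceeds \<open>l\<close>, carries a
  fixed fraction of the norm of \<open>x\<close> on \<open>A\<close>. Integrate \<open>z\<close>
  against the sign of \<open>x\<close> over \<open>B\<close> and divide by the value at
  \<open>x\<close>, which is at least \<open>l * m\<close>.\<close>

lemma norming_functional:
  obtains K where "0 < K"
    "\<And>A x. A \<in> sets unit_leb \<Longrightarrow> N x < \<infinity> \<Longrightarrow> ind A * x \<noteq> 0 \<Longrightarrow>
      \<exists>g. (\<forall>z z'. N z < \<infinity> \<longrightarrow> N z' < \<infinity> \<longrightarrow> g (z + z') = g z + g z') \<and>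
        (\<forall>c z. N z < \<infinity> \<longrightarrow> g (c *\<^sub>R z) = c * g z) \<and> g x = 1 \<and>
        (\<forall>z. N z < \<infinity> \<longrightarrow> \<bar>g z\<bar> * enn2real (N (ind A * x)) \<le> K * enn2real (N (ind A * z)))"
proof -
  obtain K where K: "0 < K"
    "\<And>x q. 0 \<le> q \<Longrightarrow> (\<And>l. 0 < l \<Longrightarrow> l * \<phi> (distr_fn (rep_L0 x) l) \<le> q) \<Longrightarrow> N x \<le> ennreal (K * q)"
    using N_weak_type by blast
  show ?thesis
  proof (rule that[of "2 * K"])
    fix A x assume A: "A \<in> sets unit_leb" and x: "N x < \<infinity>" and nz: "ind A * x \<noteq> 0"
    have rep: "AE t in unit_leb. rep_L0 (ind A * y) t = indicator A t * rep_L0 y t" for y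
      using rep_L0_times[of "ind A" y] rep_L0_ind[OF A] by eventually_elim simp
    have Nle: "N (ind A * y) \<le> N y" for y
      by (rule N_solid) (use rep[of y] in \<open>auto elim!: eventually_mono simp: indicator_def\<close>)
    define n where "n = enn2real (N (ind A * x))"
    have fin: "N (ind A * x) < \<infinity>" using Nle x by (rule le_less_trans)
    then have Nn: "N (ind A * x) = ennreal n" by (simp add: n_def)
    have n: "0 < n" using nz N_eq_0_iff[of "ind A * x"] fin by (auto simp: n_def enn2real_positive_iff zero_less_iff_neq_zero)
    define f where "f = (\<lambda>t. indicator A t * rep_L0 x t)"
    have fm: "f \<in> borel_measurable unit_leb"
      unfolding f_def by (intro borel_measurable_times borel_measurable_indicator A rep_L0_measurable)
    have dist_eq: "distr_fn (rep_L0 (ind A * x)) l = distr_fn f l" for l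
    proof -
      have sp: "{s \<in> {0..1}. l < \<bar>z s\<bar>} = {s \<in> space unit_leb. l < \<bar>z s\<bar>}" for z :: "real \<Rightarrow> real" by simp
      show ?thesis
        unfolding distr_fn_def
        by (rule measure_eq_AE; (rule sets_greater_unit_leb)?)
          (use rep[of x] fm in \<open>auto elim: eventually_mono simp: f_def intro: rep_L0_measurable\<close>)
    qed
    \<comment> \<open>The factor 2 creates the contradiction: if no such level existed, the norm
      would be at most \<open>n / 2\<close>.\<close>
    have "\<exists>l>0. n / (2 * K) < l * \<phi> (distr_fn f l)"
    proof (rule ccontr)
      assume "\<not> ?thesis"
      then have "\<And>l. 0 < l \<Longrightarrow> l * \<phi> (distr_fn (rep_L0 (ind A * x)) l) \<le> n / (2 * K)"
        unfolding dist_eq by (meson not_less)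
      then have "N (ind A * x) \<le> ennreal (K * (n / (2 * K)))" by (intro K(2)) (use n K in auto)
      then show False using n K(1) unfolding Nn by (simp add: ennreal_le_iff)
    qed
    then obtain l where l: "0 < l" "n / (2 * K) < l * \<phi> (distr_fn f l)" by blast
    define B where "B = {s \<in> {0..1}. l < \<bar>f s\<bar>}"
    have B: "B \<in> sets unit_leb" "B \<subseteq> A"
      using sets_greater_unit_leb[OF fm] l by (auto simp: B_def f_def indicator_def split: if_splits)
    define m where "m = measure unit_leb B"
    have lm: "n / (2 * K) < l * \<phi> m" using l by (simp add: m_def B_def distr_fn_def)
    have m: "0 < m" "m \<le> 1"
    proof -
      have "m \<noteq> 0" using lm n K(1) by (auto simp: phi_0 field_simps)
      then show "0 < m" "m \<le> 1" using measure_unit_leb_le_1 by (auto simp: m_def less_le)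
    qed
    define h where "h z = (\<lambda>t. indicator B t * (sgn (rep_L0 x t) * rep_L0 z t))" for z
    have hm: "h z \<in> borel_measurable unit_leb" for z
    proof -
      have "(\<lambda>t. sgn (rep_L0 x t) * rep_L0 z t) \<in> borel_measurable unit_leb" by measurable
      then show ?thesis
        unfolding h_def using B(1) borel_measurable_indicator borel_measurable_times by blast
    qed
    have hint: "integrable unit_leb (h z)" if "N z < \<infinity>" for z
      by (rule Bochner_Integration.integrable_bound[OF integrable_L0[OF that] hm])
        (auto simp: h_def indicator_def abs_mult abs_sgn_eq)
    define I where "I z = (\<integral>t. h z t \<partial>unit_leb)" for z
    have I_add: "I (z + z') = I z + I z'" if "N z < \<infinity>" "N z' < \<infinity>" for z z'
    proof -
      have "I (z + z') = (\<integral>t. h z t + h z' t \<partial>unit_leb)"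
        unfolding I_def
        by (rule integral_cong_AE[OF hm borel_measurable_add[OF hm hm]])
          (use rep_L0_plus[of z z'] in \<open>auto elim!: eventually_mono simp: h_def algebra_simps\<close>)
      then show ?thesis using hint that by (simp add: I_def)
    qed
    have I_scale: "I (c *\<^sub>R z) = c * I z" for c z
    proof -
      have "I (c *\<^sub>R z) = (\<integral>t. c * h z t \<partial>unit_leb)"
        unfolding I_def
        by (rule integral_cong_AE[OF hm borel_measurable_times[OF borel_measurable_const hm]])
          (use rep_L0_scaleR[of c z] in \<open>auto elim!: eventually_mono simp: h_def algebra_simps\<close>)
      then show ?thesis by (simp add: I_def)
    qed
    have I_bound: "\<bar>I z\<bar> * \<phi> m \<le> m * enn2real (N (ind A * z))" if z: "N z < \<infinity>" for z
    proof -
      have Nz: "N (ind A * z) = ennreal (enn2real (N (ind A * z)))"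
        using le_less_trans[OF Nle z] by simp
      have "ennreal \<bar>I z\<bar> \<le> (\<integral>\<^sup>+t. ennreal (norm (h z t)) \<partial>unit_leb)"
        unfolding I_def using integral_norm_bound_ennreal[OF hint[OF z]] by simp
      also have "\<dots> \<le> (\<integral>\<^sup>+t\<in>B. ennreal \<bar>rep_L0 (ind A * z) t\<bar> \<partial>unit_leb)"
      proof (rule nn_integral_mono_AE)
        show "AE t in unit_leb. ennreal (norm (h z t)) \<le> ennreal \<bar>rep_L0 (ind A * z) t\<bar> * indicator B t"
          using rep[of z] by eventually_elim (use B(2) in \<open>auto simp: h_def indicator_def abs_mult abs_sgn_eq intro!: ennreal_leI\<close>)
      qed
      finally have "ennreal (\<phi> m / m) * ennreal \<bar>I z\<bar> \<le> ennreal (\<phi> m / m) * (\<integral>\<^sup>+t\<in>B. ennreal \<bar>rep_L0 (ind A * z) t\<bar> \<partial>unit_leb)"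
        by (rule mult_left_mono) simp
      also have "\<dots> \<le> N (ind A * z)"
        unfolding N_eq_set_norm using set_norm_upper[of B \<phi>] B m by (simp add: m_def)
      finally have "ennreal (\<phi> m / m * \<bar>I z\<bar>) \<le> N (ind A * z)"
        using m phi_nonneg[of m] by (subst ennreal_mult) auto
      then have "ennreal (\<phi> m / m * \<bar>I z\<bar>) \<le> ennreal (enn2real (N (ind A * z)))"
        by (rule ord_le_eq_trans[OF _ Nz])
      then have "\<phi> m / m * \<bar>I z\<bar> \<le> enn2real (N (ind A * z))"
        by (subst (asm) ennreal_le_iff) auto
      then show ?thesis using m by (simp add: field_simps)
    qed
    have I_x: "l * m \<le> I x"
    proof -
      have "B \<inter> {0..1} = B" by (auto simp: B_def)
      then have "l * m = (\<integral>t. l * indicator B t \<partial>unit_leb)"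
        by (simp add: m_def)
      also have "\<dots> \<le> I x"
        unfolding I_def
      proof (rule integral_mono)
        show "integrable unit_leb (\<lambda>t. l * indicator B t)"
          using B by (intro integrable_mult_right) (auto simp: unit_leb.emeasure_eq_measure)
        fix t
        have "l \<le> sgn (rep_L0 x t) * rep_L0 x t" if "t \<in> B"
          using that by (cases "t \<in> A") (auto simp: B_def f_def sgn_if)
        then show "l * indicator B t \<le> h x t" by (auto simp: h_def indicator_def)
      qed (rule hint[OF x])
      finally show ?thesis .
    qed
    then have Ixp: "0 < I x" using l m by (meson less_le_trans mult_pos_pos)
    show "\<exists>g. (\<forall>z z'. N z < \<infinity> \<longrightarrow> N z' < \<infinity> \<longrightarrow> g (z + z') = g z + g z') \<and>
        (\<forall>c z. N z < \<infinity> \<longrightarrow> g (c *\<^sub>R z) = c * g z) \<and> g x = 1 \<and>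
        (\<forall>z. N z < \<infinity> \<longrightarrow> \<bar>g z\<bar> * enn2real (N (ind A * x)) \<le> 2 * K * enn2real (N (ind A * z)))"
    proof (intro exI[of _ "\<lambda>z. I z / I x"] conjI allI impI)
      fix z assume z: "N z < \<infinity>"
      let ?a = "enn2real (N (ind A * z))"
      have "\<bar>I z / I x\<bar> * n \<le> \<bar>I z\<bar> / (l * m) * n"
        using Ixp I_x l m n by (auto simp: abs_divide intro!: mult_right_mono divide_left_mono)
      also have "\<dots> \<le> \<bar>I z\<bar> / (l * m) * (2 * K * (l * \<phi> m))"
        using lm K(1) l m by (intro mult_left_mono) (auto simp: field_simps)
      also have "\<dots> = 2 * K * (\<bar>I z\<bar> * \<phi> m / m)" using l by simp
      also have "\<dots> \<le> 2 * K * ?a"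
        using I_bound[OF z] m K(1) by (intro mult_left_mono) (auto simp: field_simps)
      finally show "\<bar>I z / I x\<bar> * enn2real (N (ind A * x)) \<le> 2 * K * ?a" by (simp add: n_def)
    qed (use Ixp I_add I_scale in \<open>auto simp: add_divide_distrib\<close>)
  qed (use K in auto)
qed

end

section \<open>Operators on the weighted couple\<close>

lemma L0_sum_add:
  assumes "AE t in unit_leb. summable (\<lambda>n. \<bar>rep_L0 (z n) t\<bar>)"
    and "AE t in unit_leb. summable (\<lambda>n. \<bar>rep_L0 (z' n) t\<bar>)"
  shows "L0_sum (\<lambda>n. z n + z' n) = L0_sum z + L0_sum z'"
proof (rule L0_eqI)
  have "AE t in unit_leb. \<forall>n. rep_L0 (z n + z' n) t = rep_L0 (z n) t + rep_L0 (z' n) t"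
    by (subst AE_all_countable) (auto intro: rep_L0_plus)
  then show "AE t in unit_leb. rep_L0 (L0_sum (\<lambda>n. z n + z' n)) t = rep_L0 (L0_sum z + L0_sum z') t"
    using assms rep_L0_sum_inf[of "\<lambda>n. z n + z' n"] rep_L0_sum_inf[of z] rep_L0_sum_inf[of z']
      rep_L0_plus[of "L0_sum z" "L0_sum z'"]
    by eventually_elim (simp add: suminf_add summable_rabs_cancel)
qed

lemma L0_sum_scaleR:
  assumes "AE t in unit_leb. summable (\<lambda>n. \<bar>rep_L0 (z n) t\<bar>)"
  shows "L0_sum (\<lambda>n. c *\<^sub>R z n) = c *\<^sub>R L0_sum z"
proof (rule L0_eqI)
  have "AE t in unit_leb. \<forall>n. rep_L0 (c *\<^sub>R z n) t = c * rep_L0 (z n) t"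
    by (subst AE_all_countable) (auto intro: rep_L0_scaleR)
  then show "AE t in unit_leb. rep_L0 (L0_sum (\<lambda>n. c *\<^sub>R z n)) t = rep_L0 (c *\<^sub>R L0_sum z) t"
    using assms rep_L0_sum_inf[of "\<lambda>n. c *\<^sub>R z n"] rep_L0_sum_inf[of z] rep_L0_scaleR[of c "L0_sum z"]
    by eventually_elim (simp add: suminf_mult summable_rabs_cancel)
qed

lemma L0_sum_finite_support:
  assumes "finite F" "\<And>n. n \<notin> F \<Longrightarrow> z n = 0"
  shows "L0_sum z = (\<Sum>n\<in>F. z n)"
proof (rule L0_eqI)
  have "AE t in unit_leb. \<forall>n. n \<notin> F \<longrightarrow> rep_L0 (z n) t = 0"
    by (subst AE_all_countable) (use assms rep_L0_zero in auto)
  then show "AE t in unit_leb. rep_L0 (L0_sum z) t = rep_L0 (\<Sum>n\<in>F. z n) t"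
    using rep_L0_sum_inf[of z] rep_L0_sum[OF assms(1), of z]
    by eventually_elim (use assms(1) in \<open>simp add: suminf_finite\<close>)
qed

lemma AE_unit: "AE t in unit_leb. t \<in> {0..1}"
  using AE_space[of unit_leb] by simp

lemma rep_L0_ind_times:
  assumes "A \<in> sets unit_leb"
  shows "AE t in unit_leb. rep_L0 (ind A * y) t = indicator A t * rep_L0 y t"
  using rep_L0_times[of "ind A" y] rep_L0_ind[OF assms] by eventually_elim simp

lemma ind_complement:
  assumes B: "B \<in> sets unit_leb"
  shows "ind B * u + ind ({0..1} - B) * u = u"
proof (rule L0_eqI)
  have C: "{0..1} - B \<in> sets unit_leb" using sets.compl_sets[OF B] by simp
  show "AE t in unit_leb. rep_L0 (ind B * u + ind ({0..1} - B) * u) t = rep_L0 u t"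
    using AE_unit rep_L0_ind_times[OF B, of u] rep_L0_ind_times[OF C, of u]
      rep_L0_plus[of "ind B * u" "ind ({0..1} - B) * u"]
    by eventually_elim (auto simp: indicator_def)
qed

lemma sets_unit_interval [simp]: "{0..1} \<in> sets unit_leb"
  by (simp add: sets_restrict_space_iff)

lemma ind_unit_mult [simp]: "ind {0..1} * z = z"
proof (rule L0_eqI)
  note AE_unit
  then show "AE t in unit_leb. rep_L0 (ind {0..1} * z) t = rep_L0 z t"
    using rep_L0_ind_times[OF sets_unit_interval, of z] by eventually_elim simp
qed

context parameter_fn
begin

lemma N_ind_lower:
  assumes A: "A \<in> sets unit_leb" and B: "B \<in> sets unit_leb" "B \<subseteq> A" and l: "0 \<le> l"
    and ge: "\<And>t. t \<in> B \<Longrightarrow> l \<le> \<bar>rep_L0 x t\<bar>"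
  shows "ennreal (l * \<phi> (measure unit_leb B)) \<le> N (ind A * x)"
proof -
  have "ennreal (l * \<phi> (measure unit_leb B)) = N (l *\<^sub>R ind B)"
    using l phi_nonneg[of "measure unit_leb B"] measure_unit_leb_le_1
    by (simp add: N_scaleR N_ind[OF B(1)] ennreal_mult)
  also have "\<dots> \<le> N (ind A * x)"
    by (rule N_solid)
      (use rep_L0_ind_times[OF A, of x] rep_L0_ind[OF B(1)] rep_L0_scaleR[of l "ind B"] in eventually_elim;
        use B(2) l ge in \<open>auto simp: indicator_def\<close>)
  finally show ?thesis .
qed

lemma N_ind_le: "A \<in> sets unit_leb \<Longrightarrow> N (ind A * x) \<le> N x"
  by (rule N_solid) (use rep_L0_ind_times[of A x] in \<open>auto elim!: eventually_mono simp: indicator_def\<close>)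

lemma AE_summable_N:
  assumes "(\<Sum>n. N (z n)) < \<infinity>"
  shows "AE t in unit_leb. summable (\<lambda>n. \<bar>rep_L0 (z n) t\<bar>)"
proof (rule AE_summable_L0[of "ind {0..1}"])
  from AE_unit rep_L0_ind[OF sets_unit_interval] show "weight (ind {0..1})"
    unfolding weight_iff by eventually_elim simp
qed (use assms in simp)

section \<open>The couple and its K-functional in terms of \<open>N\<close>\<close>

lemma pts_marcinkiewicz: "x \<in> pts (marcinkiewicz \<phi>) \<longleftrightarrow> N x < \<infinity>"
  and nrm_marcinkiewicz: "nrm (marcinkiewicz \<phi>) x = enn2real (N x)"
  and pts_weighted: "x \<in> pts (weighted (marcinkiewicz \<phi>) w) \<longleftrightarrow> N (x * w) < \<infinity>"
  and nrm_weighted: "nrm (weighted (marcinkiewicz \<phi>) w) x = enn2real (N (x * w))"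
  by (simp_all add: marcinkiewicz_def weighted_def)

lemma K_functional_upper:
  assumes "0 \<le> t" "N x0 < \<infinity>" "N (x1 * w) < \<infinity>"
  shows "K_functional t (x0 + x1) (marcinkiewicz \<phi>) (weighted (marcinkiewicz \<phi>) w)
    \<le> enn2real (N x0) + t * enn2real (N (x1 * w))"
  unfolding K_functional_def
proof (rule cInf_lower)
  show "bdd_below {nrm (marcinkiewicz \<phi>) y0 + t * nrm (weighted (marcinkiewicz \<phi>) w) y1 |y0 y1.
    y0 \<in> pts (marcinkiewicz \<phi>) \<and> y1 \<in> pts (weighted (marcinkiewicz \<phi>) w) \<and> x0 + x1 = y0 + y1}"
    using assms(1) by (intro bdd_belowI[of _ 0]) (auto simp: nrm_marcinkiewicz nrm_weighted)
qed (use assms in \<open>auto simp: pts_marcinkiewicz nrm_marcinkiewicz pts_weighted nrm_weighted\<close>)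

lemma K_functional_lower:
  assumes "x \<in> pts (couple_sum (marcinkiewicz \<phi>) (weighted (marcinkiewicz \<phi>) w))"
    and "\<And>x0 x1. N x0 < \<infinity> \<Longrightarrow> N (x1 * w) < \<infinity> \<Longrightarrow> x = x0 + x1 \<Longrightarrow> c \<le> enn2real (N x0) + t * enn2real (N (x1 * w))"
  shows "c \<le> K_functional t x (marcinkiewicz \<phi>) (weighted (marcinkiewicz \<phi>) w)"
  unfolding K_functional_def
proof (rule cInf_greatest)
  show "{nrm (marcinkiewicz \<phi>) y0 + t * nrm (weighted (marcinkiewicz \<phi>) w) y1 |y0 y1.
    y0 \<in> pts (marcinkiewicz \<phi>) \<and> y1 \<in> pts (weighted (marcinkiewicz \<phi>) w) \<and> x = y0 + y1} \<noteq> {}"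
    using assms(1) by (auto simp: couple_sum_def)
qed (use assms(2) in \<open>auto simp: pts_marcinkiewicz nrm_marcinkiewicz pts_weighted nrm_weighted\<close>)

lemma enn2real_N_triangle:
  assumes "N x < \<infinity>" "N y < \<infinity>"
  shows "enn2real (N (x + y)) \<le> enn2real (N x) + enn2real (N y)"
proof -
  have "enn2real (N (x + y)) \<le> enn2real (N x + N y)"
    using assms by (intro enn2real_mono N_triangle) auto
  then show ?thesis using assms by (simp add: enn2real_plus)
qed

lemma N_le_weighted:
  assumes "AE t in unit_leb. 1 \<le> rep_L0 w t"
  shows "N z \<le> N (z * w)"
proof (rule N_solid)
  show "AE t in unit_leb. \<bar>rep_L0 z t\<bar> \<le> \<bar>rep_L0 (z * w) t\<bar>"
    using assms rep_L0_times[of z w]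
    by eventually_elim (use mult_left_mono in \<open>fastforce simp: abs_mult\<close>)
qed

text \<open>For \<open>w \<ge> 1\<close> the weighted space lies inside the unweighted one, which is
  therefore the whole sum of the couple. This is why \<open>bounded_operator\<close> states
  linearity on elements with \<open>N x < \<infinity>\<close>.\<close>

lemma pts_couple_sum_ge_1:
  assumes w: "AE t in unit_leb. 1 \<le> rep_L0 w t"
  shows "x \<in> pts (couple_sum (marcinkiewicz \<phi>) (weighted (marcinkiewicz \<phi>) w)) \<longleftrightarrow> N x < \<infinity>"
proof
  assume "x \<in> pts (couple_sum (marcinkiewicz \<phi>) (weighted (marcinkiewicz \<phi>) w))"
  then obtain x0 x1 where x: "x = x0 + x1" "N x0 < \<infinity>" "N (x1 * w) < \<infinity>"
    by (auto simp: couple_sum_def pts_marcinkiewicz pts_weighted)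
  have "N x \<le> N x0 + N x1" unfolding x by (rule N_triangle)
  also have "\<dots> \<le> N x0 + N (x1 * w)" using N_le_weighted[OF w] by (rule add_left_mono)
  also have "\<dots> < \<infinity>" using x by simp
  finally show "N x < \<infinity>" .
next
  assume "N x < \<infinity>"
  then have "x \<in> pts (marcinkiewicz \<phi>) \<and> 0 \<in> pts (weighted (marcinkiewicz \<phi>) w) \<and> x = x + 0"
    by (simp add: pts_marcinkiewicz pts_weighted)
  then show "x \<in> pts (couple_sum (marcinkiewicz \<phi>) (weighted (marcinkiewicz \<phi>) w))"
    unfolding couple_sum_def nspace.simps mem_Collect_eq by blast
qed

section \<open>Operators with a common bound on both spaces, and infinite sums of them\<close>

definition bounded_operator :: "L0 \<Rightarrow> real \<Rightarrow> (L0 \<Rightarrow> L0) \<Rightarrow> bool"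
  where "bounded_operator w M T \<longleftrightarrow>
    (\<forall>x y. N x < \<infinity> \<longrightarrow> N y < \<infinity> \<longrightarrow> T (x + y) = T x + T y) \<and>
    (\<forall>c x. N x < \<infinity> \<longrightarrow> T (c *\<^sub>R x) = c *\<^sub>R T x) \<and>
    (\<forall>x. N x < \<infinity> \<longrightarrow> N (T x) \<le> ennreal M * N x) \<and>
    (\<forall>x. N (x * w) < \<infinity> \<longrightarrow> N (T x * w) \<le> ennreal M * N (x * w))"

lemma bounded_operatorD:
  assumes "bounded_operator w M T"
  shows "N x < \<infinity> \<Longrightarrow> N y < \<infinity> \<Longrightarrow> T (x + y) = T x + T y"
    and "N x < \<infinity> \<Longrightarrow> T (c *\<^sub>R x) = c *\<^sub>R T x"
    and "N x < \<infinity> \<Longrightarrow> N (T x) \<le> ennreal M * N x"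
    and "N (x * w) < \<infinity> \<Longrightarrow> N (T x * w) \<le> ennreal M * N (x * w)"
    and "N x < \<infinity> \<Longrightarrow> N (T x) < \<infinity>"
    and "N (x * w) < \<infinity> \<Longrightarrow> N (T x * w) < \<infinity>"
  using assms by (auto simp: bounded_operator_def ennreal_mult_less_top elim!: le_less_trans)

lemma bounded_operator_zero: "bounded_operator w M T \<Longrightarrow> T 0 = 0"
  using bounded_operatorD(2)[of w M T 0 0] by simp

text \<open>The bound on \<open>E\<close> obtained here is not controlled by \<open>M\<close>;
  supplying such control is the task of the gliding hump below.\<close>

lemma bounded_operator_bounded_on:
  assumes w: "AE t in unit_leb. 1 \<le> rep_L0 w t" and T: "bounded_operator w M T"
    and E: "interpolation_space E (marcinkiewicz \<phi>) (weighted (marcinkiewicz \<phi>) w)"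
  shows "maps_boundedly T E"
proof -
  let ?X = "marcinkiewicz \<phi>" and ?Y = "weighted (marcinkiewicz \<phi>) w"
  note D = bounded_operatorD[OF T]
  have pS: "x \<in> pts (couple_sum ?X ?Y) \<longleftrightarrow> N x < \<infinity>" for x by (rule pts_couple_sum_ge_1[OF w])
  have le: "enn2real a \<le> max M 0 * enn2real b" if "a \<le> ennreal M * b" "b < \<infinity>" for a b
  proof -
    have "enn2real a \<le> enn2real (ennreal M * b)"
      using that by (intro enn2real_mono) (auto simp: ennreal_mult_less_top)
    then show ?thesis by (cases "0 \<le> M") (auto simp: enn2real_mult ennreal_neg)
  qed
  have "linear_operator_on T (couple_sum ?X ?Y)"
    using D by (auto simp: linear_operator_on_def pS)
  moreover have "maps_boundedly T ?X"
    unfolding maps_boundedly_def using D le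
    by (auto simp: pts_marcinkiewicz nrm_marcinkiewicz intro!: exI[of _ "max M 0"])
  moreover have "maps_boundedly T ?Y"
    unfolding maps_boundedly_def using D le
    by (auto simp: pts_weighted nrm_weighted intro!: exI[of _ "max M 0"])
  ultimately show ?thesis using E unfolding interpolation_space_def by blast
qed

text \<open>The weights make every uniformly bounded sequence of operators summable, with at most
  twice the common bound on either space.\<close>

definition op_sum :: "(nat \<Rightarrow> L0 \<Rightarrow> L0) \<Rightarrow> L0 \<Rightarrow> L0"
  where "op_sum S x = L0_sum (\<lambda>n. (1 / 2 ^ n) *\<^sub>R S n x)"

context
  fixes w :: L0 and M :: real and S :: "nat \<Rightarrow> L0 \<Rightarrow> L0"
  assumes w: "AE t in unit_leb. 1 \<le> rep_L0 w t"
    and S: "\<And>n. bounded_operator w M (S n)" and M: "0 \<le> M"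
begin

lemma suminf_N_op_le:
  assumes "\<And>n. N (u * S n x) \<le> ennreal M * N (u * x)"
  shows "(\<Sum>n. N (u * ((1 / 2 ^ (n + m)) *\<^sub>R S (n + m) x))) \<le> ennreal (2 * M / 2 ^ m) * N (u * x)"
proof -
  have geo: "summable (\<lambda>n. c * (1 / 2) ^ n)" "(\<Sum>n. c * (1 / 2) ^ n) = 2 * c" for c :: real
    by (auto intro!: summable_mult summable_geometric simp: suminf_mult suminf_geometric)
  have "(\<Sum>n. N (u * ((1 / 2 ^ (n + m)) *\<^sub>R S (n + m) x))) \<le> (\<Sum>n. ennreal (M / 2 ^ m * (1/2) ^ n) * N (u * x))"
  proof (intro suminf_le)
    fix n
    have "N (u * ((1 / 2 ^ (n + m)) *\<^sub>R S (n + m) x)) = ennreal (1 / 2 ^ (n + m)) * N (u * S (n + m) x)"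
      by (simp add: N_scaleR)
    also have "\<dots> \<le> ennreal (1 / 2 ^ (n + m)) * (ennreal M * N (u * x))"
      by (intro mult_left_mono assms) auto
    also have "\<dots> = ennreal (M / 2 ^ m * (1/2) ^ n) * N (u * x)"
      using M by (simp add: mult.assoc[symmetric] ennreal_mult[symmetric] power_one_over power_add mult.commute[of "2 ^ n"])
    finally show "N (u * ((1 / 2 ^ (n + m)) *\<^sub>R S (n + m) x)) \<le> ennreal (M / 2 ^ m * (1/2) ^ n) * N (u * x)" .
  qed auto
  also have "\<dots> = (\<Sum>n. ennreal (M / 2 ^ m * (1/2) ^ n)) * N (u * x)" by simp
  also have "(\<Sum>n. ennreal (M / 2 ^ m * (1/2) ^ n)) = ennreal (2 * (M / 2 ^ m))"
  proof -
    have sum: "(\<Sum>n. ennreal (c * (1/2) ^ n)) = ennreal (2 * c)" if "0 \<le> c" for c :: real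
      using that geo[of c] by (subst suminf_ennreal2) auto
    show ?thesis by (rule sum) (use M in simp)
  qed
  finally show ?thesis by simp
qed

lemma op_sum_summable:
  assumes x: "N x < \<infinity>"
  shows "AE t in unit_leb. summable (\<lambda>n. \<bar>rep_L0 ((1 / 2 ^ n) *\<^sub>R S n x) t\<bar>)"
proof (rule AE_summable_N)
  have "(\<Sum>n. N ((1 / 2 ^ n) *\<^sub>R S n x)) \<le> ennreal (2 * M) * N x"
    using suminf_N_op_le[of "ind {0..1}" x 0] bounded_operatorD(3)[OF S x] by simp
  also have "\<dots> < \<infinity>" using x by (auto simp: ennreal_mult_less_top)
  finally show "(\<Sum>n. N ((1 / 2 ^ n) *\<^sub>R S n x)) < \<infinity>" .
qed

lemma op_sum_tail:
  assumes x: "N x < \<infinity>"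
  shows "N (op_sum S x - (\<Sum>n<m. (1 / 2 ^ n) *\<^sub>R S n x)) \<le> ennreal (2 * M / 2 ^ m) * N x"
  using order_trans[OF N_L0_sum_le[OF op_sum_summable[OF x], of "ind {0..1}" m] suminf_N_op_le[of "ind {0..1}" x m]]
    bounded_operatorD(3)[OF S x] by (simp add: op_sum_def)

lemma bounded_operator_op_sum: "bounded_operator w (2 * M) (op_sum S)"
  unfolding bounded_operator_def
proof (intro conjI allI impI)
  fix x y c assume x: "N x < \<infinity>"
  show "op_sum S (x + y) = op_sum S x + op_sum S y" if y: "N y < \<infinity>"
    unfolding op_sum_def L0_sum_add[OF op_sum_summable[OF x] op_sum_summable[OF y], symmetric]
    by (simp add: bounded_operatorD(1)[OF S x y] scaleR_add_right)
  show "op_sum S (c *\<^sub>R x) = c *\<^sub>R op_sum S x"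
    unfolding op_sum_def L0_sum_scaleR[OF op_sum_summable[OF x], symmetric]
    by (simp add: bounded_operatorD(2)[OF S x] mult.commute)
  show "N (op_sum S x) \<le> ennreal (2 * M) * N x"
    using op_sum_tail[OF x, of 0] by simp
next
  fix x assume xw: "N (x * w) < \<infinity>"
  then have x: "N x < \<infinity>" using N_le_weighted[OF w, of x] by (rule le_less_trans[rotated])
  have "N (w * op_sum S x) \<le> ennreal (2 * M) * N (w * x)"
    using order_trans[OF N_L0_sum_le[OF op_sum_summable[OF x], of w 0] suminf_N_op_le[of w x 0]]
      bounded_operatorD(4)[OF S xw] by (simp add: op_sum_def mult.commute)
  then show "N (op_sum S x * w) \<le> ennreal (2 * M) * N (x * w)" by (simp add: mult.commute)
qed

lemma op_sum_single:
  assumes "\<And>n. n \<noteq> i \<Longrightarrow> S n x = 0"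
  shows "op_sum S x = (1 / 2 ^ i) *\<^sub>R S i x"
  unfolding op_sum_def using L0_sum_finite_support[of "{i}" "\<lambda>n. (1 / 2 ^ n) *\<^sub>R S n x"] assms by simp

text \<open>An operator bounded on the unweighted space passes through the infinite sum because the
  tails tend to zero in norm, so only the term with index \<open>i\<close> survives.\<close>

lemma apply_op_sum_single:
  assumes A: "bounded_operator w M' A" and x: "N x < \<infinity>"
    and z: "\<And>n. n \<noteq> i \<Longrightarrow> A (S n x) = 0"
  shows "A (op_sum S x) = (1 / 2 ^ i) *\<^sub>R A (S i x)"
proof -
  note AD = bounded_operatorD[OF A]
  have Sx: "N ((1 / 2 ^ n) *\<^sub>R S n x) < \<infinity>" for n
    using bounded_operatorD(5)[OF S x] by (auto simp: N_scaleR ennreal_mult_less_top)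
  have fin_sum: "N (\<Sum>n\<in>F. (1 / 2 ^ n) *\<^sub>R S n x) < \<infinity>" if "finite F" for F
    by (rule le_less_trans[OF N_sum_le[OF that]]) (use that Sx in auto)
  have A_sum: "A (\<Sum>n\<in>F. (1 / 2 ^ n) *\<^sub>R S n x) = (\<Sum>n\<in>F. A ((1 / 2 ^ n) *\<^sub>R S n x))" if "finite F" for F
    using that
  proof (induction F rule: finite_induct)
    case (insert n F)
    then show ?case using AD(1)[OF Sx[of n] fin_sum[of F]] by simp
  qed (simp add: bounded_operator_zero[OF A])
  have op: "N (op_sum S x) < \<infinity>" by (rule bounded_operatorD(5)[OF bounded_operator_op_sum x])
  have est: "N (A (op_sum S x) - (1 / 2 ^ i) *\<^sub>R A (S i x)) \<le> ennreal (max M' 0 * (2 * M) * enn2real (N x) * (1/2) ^ m)" if m: "i < m" for m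
  proof -
    let ?s = "\<Sum>n<m. (1 / 2 ^ n) *\<^sub>R S n x"
    have "A ?s = (\<Sum>n<m. (1 / 2 ^ n) *\<^sub>R A (S n x))"
      by (simp only: A_sum[OF finite_lessThan] AD(2)[OF bounded_operatorD(5)[OF S x]])
    also have "\<dots> = (\<Sum>n\<in>{i}. (1 / 2 ^ n) *\<^sub>R A (S n x))"
      by (rule sum.mono_neutral_right) (use m z in auto)
    finally have As: "A ?s = (1 / 2 ^ i) *\<^sub>R A (S i x)" by simp
    have neg: "N (- ?s) < \<infinity>" using N_minus_commute[of 0 ?s] fin_sum[of "{..<m}"] by simp
    have "A (- ?s) = - A ?s" using AD(2)[OF fin_sum[of "{..<m}"], of "-1"] by simp
    then have "A (op_sum S x) - (1 / 2 ^ i) *\<^sub>R A (S i x) = A (op_sum S x - ?s)"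
      using AD(1)[OF op neg] As by simp
    also have "N \<dots> \<le> ennreal M' * N (op_sum S x - ?s)"
    proof (rule AD(3))
      show "N (op_sum S x - ?s) < \<infinity>"
        using N_triangle[of "op_sum S x" "- ?s"] op neg by (auto elim!: le_less_trans)
    qed
    also have "\<dots> \<le> ennreal (max M' 0) * (ennreal (2 * M / 2 ^ m) * ennreal (enn2real (N x)))"
      using op_sum_tail[OF x, of m] x by (intro mult_mono ennreal_leI) auto
    also have "\<dots> = ennreal (max M' 0 * (2 * M) * enn2real (N x) * (1/2) ^ m)"
      using M by (simp add: ennreal_mult[symmetric] power_one_over mult_ac)
    finally show ?thesis .
  qed
  have "(\<lambda>m. ennreal (max M' 0 * (2 * M) * enn2real (N x) * (1/2) ^ m)) \<longlonglongrightarrow> ennreal (max M' 0 * (2 * M) * enn2real (N x) * 0)"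
    by (intro tendsto_ennrealI tendsto_mult tendsto_const LIMSEQ_power_zero) auto
  then have "N (A (op_sum S x) - (1 / 2 ^ i) *\<^sub>R A (S i x)) \<le> 0"
    by (intro LIMSEQ_le_const[of _ 0]) (use est in \<open>auto intro!: exI[of _ "Suc i"]\<close>)
  then show ?thesis by (simp add: N_eq_0_iff)
qed

end

text \<open>The gliding hump of the main boundedness lemma of Bade and Curtis. It uses products of operators in
  place of the completeness of \<open>E\<close>, since the library's notion of completeness is only usable
  when \<open>nrm E\<close> behaves like a norm outside \<open>pts E\<close> as well.\<close>

lemma orthogonal_factorization_bound:
  assumes w: "AE t in unit_leb. 1 \<le> rep_L0 w t"
    and E: "interpolation_space E (marcinkiewicz \<phi>) (weighted (marcinkiewicz \<phi>) w)"
    and M: "0 \<le> M"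
    and g: "\<And>i j. bounded_operator w M (g i j)" and h: "\<And>i j. bounded_operator w M (h i j)"
    and orth: "\<And>i j i' j' x. N x < \<infinity> \<Longrightarrow> (i, j) \<noteq> (i', j') \<Longrightarrow> g i j (h i' j' x) = 0"
  shows "\<exists>i j. \<forall>x\<in>pts E. g i j (h i j x) \<in> pts E \<and> nrm E (g i j (h i j x)) \<le> 4 ^ (i + j) * nrm E x"
proof -
  have BE: "banach_space E" and ES: "cont_embedded E (couple_sum (marcinkiewicz \<phi>) (weighted (marcinkiewicz \<phi>) w))"
    using E by (auto simp: interpolation_space_def)
  have E_fin: "N x < \<infinity>" if "x \<in> pts E" for x
    using ES that pts_couple_sum_ge_1[OF w] by (auto simp: cont_embedded_def)
  have subE: "subspace (pts E)" using BE by (simp add: banach_space_def)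
  have nE0: "0 \<le> nrm E x" if "x \<in> pts E" for x using BE that by (simp add: banach_space_def)
  have nEs: "nrm E (c *\<^sub>R x) = \<bar>c\<bar> * nrm E x" if "x \<in> pts E" for c x using BE that by (simp add: banach_space_def)
  define f where "f i = op_sum (g i)" for i
  have f: "bounded_operator w (2 * M) (f i)" for i
    unfolding f_def by (rule bounded_operator_op_sum[OF w g M])
  \<comment> \<open>The second index \<open>j i\<close> is fixed from the norm of \<open>f i\<close>
    on \<open>E\<close> before \<open>y\<close> is formed; the term of \<open>y\<close> with index
    \<open>i\<close> then uses exactly this second index.\<close>
  have "\<exists>j. \<forall>x\<in>pts E. f i x \<in> pts E \<and> nrm E (f i x) \<le> 2 ^ j * nrm E x" for i
  proof -
    obtain C where C: "\<And>x. x \<in> pts E \<Longrightarrow> f i x \<in> pts E \<and> nrm E (f i x) \<le> C * nrm E x"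
      using bounded_operator_bounded_on[OF w f E, of i] by (auto simp: maps_boundedly_def)
    obtain j where j: "C < 2 ^ j" using real_arch_pow[of 2 C] by auto
    have "nrm E (f i x) \<le> 2 ^ j * nrm E x" if "x \<in> pts E" for x
      using C[OF that] nE0[OF that] j by (meson less_imp_le mult_right_mono order_trans)
    then show ?thesis using C by blast
  qed
  then obtain j where j: "\<And>i x. x \<in> pts E \<Longrightarrow> f i x \<in> pts E \<and> nrm E (f i x) \<le> 2 ^ j i * nrm E x"
    by metis
  define y where "y = op_sum (\<lambda>i. h i (j i))"
  have y: "bounded_operator w (2 * M) y"
    unfolding y_def by (rule bounded_operator_op_sum[OF w h M])
  obtain C where C: "\<And>x. x \<in> pts E \<Longrightarrow> y x \<in> pts E \<and> nrm E (y x) \<le> C * nrm E x"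
    using bounded_operator_bounded_on[OF w y E] by (auto simp: maps_boundedly_def)
  \<comment> \<open>The first index is chosen last, from the norm of \<open>y\<close> on
    \<open>E\<close>. Orthogonality reduces \<open>f i (y x)\<close> to a single term with
    coefficient \<open>1 / 2 ^ (i + j i)\<close>; together with the operator bounds
    \<open>2 ^ j i\<close> and \<open>2 ^ i\<close> this gives \<open>4 ^ (i + j i)\<close>.\<close>
  obtain i where i: "C < 2 ^ i" using real_arch_pow[of 2 C] by auto
  have fh: "f i (h i' j' x) = (if i' = i then (1 / 2 ^ j') *\<^sub>R g i j' (h i j' x) else 0)" if "N x < \<infinity>" for i i' j' x
  proof (cases "i' = i")
    case True
    have "op_sum (g i) (h i j' x) = (1 / 2 ^ j') *\<^sub>R g i j' (h i j' x)"
      by (rule op_sum_single[OF w g M]) (use orth that in auto)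
    then show ?thesis using True by (simp add: f_def)
  next
    case False
    have "op_sum (g i) (h i' j' x) = (1 / 2 ^ 0) *\<^sub>R g i 0 (h i' j' x)"
      by (rule op_sum_single[OF w g M]) (use orth that False in auto)
    then show ?thesis using False orth[OF that, of i 0 i' j'] by (simp add: f_def)
  qed
  have eq: "f i (y x) = (1 / 2 ^ (i + j i)) *\<^sub>R g i (j i) (h i (j i) x)" if x: "N x < \<infinity>" for x
    unfolding y_def
    by (subst apply_op_sum_single[OF w h M f x, of i]) (auto simp: fh[OF x] power_add)
  show ?thesis
  proof (intro exI ballI)
    fix x assume x: "x \<in> pts E"
    have e: "g i (j i) (h i (j i) x) = 2 ^ (i + j i) *\<^sub>R f i (y x)"
      unfolding eq[OF E_fin[OF x]] by simp
    have fy: "f i (y x) \<in> pts E" using j C x by blast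
    have "nrm E (g i (j i) (h i (j i) x)) = 2 ^ (i + j i) * nrm E (f i (y x))"
      unfolding e nEs[OF fy] by simp
    also have "\<dots> \<le> 2 ^ (i + j i) * (2 ^ j i * (2 ^ i * nrm E x))"
    proof (rule mult_left_mono)
      have "nrm E (f i (y x)) \<le> 2 ^ j i * nrm E (y x)" using j C x by blast
      also have "\<dots> \<le> 2 ^ j i * (2 ^ i * nrm E x)"
        using C[OF x] nE0[OF x] i by (intro mult_left_mono) (auto intro: order_trans mult_right_mono less_imp_le)
      finally show "nrm E (f i (y x)) \<le> 2 ^ j i * (2 ^ i * nrm E x)" .
    qed simp
    also have "\<dots> = (2 * 2) ^ (i + j i) * nrm E x" unfolding power_mult_distrib by (simp add: power_add)
    finally show "g i (j i) (h i (j i) x) \<in> pts E \<and> nrm E (g i (j i) (h i (j i) x)) \<le> 4 ^ (i + j i) * nrm E x"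
      unfolding e using fy subE by (simp add: subspace_scale)
  qed
qed

end

section \<open>A weight with a K-monotone couple\<close>

lemma (in parameter_fn) almost_slowly_varying_sequence:
  assumes "almost_slowly_varying \<phi>"
  obtains C \<tau> where "2 \<le> C" "\<tau> 0 = 1" "\<And>k. 0 < \<tau> k" "\<And>k. \<tau> (Suc k) \<le> \<tau> k / 2"
    "\<And>k s. 0 < s \<Longrightarrow> s \<le> \<tau> k \<Longrightarrow> real (k + 2) * s \<le> 1 \<Longrightarrow> \<phi> (real (k + 2) * s) \<le> C * \<phi> s"
proof -
  obtain C0 where "\<forall>n::nat. \<exists>d>0. \<forall>s::real. 0 < s \<longrightarrow> s \<le> d \<longrightarrow> n * s \<le> 1 \<longrightarrow> \<phi> (n * s) \<le> C0 * \<phi> s"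
    using assms unfolding almost_slowly_varying_def by blast
  then obtain d :: "nat \<Rightarrow> real" where
    d: "\<forall>n. 0 < d n \<and> (\<forall>s. 0 < s \<longrightarrow> s \<le> d n \<longrightarrow> n * s \<le> 1 \<longrightarrow> \<phi> (n * s) \<le> C0 * \<phi> s)"
    using choice by metis
  \<comment> \<open>\<open>\<tau> (Suc k)\<close> has to be a threshold for the factor
    \<open>Suc k + 2\<close>, hence \<open>d (k + 3)\<close>. For \<open>k = 0\<close> the factor is
    2, where concavity suffices, so \<open>\<tau> 0\<close> may be 1.\<close>
  define \<tau> where "\<tau> = rec_nat 1 (\<lambda>k t. min (t / 2) (d (k + 3)))"
  have \<tau>: "\<tau> 0 = 1" "\<tau> (Suc k) = min (\<tau> k / 2) (d (k + 3))" for k by (simp_all add: \<tau>_def)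
  have pos: "0 < \<tau> k" for k by (induction k) (use d in \<open>auto simp: \<tau>\<close>)
  show ?thesis
  proof (rule that[of "max C0 2" \<tau>])
    fix k and s :: real assume s: "0 < s" "s \<le> \<tau> k" "real (k + 2) * s \<le> 1"
    have "1 * s \<le> real (k + 2) * s" using s by (intro mult_right_mono) auto
    then have s1: "s \<le> 1" using s by linarith
    show "\<phi> (real (k + 2) * s) \<le> max C0 2 * \<phi> s"
    proof (cases k)
      case 0
      have "\<phi> (2 * s) \<le> 2 * \<phi> s" using s 0 by (intro phi_scale) auto
      also have "\<dots> \<le> max C0 2 * \<phi> s" using s s1 phi_nonneg by (intro mult_right_mono) auto
      finally show ?thesis using 0 by simp
    next
      case (Suc j)
      have "\<phi> (real (k + 2) * s) \<le> C0 * \<phi> s"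
        using d[rule_format, of "k + 2"] s \<tau>(2)[of j] Suc by (auto simp: add.commute eval_nat_numeral)
      also have "\<dots> \<le> max C0 2 * \<phi> s" using s s1 phi_nonneg by (intro mult_right_mono) auto
      finally show ?thesis .
    qed
  qed (use \<tau> pos in auto)
qed

section \<open>Blocks of rapidly decreasing length\<close>

locale block_sequence = parameter_fn_index +
  fixes \<tau> :: "nat \<Rightarrow> real" and C :: real
  assumes C_ge: "2 \<le> C" and \<tau>_0: "\<tau> 0 = 1" and \<tau>_pos: "0 < \<tau> k" and \<tau>_Suc: "\<tau> (Suc k) \<le> \<tau> k / 2"
    and phi_\<tau>: "0 < s \<Longrightarrow> s \<le> \<tau> k \<Longrightarrow> real (k + 2) * s \<le> 1 \<Longrightarrow> \<phi> (real (k + 2) * s) \<le> C * \<phi> s"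
begin

lemma \<tau>_antimono: "m \<le> n \<Longrightarrow> \<tau> n \<le> \<tau> m"
proof (rule lift_Suc_antimono_le)
  show "\<tau> (Suc k) \<le> \<tau> k" for k using \<tau>_Suc[of k] \<tau>_pos[of k] by simp
qed

lemma \<tau>_le_1: "\<tau> k \<le> 1"
  using \<tau>_antimono[of 0 k] \<tau>_0 by simp

lemma \<tau>_lessI: "0 < s \<Longrightarrow> \<exists>n. \<tau> n < s"
proof -
  assume s: "0 < s"
  have le: "\<tau> n \<le> (1/2) ^ n" for n
    by (induction n) (use \<tau>_Suc in \<open>auto simp: \<tau>_0 intro: order_trans\<close>)
  obtain n where "(1/2) ^ n < s" using real_arch_pow_inv[of s "1/2"] s by auto
  then show ?thesis using le[of n] by (intro exI[of _ n]) simp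
qed

text \<open>Block \<open>k\<close> is the interval from \<open>\<tau> (Suc k)\<close> to
  \<open>\<tau> k\<close>. At \<open>t = 0\<close> no index qualifies and the value is arbitrary,
  which concerns a null set only.\<close>

definition block :: "real \<Rightarrow> nat"
  where "block t = (LEAST k. \<tau> (Suc k) < t)"

definition A :: "nat \<Rightarrow> real set"
  where "A k = {t \<in> {0..1}. block t = k}"

definition step :: "(nat \<Rightarrow> real) \<Rightarrow> L0"
  where "step c = abs_L0 (\<lambda>t. c (block t))"

lemma measurable_block [measurable]: "block \<in> measurable unit_leb (count_space UNIV)"
proof -
  have [measurable]: "(\<lambda>t::real. t) \<in> borel_measurable unit_leb"
    by (rule continuous_imp_measurable_on_sets_lebesgue) auto
  show ?thesis unfolding block_def by measurable
qed

lemma measurable_block_compose: "(\<lambda>t. c (block t)) \<in> borel_measurable unit_leb" for c :: "nat \<Rightarrow> real"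
  by measurable

lemma rep_L0_step: "AE t in unit_leb. rep_L0 (step c) t = c (block t)"
  unfolding step_def by (rule rep_abs_L0) (rule measurable_block_compose)

lemma sets_block: "{t \<in> {0..1}. P (block t)} \<in> sets unit_leb"
proof -
  have "{t \<in> space unit_leb. P (block t)} \<in> sets unit_leb" by measurable
  then show ?thesis by simp
qed

lemma sets_A [simp]: "A k \<in> sets unit_leb"
  unfolding A_def by (rule sets_block)

lemma block_eqI: "\<tau> (Suc k) < t \<Longrightarrow> t \<le> \<tau> k \<Longrightarrow> block t = k"
  unfolding block_def
proof (rule Least_equality)
  fix j assume "t \<le> \<tau> k" "\<tau> (Suc j) < t"
  then show "k \<le> j" using \<tau>_antimono[of "Suc j" k] by (cases "k \<le> j") auto
qed

lemma measure_block_ge: "measure unit_leb {t \<in> {0..1}. n \<le> block t} \<le> \<tau> n"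
proof (cases n)
  case 0
  then show ?thesis using measure_unit_leb_le_1 \<tau>_0 by simp
next
  case (Suc k)
  have sub: "{t \<in> {0..1}. n \<le> block t} \<subseteq> {0..\<tau> n}"
  proof safe
    fix t assume t: "t \<in> {0..1}" "n \<le> block t"
    have "\<not> \<tau> n < t"
    proof
      assume "\<tau> n < t"
      then have "block t \<le> k" unfolding block_def Suc by (rule Least_le)
      then show False using t Suc by simp
    qed
    then show "t \<in> {0..\<tau> n}" using t by auto
  qed
  have "measure unit_leb {t \<in> {0..1}. n \<le> block t} \<le> measure unit_leb {0..\<tau> n}"
    by (rule unit_leb.finite_measure_mono[OF sub]) (use \<tau>_le_1 in \<open>auto simp: sets_restrict_space_iff\<close>)
  also have "\<dots> = \<tau> n" using \<tau>_pos[of n] \<tau>_le_1[of n] by (subst measure_restrict_space) auto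
  finally show ?thesis .
qed

lemma AE_ind_A: "AE t in unit_leb. \<forall>k. rep_L0 (ind (A k) * z) t = (if block t = k then rep_L0 z t else 0)"
  unfolding AE_all_countable
proof
  fix k
  note AE_unit
  then show "AE t in unit_leb. rep_L0 (ind (A k) * z) t = (if block t = k then rep_L0 z t else 0)"
    using rep_L0_ind_times[OF sets_A[of k], of z]
    by eventually_elim (auto simp: A_def indicator_def)
qed

lemma L0_eq_blocks:
  assumes "\<And>k. ind (A k) * u = ind (A k) * v"
  shows "u = v"
proof (rule L0_eqI)
  show "AE t in unit_leb. rep_L0 u t = rep_L0 v t"
    using AE_ind_A[of u] AE_ind_A[of v] by eventually_elim (use assms in metis)
qed

lemma ind_A_step: "ind (A k) * (step c * z) = c k *\<^sub>R (ind (A k) * z)"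
  by (rule L0_eqI)
    (use AE_ind_A[of "step c * z"] AE_ind_A[of z] rep_L0_step[of c] rep_L0_times[of "step c" z]
      rep_L0_scaleR[of "c k" "ind (A k) * z"] in eventually_elim; auto)

lemma ind_A_mult_ind:
  assumes "B \<in> sets unit_leb"
  shows "ind (A k) * ind B = ind (A k \<inter> B)"
  using assms by (simp add: ind_mult_ind)

text \<open>By the weak-type estimate it suffices to treat level sets. If no block carries more than
  \<open>s\<close> of a level set and \<open>\<tau> (Suc k) < s \<le> \<tau> k\<close>, then the
  first \<open>k + 1\<close> blocks carry at most \<open>(k + 1) * s\<close> and the others at most
  \<open>\<tau> (Suc k)\<close>, in total at most \<open>(k + 2) * s\<close>. The choice of \<tau>
  makes \<phi> of this comparable to \<open>\<phi> s\<close>, that is, to the share of one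
  block.\<close>

lemma N_block_bound:
  obtains Cb where "0 < Cb" "\<And>z S. 0 \<le> S \<Longrightarrow> (\<And>k. N (ind (A k) * z) \<le> ennreal S) \<Longrightarrow> N z \<le> ennreal (Cb * S)"
proof -
  obtain K where K: "0 < K"
    "\<And>x q. 0 \<le> q \<Longrightarrow> (\<And>l. 0 < l \<Longrightarrow> l * \<phi> (distr_fn (rep_L0 x) l) \<le> q) \<Longrightarrow> N x \<le> ennreal (K * q)"
    using N_weak_type by blast
  show ?thesis
  proof (rule that[of "K * (C * 2)"])
    show "0 < K * (C * 2)" using K C_ge by simp
    fix z S assume S: "0 \<le> S" and bd: "\<And>k. N (ind (A k) * z) \<le> ennreal S"
    have "N z \<le> ennreal (K * (C * 2 * S))"
    proof (rule K(2))
      show "0 \<le> C * 2 * S" using S C_ge by simp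
      fix l :: real assume l: "0 < l"
      let ?L = "{s \<in> {0..1}. l < \<bar>rep_L0 z s\<bar>}"
      have L: "?L \<in> sets unit_leb" by (rule sets_greater_unit_leb[OF rep_L0_measurable])
      define d where "d k = measure unit_leb (A k \<inter> ?L)" for k
      have d01: "0 \<le> d k" "d k \<le> 1" for k using measure_unit_leb_le_1 by (auto simp: d_def)
      have phid: "l * \<phi> (d k) \<le> S" for k
      proof -
        have "ennreal (l * \<phi> (d k)) \<le> N (ind (A k) * z)"
          unfolding d_def by (rule N_ind_lower) (use L l in auto)
        also have "\<dots> \<le> ennreal S" by (rule bd)
        finally show ?thesis using S by (simp add: ennreal_le_iff)
      qed
      define D where "D = distr_fn (rep_L0 z) l"
      have D01: "0 \<le> D" "D \<le> 1" using measure_unit_leb_le_1 by (auto simp: D_def distr_fn_def)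
      have split: "D \<le> (\<Sum>k<n. d k) + \<tau> n" for n
      proof -
        have "D \<le> measure unit_leb ((\<Union>k<n. A k \<inter> ?L) \<union> {t \<in> {0..1}. n \<le> block t})"
          unfolding D_def distr_fn_def
          by (rule unit_leb.finite_measure_mono) (use L sets_block in \<open>auto simp: A_def not_less\<close>)
        also have "\<dots> \<le> measure unit_leb (\<Union>k<n. A k \<inter> ?L) + measure unit_leb {t \<in> {0..1}. n \<le> block t}"
          by (intro measure_Un_le sets.finite_UN sets.Int sets_A L sets_block) auto
        also have "measure unit_leb (\<Union>k<n. A k \<inter> ?L) \<le> (\<Sum>k<n. d k)"
          unfolding d_def by (rule unit_leb.finite_measure_subadditive_finite) (use L in auto)
        finally show ?thesis using measure_block_ge[of n] by linarith
      qed
      have "l * \<phi> D \<le> C * 2 * S"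
      proof (cases "D = 0")
        case True
        then show ?thesis using S C_ge by (simp add: phi_0)
      next
        case False
        define s where "s = (SUP k. d k)"
        have bdd: "bdd_above (range d)" using d01 by (intro bdd_aboveI[of _ 1]) auto
        have ds: "d k \<le> s" for k unfolding s_def by (rule cSUP_upper[OF _ bdd]) simp
        have s0: "0 < s"
        proof (rule ccontr)
          assume "\<not> 0 < s"
          then have "d k = 0" for k using ds[of k] d01[of k] by simp
          then have "D \<le> \<tau> n" for n using split[of n] by simp
          moreover obtain n where "\<tau> n < D" using \<tau>_lessI[of D] D01 False by auto
          ultimately show False by (meson not_less)
        qed
        have s1: "s \<le> 1" unfolding s_def by (rule cSUP_least) (use d01 in auto)
        \<comment> \<open>The supremum is replaced by a block carrying more than half of it; by
          concavity this costs a factor 2.\<close>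
        have "\<exists>k. s / 2 < d k"
        proof (rule ccontr)
          assume "\<nexists>k. s / 2 < d k"
          then have "s \<le> s / 2" unfolding s_def by (intro cSUP_least) (auto simp: not_less s_def)
          then show False using s0 by simp
        qed
        then obtain k0 where k0: "s / 2 < d k0" by blast
        obtain n0 where "\<tau> n0 < s" using \<tau>_lessI[OF s0] by blast
        define n where "n = (LEAST n. \<tau> n < s)"
        have n: "\<tau> n < s" unfolding n_def by (rule LeastI[where P = "\<lambda>n. \<tau> n < s"]) fact
        have "n \<noteq> 0" using n s1 \<tau>_0 by (auto intro: ccontr)
        then obtain k where k: "n = Suc k" by (cases n) auto
        have sk: "s \<le> \<tau> k" using not_less_Least[of k "\<lambda>n. \<tau> n < s"] k by (simp add: n_def)
        have "D \<le> real n * s + s" using split[of n] sum_mono[of "{..<n}" d "\<lambda>_. s"] ds n by simp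
        then have Dk: "D \<le> real (k + 2) * s" by (simp add: k algebra_simps)
        \<comment> \<open>Truncation keeps \<open>(k + 2) * s'\<close> inside the domain of \<phi>;
          the bound on \<open>D\<close> survives because \<open>D \<le> 1\<close>.\<close>
        define s' where "s' = min s (1 / real (k + 2))"
        have s': "0 < s'" "s' \<le> s" "real (k + 2) * s' \<le> 1" "D \<le> real (k + 2) * s'"
        proof -
          have "real (k + 2) * s' = min (real (k + 2) * s) (real (k + 2) * (1 / real (k + 2)))"
            unfolding s'_def by (simp only: min_mult_distrib_left of_nat_0_le_iff if_True)
          also have "real (k + 2) * (1 / real (k + 2)) = 1" by (simp del: of_nat_add)
          finally have e: "real (k + 2) * s' = min (real (k + 2) * s) 1" .
          show "real (k + 2) * s' \<le> 1" "D \<le> real (k + 2) * s'" unfolding e using Dk D01 by auto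
          show "0 < s'" "s' \<le> s" using s0 by (auto simp: s'_def)
        qed
        have "\<phi> D \<le> \<phi> (real (k + 2) * s')" using s' D01 by (intro phi_le) auto
        also have "\<dots> \<le> C * \<phi> s'" using s' sk by (intro phi_\<tau>) auto
        also have "\<dots> \<le> C * \<phi> s" using s' s1 C_ge by (intro mult_left_mono phi_le) auto
        also have "\<dots> \<le> C * (2 * \<phi> (d k0))"
        proof (rule mult_left_mono)
          have "\<phi> (2 * (s / 2)) \<le> 2 * \<phi> (s / 2)" using s0 s1 by (intro phi_scale) auto
          also have "\<dots> \<le> 2 * \<phi> (d k0)" using k0 s0 d01 by (intro mult_left_mono phi_le) auto
          finally show "\<phi> s \<le> 2 * \<phi> (d k0)" by simp
        qed (use C_ge in simp)
        finally have "l * \<phi> D \<le> l * (C * (2 * \<phi> (d k0)))" using l by (intro mult_left_mono) auto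
        also have "\<dots> = C * 2 * (l * \<phi> (d k0))" by simp
        also have "\<dots> \<le> C * 2 * S" using C_ge phid by (intro mult_left_mono) auto
        finally show ?thesis .
      qed
      then show "l * \<phi> (distr_fn (rep_L0 z) l) \<le> C * 2 * S" by (simp add: D_def)
    qed
    then show "N z \<le> ennreal (K * (C * 2) * S)" by (simp add: mult.assoc)
  qed
qed

section \<open>The dyadic block weight and its K-functional\<close>

definition w :: L0 where "w = step (\<lambda>k. 2 ^ k)"

lemma w_ge_1: "AE t in unit_leb. 1 \<le> rep_L0 w t"
  using rep_L0_step[of "\<lambda>k. 2 ^ k"] unfolding w_def by eventually_elim simp

lemma nontrivial_w: "nontrivial_weight w"
  unfolding nontrivial_weight_def weight_iff ess_bounded_above_iff
proof (intro conjI disjI1 notI)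
  show "AE t in unit_leb. 0 < rep_L0 w t" using w_ge_1 by eventually_elim simp
  assume "\<exists>c. AE t in unit_leb. rep_L0 w t \<le> c"
  then obtain c where c: "AE t in unit_leb. rep_L0 w t \<le> c" by blast
  obtain k where k: "c < 2 ^ k" using real_arch_pow[of 2 c] by auto
  let ?I = "{\<tau> (Suc k)<..\<tau> k}"
  have I: "?I \<in> sets unit_leb" "measure unit_leb ?I = \<tau> k - \<tau> (Suc k)"
    using measure_unit_leb_cbox[of "\<tau> (Suc k)" "\<tau> k"] \<tau>_pos[of "Suc k"] \<tau>_le_1[of k] \<tau>_antimono[of k "Suc k"] by auto
  have "AE t in unit_leb. t \<notin> ?I"
    using c rep_L0_step[of "\<lambda>k. 2 ^ k"] unfolding w_def
    by eventually_elim (use k block_eqI in fastforce)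
  then have "measure unit_leb ?I = 0"
    using I(1) by (subst (asm) AE_iff_measurable[of ?I]) (use sets.sets_into_space[OF I(1)] in \<open>auto simp: measure_def\<close>)
  then show False using I(2) \<tau>_Suc[of k] \<tau>_pos[of k] by simp
qed

definition r :: "L0 \<Rightarrow> nat \<Rightarrow> real"
  where "r z k = enn2real (N (ind (A k) * z))"

lemma N_ind_A: "N z < \<infinity> \<Longrightarrow> N (ind (A k) * z) = ennreal (r z k)"
  using N_ind_le[OF sets_A[of k], of z] by (auto simp: r_def dest: le_less_trans)

lemma r_nonneg [simp]: "0 \<le> r z k"
  by (simp add: r_def)

lemma r_le: "N z < \<infinity> \<Longrightarrow> r z k \<le> enn2real (N z)"
  unfolding r_def by (intro enn2real_mono N_ind_le) auto

lemma ind_A_times_w: "ind (A k) * (z * w) = 2 ^ k *\<^sub>R (ind (A k) * z)"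
  using ind_A_step[of k "\<lambda>k. 2 ^ k" z] by (simp add: w_def mult.commute)

lemma r_times_w: "r (z * w) k = 2 ^ k * r z k"
  by (simp add: r_def ind_A_times_w N_scaleR enn2real_mult)

lemma r_triangle:
  assumes "N x < \<infinity>" "N y < \<infinity>"
  shows "r (x + y) k \<le> r x k + r y k"
  unfolding r_def distrib_left
  by (intro enn2real_N_triangle) (use assms N_ind_le[OF sets_A[of k]] in \<open>auto intro: le_less_trans\<close>)

lemma N_finite_weighted: "N (z * w) < \<infinity> \<Longrightarrow> N z < \<infinity>"
  using N_le_weighted[OF w_ge_1] by (rule le_less_trans)

text \<open>The factor \<open>min 1 (2 ^ j / 2 ^ k)\<close> is the size allowed to a transfer from
  block \<open>j\<close> to block \<open>k\<close> that is to be bounded on both spaces: 1 serves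
  the unweighted norm, \<open>2 ^ j / 2 ^ k\<close> compensates the change of weight.
  \<open>N_block_bound\<close> reassembles the blocks, so the source \<open>j\<close> may depend on
  \<open>k\<close> arbitrarily.\<close>

lemma block_operator:
  obtains Cb where "0 < Cb"
    "\<And>f v M. 0 \<le> M \<Longrightarrow> (\<And>k. N (ind (A k) * v) < \<infinity>) \<Longrightarrow>
      (\<And>k x y. N x < \<infinity> \<Longrightarrow> N y < \<infinity> \<Longrightarrow> f k (x + y) = f k x + f k y) \<Longrightarrow>
      (\<And>k c x. N x < \<infinity> \<Longrightarrow> f k (c *\<^sub>R x) = c * f k x) \<Longrightarrow>
      (\<And>k. \<exists>j. \<forall>z. N z < \<infinity> \<longrightarrow> \<bar>f k z\<bar> * r v k \<le> M * (min 1 (2 ^ j / 2 ^ k) * r z j)) \<Longrightarrow>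
      bounded_operator w (Cb * M) (\<lambda>z. step (\<lambda>k. f k z) * v)"
proof -
  obtain Cb where Cb: "0 < Cb"
    "\<And>z S. 0 \<le> S \<Longrightarrow> (\<And>k. N (ind (A k) * z) \<le> ennreal S) \<Longrightarrow> N z \<le> ennreal (Cb * S)"
    using N_block_bound by blast
  show ?thesis
  proof (rule that[OF Cb(1)])
    fix f :: "nat \<Rightarrow> L0 \<Rightarrow> real" and v M
    assume M: "0 \<le> M" and v: "\<And>k. N (ind (A k) * v) < \<infinity>"
      and add: "\<And>k x y. N x < \<infinity> \<Longrightarrow> N y < \<infinity> \<Longrightarrow> f k (x + y) = f k x + f k y"
      and scale: "\<And>k c x. N x < \<infinity> \<Longrightarrow> f k (c *\<^sub>R x) = c * f k x"
      and bd: "\<And>k. \<exists>j. \<forall>z. N z < \<infinity> \<longrightarrow> \<bar>f k z\<bar> * r v k \<le> M * (min 1 (2 ^ j / 2 ^ k) * r z j)"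
    have Nv: "N (ind (A k) * v) = ennreal (r v k)" for k using v[of k] by (simp add: r_def)
    have NT: "N (ind (A k) * (step (\<lambda>k. f k z) * v)) = ennreal (\<bar>f k z\<bar> * r v k)" for k z
      by (simp add: ind_A_step N_scaleR Nv ennreal_mult)
    show "bounded_operator w (Cb * M) (\<lambda>z. step (\<lambda>k. f k z) * v)"
      unfolding bounded_operator_def
    proof (intro conjI allI impI)
      fix x y c assume x: "N x < \<infinity>"
      show "step (\<lambda>k. f k (x + y)) * v = step (\<lambda>k. f k x) * v + step (\<lambda>k. f k y) * v" if "N y < \<infinity>"
        by (rule L0_eq_blocks) (simp add: distrib_left ind_A_step add[OF x that] scaleR_add_left)
      show "step (\<lambda>k. f k (c *\<^sub>R x)) * v = c *\<^sub>R (step (\<lambda>k. f k x) * v)"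
        by (rule L0_eq_blocks) (simp add: ind_A_step scale[OF x])
      have "N (step (\<lambda>k. f k x) * v) \<le> ennreal (Cb * (M * enn2real (N x)))"
      proof (rule Cb(2))
        fix k
        obtain j where "\<bar>f k x\<bar> * r v k \<le> M * (min 1 (2 ^ j / 2 ^ k) * r x j)" using bd x by blast
        also have "\<dots> \<le> M * (1 * enn2real (N x))"
          by (intro mult_left_mono mult_mono r_le x M) auto
        finally show "N (ind (A k) * (step (\<lambda>k. f k x) * v)) \<le> ennreal (M * enn2real (N x))"
          unfolding NT by (simp add: ennreal_leI)
      qed (use M in auto)
      also have "\<dots> = ennreal (Cb * M) * N x"
        using x M Cb(1) by (simp add: ennreal_mult mult.assoc)
      finally show "N (step (\<lambda>k. f k x) * v) \<le> ennreal (Cb * M) * N x" .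
    next
      fix x assume xw: "N (x * w) < \<infinity>"
      have x: "N x < \<infinity>" by (rule N_finite_weighted[OF xw])
      have "N (step (\<lambda>k. f k x) * v * w) \<le> ennreal (Cb * (M * enn2real (N (x * w))))"
      proof (rule Cb(2))
        fix k
        obtain j where "\<bar>f k x\<bar> * r v k \<le> M * (min 1 (2 ^ j / 2 ^ k) * r x j)" using bd x by blast
        also have "\<dots> \<le> M * (2 ^ j / 2 ^ k * r x j)"
          by (intro mult_left_mono mult_right_mono M) auto
        finally have "2 ^ k * (\<bar>f k x\<bar> * r v k) \<le> 2 ^ k * (M * (2 ^ j / 2 ^ k * r x j))"
          by (intro mult_left_mono) auto
        also have "\<dots> = M * r (x * w) j" by (simp add: r_times_w)
        also have "\<dots> \<le> M * enn2real (N (x * w))" by (intro mult_left_mono r_le xw M)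
        finally have "2 ^ k * (\<bar>f k x\<bar> * r v k) \<le> M * enn2real (N (x * w))" .
        moreover have "N (ind (A k) * (step (\<lambda>k. f k x) * v * w)) = ennreal (2 ^ k * (\<bar>f k x\<bar> * r v k))"
          unfolding ind_A_times_w N_scaleR NT by (simp add: ennreal_mult)
        ultimately show "N (ind (A k) * (step (\<lambda>k. f k x) * v * w)) \<le> ennreal (M * enn2real (N (x * w)))"
          by (simp add: ennreal_leI)
      qed (use M in auto)
      also have "\<dots> = ennreal (Cb * M) * N (x * w)"
        using xw M Cb(1) by (simp add: ennreal_mult mult.assoc)
      finally show "N (step (\<lambda>k. f k x) * v * w) \<le> ennreal (Cb * M) * N (x * w)" .
    qed
  qed
qed

abbreviation K where "K t x \<equiv> K_functional t x (marcinkiewicz \<phi>) (weighted (marcinkiewicz \<phi>) w)"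

text \<open>At \<open>t = 1 / 2 ^ k\<close> the scalar cancels the weight on block \<open>k\<close>,
  so both summands of a decomposition count there with their plain norms.\<close>

lemma r_le_K:
  assumes y: "N y < \<infinity>"
  shows "r y k \<le> K (1 / 2 ^ k) y"
proof (rule K_functional_lower)
  fix y0 y1 assume d: "N y0 < \<infinity>" "N (y1 * w) < \<infinity>" "y = y0 + y1"
  have "r y k \<le> r y0 k + r y1 k" unfolding d(3) by (rule r_triangle[OF d(1) N_finite_weighted[OF d(2)]])
  also have "r y1 k = 1 / 2 ^ k * r (y1 * w) k" by (simp add: r_times_w)
  also have "r y0 k + \<dots> \<le> enn2real (N y0) + 1 / 2 ^ k * enn2real (N (y1 * w))"
    by (intro add_mono mult_left_mono r_le d) auto
  finally show "r y k \<le> enn2real (N y0) + 1 / 2 ^ k * enn2real (N (y1 * w))" .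
qed (use y pts_couple_sum_ge_1[OF w_ge_1] in simp)

text \<open>Split at block \<open>k\<close>: blocks from \<open>k\<close> on go to the unweighted
  space, earlier ones to the weighted space, and \<open>N_block_bound\<close> reduces either norm to
  a supremum over blocks.\<close>

lemma K_le_blocks:
  obtains Cb where "0 < Cb"
    "\<And>x k S. N x < \<infinity> \<Longrightarrow> 0 \<le> S \<Longrightarrow> (\<And>j. min 1 (2 ^ j / 2 ^ k) * r x j \<le> S) \<Longrightarrow> K (1 / 2 ^ k) x \<le> Cb * S"
proof -
  obtain Cb where Cb: "0 < Cb"
    "\<And>z S. 0 \<le> S \<Longrightarrow> (\<And>k. N (ind (A k) * z) \<le> ennreal S) \<Longrightarrow> N z \<le> ennreal (Cb * S)"
    using N_block_bound by blast
  show ?thesis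
  proof (rule that[of "2 * Cb"])
    show "0 < 2 * Cb" using Cb by simp
    fix x S and k :: nat
    assume x: "N x < \<infinity>" and S: "0 \<le> S" and bd: "\<And>j. min 1 (2 ^ j / 2 ^ k) * r x j \<le> S"
    let ?x0 = "step (\<lambda>j. if k \<le> j then 1 else 0) * x" and ?x1 = "step (\<lambda>j. if k \<le> j then 0 else 1) * x"
    have eq: "?x0 + ?x1 = x"
      by (rule L0_eq_blocks) (simp add: distrib_left ind_A_step)
    have r1: "r x j \<le> S" if "k \<le> j" for j
    proof -
      have "(1::real) \<le> 2 ^ j / 2 ^ k" using that by (simp add: power_increasing)
      then show ?thesis using bd[of j] by (simp add: min_def split: if_splits)
    qed
    have r2: "2 ^ j * r x j \<le> 2 ^ k * S" if "\<not> k \<le> j" for j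
    proof -
      have "(2::real) ^ j / 2 ^ k \<le> 1" using that by (simp add: power_increasing)
      then have "2 ^ j / 2 ^ k * r x j \<le> S" using bd[of j] by (simp add: min_def split: if_splits)
      then show ?thesis by (simp add: field_simps)
    qed
    have n0: "N ?x0 \<le> ennreal (Cb * S)"
    proof (rule Cb(2)[OF S])
      fix j show "N (ind (A j) * ?x0) \<le> ennreal S"
        using r1[of j] S by (auto simp: ind_A_step N_ind_A[OF x] intro: ennreal_leI)
    qed
    have n1: "N (?x1 * w) \<le> ennreal (Cb * (2 ^ k * S))"
    proof (rule Cb(2))
      fix j show "N (ind (A j) * (?x1 * w)) \<le> ennreal (2 ^ k * S)"
        unfolding ind_A_times_w using r2[of j] S
        by (auto simp: ind_A_step N_ind_A[OF x] N_scaleR ennreal_mult[symmetric] intro: ennreal_leI)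
    qed (use S in simp)
    have "K (1 / 2 ^ k) (?x0 + ?x1) \<le> enn2real (N ?x0) + 1 / 2 ^ k * enn2real (N (?x1 * w))"
      by (rule K_functional_upper) (use n0 n1 in \<open>auto intro: le_less_trans\<close>)
    also have "\<dots> \<le> Cb * S + 1 / 2 ^ k * (Cb * (2 ^ k * S))"
      using n0 n1 S Cb(1) by (intro add_mono mult_left_mono enn2real_leI) auto
    also have "\<dots> = 2 * Cb * S" by simp
    finally show "K (1 / 2 ^ k) x \<le> 2 * Cb * S" unfolding eq .
  qed
qed

text \<open>The K-inequality at \<open>t = 1 / 2 ^ k\<close> and the two block estimates provide a
  block \<open>j\<close> on which \<open>min 1 (2 ^ j / 2 ^ k) * r x j\<close> reaches
  \<open>r y k\<close> up to the factor \<open>2 * Cb\<close>. The functional norming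
  \<open>x\<close> on that block is the required one.\<close>

lemma transfer_functionals:
  obtains M where "0 < M"
    "\<And>x y k. N x < \<infinity> \<Longrightarrow> N y < \<infinity> \<Longrightarrow> (\<forall>t>0. K t y \<le> K t x) \<Longrightarrow>
      \<exists>g j. (\<forall>z z'. N z < \<infinity> \<longrightarrow> N z' < \<infinity> \<longrightarrow> g (z + z') = g z + g z') \<and>
        (\<forall>c z. N z < \<infinity> \<longrightarrow> g (c *\<^sub>R z) = c * g z) \<and> (r y k \<noteq> 0 \<longrightarrow> g x = 1) \<and>
        (\<forall>z. N z < \<infinity> \<longrightarrow> \<bar>g z\<bar> * r y k \<le> M * (min 1 (2 ^ j / 2 ^ k) * r z j))"
proof -
  obtain Cb where Cb: "0 < Cb"
    "\<And>x k S. N x < \<infinity> \<Longrightarrow> 0 \<le> S \<Longrightarrow> (\<And>j. min 1 (2 ^ j / 2 ^ k) * r x j \<le> S) \<Longrightarrow> K (1 / 2 ^ k) x \<le> Cb * S"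
    using K_le_blocks by blast
  obtain Kf where Kf: "0 < Kf"
    "\<And>A x. A \<in> sets unit_leb \<Longrightarrow> N x < \<infinity> \<Longrightarrow> ind A * x \<noteq> 0 \<Longrightarrow>
      \<exists>g. (\<forall>z z'. N z < \<infinity> \<longrightarrow> N z' < \<infinity> \<longrightarrow> g (z + z') = g z + g z') \<and>
        (\<forall>c z. N z < \<infinity> \<longrightarrow> g (c *\<^sub>R z) = c * g z) \<and> g x = 1 \<and>
        (\<forall>z. N z < \<infinity> \<longrightarrow> \<bar>g z\<bar> * enn2real (N (ind A * x)) \<le> Kf * enn2real (N (ind A * z)))"
    using norming_functional by blast
  show ?thesis
  proof (rule that[of "2 * Cb * Kf"])
    show "0 < 2 * Cb * Kf" using Cb Kf by simp
    fix x y k assume x: "N x < \<infinity>" and y: "N y < \<infinity>" and le: "\<forall>t>0. K t y \<le> K t x"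
    let ?m = "\<lambda>j. min 1 (2 ^ j / 2 ^ k) :: real"
    have m: "0 < ?m j" for j by simp
    show "\<exists>g j. (\<forall>z z'. N z < \<infinity> \<longrightarrow> N z' < \<infinity> \<longrightarrow> g (z + z') = g z + g z') \<and>
        (\<forall>c z. N z < \<infinity> \<longrightarrow> g (c *\<^sub>R z) = c * g z) \<and> (r y k \<noteq> 0 \<longrightarrow> g x = 1) \<and>
        (\<forall>z. N z < \<infinity> \<longrightarrow> \<bar>g z\<bar> * r y k \<le> 2 * Cb * Kf * (?m j * r z j))"
    \<comment> \<open>If \<open>y\<close> vanishes on block \<open>k\<close>, nothing has to be
      produced there and the zero functional serves; hence the proviso on
      \<open>g x\<close>.\<close>
    proof (cases "r y k = 0")
      case True
      then show ?thesis using Cb Kf by (intro exI[of _ "\<lambda>_. 0"] exI[of _ 0]) auto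
    next
      case False
      have ry: "0 < r y k" using False by (simp add: less_le)
      have ryK: "r y k \<le> K (1 / 2 ^ k) x"
        using r_le_K[OF y, of k] le[rule_format, of "1 / 2 ^ k"] by simp
      have "\<exists>j. r y k < 2 * Cb * (?m j * r x j)"
      proof (rule ccontr)
        assume "\<not> ?thesis"
        then have "?m j * r x j \<le> r y k / (2 * Cb)" for j
          using Cb(1) by (simp add: not_less field_simps)
        then have "K (1 / 2 ^ k) x \<le> Cb * (r y k / (2 * Cb))"
          using Cb(1) ry by (intro Cb(2) x) auto
        then show False using ryK ry Cb(1) by simp
      qed
      then obtain j where j: "r y k < 2 * Cb * (?m j * r x j)" by blast
      have "r x j \<noteq> 0" using j ry by auto
      then have "ind (A j) * x \<noteq> 0" by (auto simp: r_def)
      then obtain g where g: "\<forall>z z'. N z < \<infinity> \<longrightarrow> N z' < \<infinity> \<longrightarrow> g (z + z') = g z + g z'"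
        "\<forall>c z. N z < \<infinity> \<longrightarrow> g (c *\<^sub>R z) = c * g z" "g x = 1"
        "\<forall>z. N z < \<infinity> \<longrightarrow> \<bar>g z\<bar> * r x j \<le> Kf * r z j"
        using Kf(2)[OF sets_A x, of j] unfolding r_def by blast
      have "\<bar>g z\<bar> * r y k \<le> 2 * Cb * Kf * (?m j * r z j)" if z: "N z < \<infinity>" for z
      proof -
        have "\<bar>g z\<bar> * r y k \<le> \<bar>g z\<bar> * (2 * Cb * (?m j * r x j))"
          using j by (intro mult_left_mono) auto
        also have "\<dots> = 2 * Cb * ?m j * (\<bar>g z\<bar> * r x j)" by (simp only: ac_simps)
        also have "\<dots> \<le> 2 * Cb * ?m j * (Kf * r z j)"
          using g(4) z Cb(1) m[of j] by (intro mult_left_mono) auto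
        finally show ?thesis by (simp only: ac_simps)
      qed
      then show ?thesis using g by blast
    qed
  qed
qed

end

section \<open>Cells: disjoint copies of the block structure\<close>

context block_sequence
begin

text \<open>A dyadic partition of block \<open>k\<close> into countably many pieces. Thus every
  \<open>cells n\<close> meets every block in positive measure, while different
  \<open>cells n\<close> are disjoint.\<close>

definition cell :: "nat \<Rightarrow> nat \<Rightarrow> real set"
  where "cell n k = {\<tau> (Suc k) + (\<tau> k - \<tau> (Suc k)) / 2 ^ Suc n <.. \<tau> (Suc k) + (\<tau> k - \<tau> (Suc k)) / 2 ^ n}"

definition cells :: "nat \<Rightarrow> real set"
  where "cells n = (\<Union>k. cell n k)"

lemma \<tau>_gap: "0 < \<tau> k - \<tau> (Suc k)"
  using \<tau>_Suc[of k] \<tau>_pos[of k] by simp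

lemma cell_subset: "cell n k \<subseteq> {\<tau> (Suc k)<..\<tau> k}"
proof
  fix t assume t: "t \<in> cell n k"
  have "0 < (\<tau> k - \<tau> (Suc k)) / 2 ^ Suc n" using \<tau>_gap[of k] by simp
  moreover have "(\<tau> k - \<tau> (Suc k)) / 2 ^ n \<le> (\<tau> k - \<tau> (Suc k)) / 1"
    using \<tau>_gap[of k] by (intro divide_left_mono) auto
  ultimately show "t \<in> {\<tau> (Suc k)<..\<tau> k}" using t by (auto simp: cell_def)
qed

lemma cell_subset_A: "cell n k \<subseteq> A k"
  using cell_subset[of n k] block_eqI[of k] \<tau>_pos[of "Suc k"] \<tau>_le_1[of k] by (fastforce simp: A_def)

lemma
  shows sets_cell: "cell n k \<in> sets unit_leb"
    and measure_cell: "measure unit_leb (cell n k) = (\<tau> k - \<tau> (Suc k)) / 2 ^ Suc n"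
proof -
  let ?a = "\<tau> (Suc k) + (\<tau> k - \<tau> (Suc k)) / 2 ^ Suc n" and ?b = "\<tau> (Suc k) + (\<tau> k - \<tau> (Suc k)) / 2 ^ n"
  have "(\<tau> k - \<tau> (Suc k)) / 2 ^ Suc n \<le> (\<tau> k - \<tau> (Suc k)) / 2 ^ n"
    using \<tau>_gap[of k] by (intro divide_left_mono) auto
  moreover have "0 < (\<tau> k - \<tau> (Suc k)) / 2 ^ Suc n" using \<tau>_gap[of k] by simp
  ultimately have ab: "0 \<le> ?a" "?a \<le> ?b" using \<tau>_pos[of "Suc k"] by linarith+
  have "(\<tau> k - \<tau> (Suc k)) / 2 ^ n \<le> (\<tau> k - \<tau> (Suc k)) / 1"
    using \<tau>_gap[of k] by (intro divide_left_mono) auto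
  then have b: "?b \<le> 1" using \<tau>_le_1[of k] by simp
  show "cell n k \<in> sets unit_leb" unfolding cell_def by (rule measure_unit_leb_cbox(1)[OF ab b])
  show "measure unit_leb (cell n k) = (\<tau> k - \<tau> (Suc k)) / 2 ^ Suc n"
    unfolding cell_def measure_unit_leb_cbox(2)[OF ab b] by simp
qed

lemma phi_cell_pos: "0 < \<phi> (measure unit_leb (cell n k))"
  using measure_unit_leb_le_1[of "cell n k"] \<tau>_gap[of k] by (intro phi_gt_0) (auto simp: measure_cell)

lemma sets_cells: "cells n \<in> sets unit_leb"
  unfolding cells_def using sets_cell by blast

lemma cell_disjoint: "m < n \<Longrightarrow> cell m k \<inter> cell n k = {}"
proof -
  assume "m < n"
  then have "(2::real) ^ Suc m \<le> 2 ^ n" by (intro power_increasing) auto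
  then have "(\<tau> k - \<tau> (Suc k)) / 2 ^ n \<le> (\<tau> k - \<tau> (Suc k)) / 2 ^ Suc m"
    using \<tau>_gap[of k] by (intro divide_left_mono) auto
  then show ?thesis by (auto simp: cell_def)
qed

lemma A_Int_cells: "A k \<inter> cells n = cell n k"
proof (intro equalityI subsetI)
  fix t assume "t \<in> A k \<inter> cells n"
  then obtain j where j: "t \<in> cell n j" "t \<in> A k" by (auto simp: cells_def)
  then have "t \<in> A j" using cell_subset_A by blast
  then have "j = k" using j(2) by (simp add: A_def)
  then show "t \<in> cell n k" using j by simp
next
  fix t assume "t \<in> cell n k"
  then show "t \<in> A k \<inter> cells n" using cell_subset_A by (auto simp: cells_def)
qed

lemma cell_Int_cells: "cell n k \<inter> cells m = (if m = n then cell n k else {})"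
proof -
  have "cell n k \<inter> cells m = cell n k \<inter> cell m k"
    using cell_subset_A[of n k] A_Int_cells[of k m] by blast
  then show ?thesis using cell_disjoint[of m n k] cell_disjoint[of n m k] by (cases m n rule: linorder_cases) auto
qed

text \<open>The indicators of \<open>cell n k\<close> and the functionals \<open>G n k\<close> play
  the role of unit vectors and coordinates of a sequence space carried by
  \<open>cells n\<close>.\<close>

lemma cell_functionals:
  obtains Kf G where "0 < Kf"
    "\<And>n k z z'. N z < \<infinity> \<Longrightarrow> N z' < \<infinity> \<Longrightarrow> G n k (z + z') = G n k z + G n k z'"
    "\<And>n k c z. N z < \<infinity> \<Longrightarrow> G n k (c *\<^sub>R z) = c * G n k z"
    "\<And>n k. G n k (ind (cell n k)) = (1::real)"
    "\<And>n k z. N z < \<infinity> \<Longrightarrow> \<bar>G n k z\<bar> * \<phi> (measure unit_leb (cell n k)) \<le> Kf * enn2real (N (ind (cell n k) * z))"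
proof -
  obtain Kf where Kf: "0 < Kf"
    "\<And>A x. A \<in> sets unit_leb \<Longrightarrow> N x < \<infinity> \<Longrightarrow> ind A * x \<noteq> 0 \<Longrightarrow>
      \<exists>g. (\<forall>z z'. N z < \<infinity> \<longrightarrow> N z' < \<infinity> \<longrightarrow> g (z + z') = g z + g z') \<and>
        (\<forall>c z. N z < \<infinity> \<longrightarrow> g (c *\<^sub>R z) = c * g z) \<and> g x = 1 \<and>
        (\<forall>z. N z < \<infinity> \<longrightarrow> \<bar>g z\<bar> * enn2real (N (ind A * x)) \<le> Kf * enn2real (N (ind A * z)))"
    using norming_functional by blast
  have "\<exists>g. (\<forall>z z'. N z < \<infinity> \<longrightarrow> N z' < \<infinity> \<longrightarrow> g (z + z') = g z + g z') \<and>
        (\<forall>c z. N z < \<infinity> \<longrightarrow> g (c *\<^sub>R z) = c * g z) \<and> g (ind (cell n k)) = 1 \<and>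
        (\<forall>z. N z < \<infinity> \<longrightarrow> \<bar>g z\<bar> * \<phi> (measure unit_leb (cell n k)) \<le> Kf * enn2real (N (ind (cell n k) * z)))" for n k
  proof -
    have sq: "ind (cell n k) * ind (cell n k) = ind (cell n k)" using sets_cell by (simp add: ind_mult_ind)
    have Nc: "N (ind (cell n k)) = ennreal (\<phi> (measure unit_leb (cell n k)))" by (rule N_ind[OF sets_cell])
    have nz: "ind (cell n k) * ind (cell n k) \<noteq> 0"
      unfolding sq using Nc phi_cell_pos[of n k] N_eq_0_iff[of "ind (cell n k)"] by auto
    show ?thesis
      using Kf(2)[OF sets_cell _ nz] phi_cell_pos[of n k] unfolding sq Nc by simp
  qed
  then have "\<exists>G. \<forall>n k. (\<forall>z z'. N z < \<infinity> \<longrightarrow> N z' < \<infinity> \<longrightarrow> G n k (z + z') = G n k z + G n k z') \<and>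
        (\<forall>c z. N z < \<infinity> \<longrightarrow> G n k (c *\<^sub>R z) = c * G n k z) \<and> G n k (ind (cell n k)) = (1::real) \<and>
        (\<forall>z. N z < \<infinity> \<longrightarrow> \<bar>G n k z\<bar> * \<phi> (measure unit_leb (cell n k)) \<le> Kf * enn2real (N (ind (cell n k) * z)))"
    by (intro choice allI) 
  then obtain G where G: "\<forall>n k. (\<forall>z z'. N z < \<infinity> \<longrightarrow> N z' < \<infinity> \<longrightarrow> G n k (z + z') = G n k z + G n k z') \<and>
        (\<forall>c z. N z < \<infinity> \<longrightarrow> G n k (c *\<^sub>R z) = c * G n k z) \<and> G n k (ind (cell n k)) = (1::real) \<and>
        (\<forall>z. N z < \<infinity> \<longrightarrow> \<bar>G n k z\<bar> * \<phi> (measure unit_leb (cell n k)) \<le> Kf * enn2real (N (ind (cell n k) * z)))" ..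
  show ?thesis
    by (rule that[OF Kf(1), of G]) (use G in blast)+
qed

text \<open>Every operator needed factors through the couple of weighted \<open>l\<^sub>\<infinity>\<close> spaces, which embeds
  complementably into functions supported on \<open>cells n\<close>, for each \<open>n\<close> separately. This yields the
  orthogonality required for the gliding hump.\<close>

lemma factorization:
  obtains M where "0 < M"
    "\<And>x y. N x < \<infinity> \<Longrightarrow> N y < \<infinity> \<Longrightarrow> (\<forall>t>0. K t y \<le> K t x) \<Longrightarrow>
      \<exists>g h. \<forall>n. bounded_operator w M (g n) \<and> bounded_operator w M (h n) \<and> g n (h n x) = y \<and>
        (\<forall>u. N u < \<infinity> \<longrightarrow> ind (cells n) * u = 0 \<longrightarrow> g n u = 0) \<and> (\<forall>z. ind (cells n) * h n z = h n z)"
proof -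
  obtain Cb where Cb: "0 < Cb"
    "\<And>f v M. 0 \<le> M \<Longrightarrow> (\<And>k. N (ind (A k) * v) < \<infinity>) \<Longrightarrow>
      (\<And>k x y. N x < \<infinity> \<Longrightarrow> N y < \<infinity> \<Longrightarrow> f k (x + y) = f k x + f k y) \<Longrightarrow>
      (\<And>k c x. N x < \<infinity> \<Longrightarrow> f k (c *\<^sub>R x) = c * f k x) \<Longrightarrow>
      (\<And>k. \<exists>j. \<forall>z. N z < \<infinity> \<longrightarrow> \<bar>f k z\<bar> * r v k \<le> M * (min 1 (2 ^ j / 2 ^ k) * r z j)) \<Longrightarrow>
      bounded_operator w (Cb * M) (\<lambda>z. step (\<lambda>k. f k z) * v)"
    using block_operator by blast
  obtain Mt where Mt: "0 < Mt"
    "\<And>x y k. N x < \<infinity> \<Longrightarrow> N y < \<infinity> \<Longrightarrow> (\<forall>t>0. K t y \<le> K t x) \<Longrightarrow>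
      \<exists>g j. (\<forall>z z'. N z < \<infinity> \<longrightarrow> N z' < \<infinity> \<longrightarrow> g (z + z') = g z + g z') \<and>
        (\<forall>c z. N z < \<infinity> \<longrightarrow> g (c *\<^sub>R z) = c * g z) \<and> (r y k \<noteq> 0 \<longrightarrow> g x = 1) \<and>
        (\<forall>z. N z < \<infinity> \<longrightarrow> \<bar>g z\<bar> * r y k \<le> Mt * (min 1 (2 ^ j / 2 ^ k) * r z j))"
    using transfer_functionals by blast
  obtain Kf G where Kf: "0 < Kf"
    and G_add: "\<And>n k z z'. N z < \<infinity> \<Longrightarrow> N z' < \<infinity> \<Longrightarrow> G n k (z + z') = G n k z + G n k z'"
    and G_scale: "\<And>n k c z. N z < \<infinity> \<Longrightarrow> G n k (c *\<^sub>R z) = c * G n k z"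
    and G_one: "\<And>n k. G n k (ind (cell n k)) = (1::real)"
    and G_bd: "\<And>n k z. N z < \<infinity> \<Longrightarrow> \<bar>G n k z\<bar> * \<phi> (measure unit_leb (cell n k)) \<le> Kf * enn2real (N (ind (cell n k) * z))"
    using cell_functionals by metis
  define M where "M = max (Cb * Mt) (Cb * Kf)"
  have mono: "bounded_operator w M T" if "bounded_operator w M' T" "M' \<le> M" for M' T
    using that unfolding bounded_operator_def
    by (meson ennreal_leI mult_right_mono order_trans zero_le)
  let ?p = "\<lambda>n k. \<phi> (measure unit_leb (cell n k))"
  have ind_cell: "ind (cell n k) * z = ind (cell n k) * (ind (A k) * z)" for n k z
    using ind_mult_ind[OF sets_cell sets_A, of n k k] cell_subset_A[of n k]
    by (simp add: mult.assoc[symmetric] Int_absorb2)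
  have G_zero: "G n k u = 0" if "N u < \<infinity>" "ind (cell n k) * u = 0" for n k u
    using G_bd[OF that(1), of n k] that(2) phi_cell_pos[of n k] by (simp add: mult_le_0_iff)
  have r_cells: "r (ind (cells n)) k = ?p n k" for n k
    using ind_A_mult_ind[OF sets_cells, of k n] phi_cell_pos[of n k] unfolding A_Int_cells
    by (simp add: r_def N_ind[OF sets_cell])
  have N_cells: "N (ind (cells n)) < \<infinity>" for n by (simp add: N_ind[OF sets_cells])
  show ?thesis
  proof (rule that[of M])
    show "0 < M" using mult_pos_pos[OF Cb(1) Kf] by (simp add: M_def)
    fix x y assume x: "N x < \<infinity>" and y: "N y < \<infinity>" and le: "\<forall>t>0. K t y \<le> K t x"
    have "\<forall>k. \<exists>g j. (\<forall>z z'. N z < \<infinity> \<longrightarrow> N z' < \<infinity> \<longrightarrow> g (z + z') = g z + g z') \<and>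
        (\<forall>c z. N z < \<infinity> \<longrightarrow> g (c *\<^sub>R z) = c * g z) \<and> (r y k \<noteq> 0 \<longrightarrow> g x = 1) \<and>
        (\<forall>z. N z < \<infinity> \<longrightarrow> \<bar>g z\<bar> * r y k \<le> Mt * (min 1 (2 ^ j / 2 ^ k) * r z j))"
      using Mt(2)[OF x y le] by blast
    then obtain l where l: "\<forall>k. \<exists>j. (\<forall>z z'. N z < \<infinity> \<longrightarrow> N z' < \<infinity> \<longrightarrow> l k (z + z') = l k z + l k z') \<and>
        (\<forall>c z. N z < \<infinity> \<longrightarrow> l k (c *\<^sub>R z) = c * l k z) \<and> (r y k \<noteq> 0 \<longrightarrow> l k x = (1::real)) \<and>
        (\<forall>z. N z < \<infinity> \<longrightarrow> \<bar>l k z\<bar> * r y k \<le> Mt * (min 1 (2 ^ j / 2 ^ k) * r z j))"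
      by (rule exE[OF choice]) blast
    \<comment> \<open>\<open>h n\<close> stores the numbers \<open>r y k * l k z\<close> as
      coordinates on the normalized indicators of the cells; \<open>g n\<close> reads them off and
      rebuilds \<open>y\<close> block by block.\<close>
    define h where "h n z = step (\<lambda>k. r y k * l k z / ?p n k) * ind (cells n)" for n z
    \<comment> \<open>Where \<open>r y k = 0\<close> the quotient is 0 by convention, which is right
      because \<open>y\<close> vanishes on that block.\<close>
    define g where "g n z = step (\<lambda>k. G n k z * ?p n k / r y k) * y" for n z
    have h: "bounded_operator w M (h n)" for n
    proof (rule mono)
      show "bounded_operator w (Cb * Mt) (h n)"
        unfolding h_def
      proof (rule Cb(2))
        fix k
        show "N (ind (A k) * ind (cells n)) < \<infinity>" by (rule le_less_trans[OF N_ind_le[OF sets_A] N_cells])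
        show "\<exists>j. \<forall>z. N z < \<infinity> \<longrightarrow> \<bar>r y k * l k z / ?p n k\<bar> * r (ind (cells n)) k \<le> Mt * (min 1 (2 ^ j / 2 ^ k) * r z j)"
          using l[rule_format, of k] phi_cell_pos[of n k] by (auto simp: r_cells abs_mult mult.commute)
      qed (use l Mt in \<open>auto simp: algebra_simps add_divide_distrib\<close>)
    qed (simp add: M_def)
    have g: "bounded_operator w M (g n)" for n
    proof (rule mono)
      show "bounded_operator w (Cb * Kf) (g n)"
        unfolding g_def
      proof (rule Cb(2))
        fix k
        show "N (ind (A k) * y) < \<infinity>" by (rule le_less_trans[OF N_ind_le[OF sets_A] y])
        show "\<exists>j. \<forall>z. N z < \<infinity> \<longrightarrow> \<bar>G n k z * ?p n k / r y k\<bar> * r y k \<le> Kf * (min 1 (2 ^ j / 2 ^ k) * r z j)"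
        proof (intro exI[of _ k] allI impI)
          fix z assume z: "N z < \<infinity>"
          have "\<bar>G n k z * ?p n k / r y k\<bar> * r y k \<le> \<bar>G n k z\<bar> * ?p n k"
            using phi_cell_pos[of n k] by (cases "r y k = 0") (auto simp: abs_mult)
          also have "\<dots> \<le> Kf * enn2real (N (ind (cell n k) * z))" by (rule G_bd[OF z])
          also have "\<dots> \<le> Kf * r z k"
          proof (rule mult_left_mono)
            show "enn2real (N (ind (cell n k) * z)) \<le> r z k"
              unfolding r_def ind_cell[of n k z]
              by (rule enn2real_mono[OF N_ind_le[OF sets_cell]]) (use N_ind_A[OF z] in simp)
          qed (use Kf in simp)
          finally show "\<bar>G n k z * ?p n k / r y k\<bar> * r y k \<le> Kf * (min 1 (2 ^ k / 2 ^ k) * r z k)" by simp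
        qed
      qed (use G_add G_scale Kf in \<open>auto simp: algebra_simps add_divide_distrib\<close>)
    qed (simp add: M_def)
    have hx: "N (h n x) < \<infinity>" for n by (rule bounded_operatorD(5)[OF h x])
    have cell_h: "ind (cell n k) * h n x = (r y k * l k x / ?p n k) *\<^sub>R ind (cell n k)" for n k
    proof -
      have "ind (cell n k) * h n x = ind (cell n k) * ((r y k * l k x / ?p n k) *\<^sub>R (ind (A k) * ind (cells n)))"
        unfolding ind_cell[of n k "h n x"] by (simp add: h_def ind_A_step)
      also have "ind (A k) * ind (cells n) = ind (cell n k)"
        by (simp add: ind_mult_ind sets_cells A_Int_cells)
      finally show ?thesis by (simp add: ind_mult_ind sets_cell)
    qed
    \<comment> \<open>On \<open>cell n k\<close> the function \<open>h n x\<close> is a multiple of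
      the indicator, and \<open>G n k\<close> annihilates whatever vanishes on the cell.\<close>
    have Gh: "G n k (h n x) = r y k * l k x / ?p n k" for n k
    proof -
      let ?c = "r y k * l k x / ?p n k"
      have Nc: "N (ind (cell n k)) < \<infinity>" by (simp add: N_ind[OF sets_cell])
      have Nc': "N ((- ?c) *\<^sub>R ind (cell n k)) < \<infinity>" using Nc unfolding N_scaleR by (simp add: ennreal_mult_less_top)
      have "G n k (h n x + (- ?c) *\<^sub>R ind (cell n k)) = 0"
      proof (rule G_zero)
        show "N (h n x + (- ?c) *\<^sub>R ind (cell n k)) < \<infinity>"
          by (rule le_less_trans[OF N_triangle]) (use hx Nc' in simp)
        show "ind (cell n k) * (h n x + (- ?c) *\<^sub>R ind (cell n k)) = 0"
          by (simp add: distrib_left cell_h ind_mult_ind sets_cell right_diff_distrib)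
      qed
      then show ?thesis unfolding G_add[OF hx Nc'] G_scale[OF Nc] by (simp add: G_one)
    qed
    have gh: "g n (h n x) = y" for n
    proof (rule L0_eq_blocks)
      fix k
      show "ind (A k) * g n (h n x) = ind (A k) * y"
      proof (cases "r y k = 0")
        case True
        then have "ind (A k) * y = 0" using N_ind_A[OF y, of k] N_eq_0_iff by simp
        then show ?thesis by (simp add: g_def ind_A_step)
      next
        case False
        then have "l k x = 1" using l by blast
        then show ?thesis using False phi_cell_pos[of n k] by (simp add: g_def ind_A_step Gh)
      qed
    qed
    have g0: "g n u = 0" if u: "N u < \<infinity>" "ind (cells n) * u = 0" for n u
    proof -
      have cell_u: "ind (cell n k) * u = 0" for k
      proof -
        have "ind (cell n k) * u = ind (cell n k) * (ind (cells n) * u)"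
          using ind_mult_ind[OF sets_cell sets_cells, of n k n] by (simp add: mult.assoc[symmetric] cell_Int_cells)
        then show ?thesis using u by simp
      qed
      show ?thesis
        by (rule L0_eq_blocks) (simp add: g_def ind_A_step G_zero[OF u(1) cell_u])
    qed
    have hs: "ind (cells n) * h n z = h n z" for n z
      using ind_mult_ind[OF sets_cells sets_cells, of n n] unfolding h_def
      by (subst mult.left_commute) simp
    show "\<exists>g h. \<forall>n. bounded_operator w M (g n) \<and> bounded_operator w M (h n) \<and> g n (h n x) = y \<and>
        (\<forall>u. N u < \<infinity> \<longrightarrow> ind (cells n) * u = 0 \<longrightarrow> g n u = 0) \<and> (\<forall>z. ind (cells n) * h n z = h n z)"
      by (rule exI[of _ g], rule exI[of _ h], intro allI conjI impI; (rule g h gh hs | rule g0; assumption))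
  qed
qed

text \<open>If no constant works, each pair \<open>(i, j)\<close> yields \<open>x\<close> and
  \<open>y\<close> that violate the constant \<open>4 ^ (i + j)\<close>. Routing the operator of
  this pair through the cells with number \<open>prod_encode (i, j)\<close> makes all these
  factorizations orthogonal, and the gliding hump bounds one of them by the very constant it
  violates.\<close>

theorem K_monotone_couple_w: "K_monotone_couple (marcinkiewicz \<phi>) (weighted (marcinkiewicz \<phi>) w)"
  unfolding K_monotone_couple_def
proof (intro allI impI, rule ccontr)
  fix E assume E: "interpolation_space E (marcinkiewicz \<phi>) (weighted (marcinkiewicz \<phi>) w)"
    and not: "\<not> K_monotone_space E (marcinkiewicz \<phi>) (weighted (marcinkiewicz \<phi>) w)"
  obtain M where M: "0 < M"
    "\<And>x y. N x < \<infinity> \<Longrightarrow> N y < \<infinity> \<Longrightarrow> (\<forall>t>0. K t y \<le> K t x) \<Longrightarrow>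
      \<exists>g h. \<forall>n. bounded_operator w M (g n) \<and> bounded_operator w M (h n) \<and> g n (h n x) = y \<and>
        (\<forall>u. N u < \<infinity> \<longrightarrow> ind (cells n) * u = 0 \<longrightarrow> g n u = 0) \<and> (\<forall>z. ind (cells n) * h n z = h n z)"
    using factorization by blast
  have "cont_embedded E (couple_sum (marcinkiewicz \<phi>) (weighted (marcinkiewicz \<phi>) w))"
    using E by (simp add: interpolation_space_def)
  then have E_fin: "N x < \<infinity>" if "x \<in> pts E" for x
    using that pts_couple_sum_ge_1[OF w_ge_1] by (auto simp: cont_embedded_def)
  have bad: "\<exists>x y. x \<in> pts E \<and> N y < \<infinity> \<and> (\<forall>t>0. K t y \<le> K t x) \<and> \<not> (y \<in> pts E \<and> nrm E y \<le> c * nrm E x)"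
    if "1 \<le> c" for c
  proof (rule ccontr)
    assume "\<not> ?thesis"
    then have "\<forall>x\<in>pts E. \<forall>y\<in>pts (couple_sum (marcinkiewicz \<phi>) (weighted (marcinkiewicz \<phi>) w)).
      (\<forall>t>0. K t y \<le> K t x) \<longrightarrow> y \<in> pts E \<and> nrm E y \<le> c * nrm E x"
      using pts_couple_sum_ge_1[OF w_ge_1] by metis
    then have "K_monotone_space E (marcinkiewicz \<phi>) (weighted (marcinkiewicz \<phi>) w)"
      unfolding K_monotone_space_def using that by (intro exI[of _ c] conjI)
    then show False using not by contradiction
  qed
  have "\<exists>x y g h. x \<in> pts E \<and> \<not> (y \<in> pts E \<and> nrm E y \<le> 4 ^ (i + j) * nrm E x) \<and>
      (\<forall>n. bounded_operator w M (g n) \<and> bounded_operator w M (h n) \<and> g n (h n x) = y \<and>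
        (\<forall>u. N u < \<infinity> \<longrightarrow> ind (cells n) * u = 0 \<longrightarrow> g n u = 0) \<and> (\<forall>z. ind (cells n) * h n z = h n z))" for i j :: nat
  proof -
    have "(1::real) \<le> 4 ^ (i + j)" by simp
    then obtain x y where xy: "x \<in> pts E" "N y < \<infinity>" "\<forall>t>0. K t y \<le> K t x" "\<not> (y \<in> pts E \<and> nrm E y \<le> 4 ^ (i + j) * nrm E x)"
      using bad by meson
    obtain g h where "\<forall>n. bounded_operator w M (g n) \<and> bounded_operator w M (h n) \<and> g n (h n x) = y \<and>
        (\<forall>u. N u < \<infinity> \<longrightarrow> ind (cells n) * u = 0 \<longrightarrow> g n u = 0) \<and> (\<forall>z. ind (cells n) * h n z = h n z)"
      using M(2)[OF E_fin[OF xy(1)] xy(2,3)] by blast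
    then show ?thesis using xy by blast
  qed
  then obtain x y g h where gh: "\<And>i j. x i j \<in> pts E" "\<And>i j. \<not> (y i j \<in> pts E \<and> nrm E (y i j) \<le> 4 ^ (i + j) * nrm E (x i j))"
    "\<And>i j n. bounded_operator w M (g i j n)" "\<And>i j n. bounded_operator w M (h i j n)" "\<And>i j n. g i j n (h i j n (x i j)) = y i j"
    "\<And>i j n u. N u < \<infinity> \<Longrightarrow> ind (cells n) * u = 0 \<Longrightarrow> g i j n u = 0"
    "\<And>i j n z. ind (cells n) * h i j n z = h i j n z"
    by metis
  let ?n = "\<lambda>i j. prod_encode (i, j)"
  have "\<exists>i j. \<forall>x\<in>pts E. g i j (?n i j) (h i j (?n i j) x) \<in> pts E \<and>
    nrm E (g i j (?n i j) (h i j (?n i j) x)) \<le> 4 ^ (i + j) * nrm E x"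
  proof (rule orthogonal_factorization_bound[where g = "\<lambda>i j. g i j (?n i j)" and h = "\<lambda>i j. h i j (?n i j)",
      OF w_ge_1 E])
    show "0 \<le> M" using M by simp
    fix i j i' j' :: nat and z assume z: "N z < \<infinity>" and ne: "(i, j) \<noteq> (i', j')"
    show "g i j (?n i j) (h i' j' (?n i' j') z) = 0"
    proof (rule gh(6))
      show "N (h i' j' (?n i' j') z) < \<infinity>" by (rule bounded_operatorD(5)[OF gh(4) z])
      have neq: "?n i j \<noteq> ?n i' j'" using ne by (simp add: prod_encode_eq)
      have "cells (?n i j) \<inter> cells (?n i' j') = {}"
      proof -
        have "cell (?n i j) k \<inter> cells (?n i' j') = {}" for k
          unfolding cell_Int_cells by (rule if_not_P) (use neq in metis)
        then show ?thesis unfolding cells_def[of "?n i j"] by blast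
      qed
      then have "ind (cells (?n i j)) * (ind (cells (?n i' j')) * h i' j' (?n i' j') z) = 0"
        using ind_mult_ind[OF sets_cells sets_cells, of "?n i j" "?n i' j'"] by (simp add: mult.assoc[symmetric] ind_empty)
      then show "ind (cells (?n i j)) * h i' j' (?n i' j') z = 0" by (simp add: gh(7))
    qed
  qed (rule gh)+
  then show False using gh(1,2,5) by metis
qed

end

context parameter_fn_index
begin

lemma exists_K_monotone_weight:
  assumes "almost_slowly_varying \<phi>"
  shows "\<exists>w. nontrivial_weight w \<and> K_monotone_couple (marcinkiewicz \<phi>) (weighted (marcinkiewicz \<phi>) w)"
proof -
  obtain C \<tau> where "2 \<le> C" "\<tau> 0 = 1" "\<And>k. 0 < \<tau> k" "\<And>k. \<tau> (Suc k) \<le> \<tau> k / 2"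
    "\<And>k s. 0 < s \<Longrightarrow> s \<le> \<tau> k \<Longrightarrow> real (k + 2) * s \<le> 1 \<Longrightarrow> \<phi> (real (k + 2) * s) \<le> C * \<phi> s"
    using almost_slowly_varying_sequence[OF assms] by blast
  then interpret block_sequence \<phi> \<tau> C by unfold_locales auto
  show ?thesis using nontrivial_w K_monotone_couple_w by blast
qed

end

section \<open>A co-orbit interpolation space\<close>

lemma sum_geometric_le:
  assumes "finite F"
  shows "(\<Sum>i\<in>F. (1/4::real) ^ i) \<le> 4/3"
proof -
  have "(\<Sum>i\<in>F. (1/4::real) ^ i) \<le> (\<Sum>i. (1/4) ^ i)"
    using assms by (intro sum_le_suminf summable_geometric) auto
  then show ?thesis by (simp add: suminf_geometric)
qed

context parameter_fn
begin

lemma N_le_scale: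
  assumes "0 \<le> c" "AE t in unit_leb. \<bar>rep_L0 u t\<bar> \<le> c * \<bar>rep_L0 z t\<bar>"
  shows "N u \<le> ennreal c * N z"
proof -
  have "N u \<le> N (c *\<^sub>R z)"
    by (rule N_solid) (use assms rep_L0_scaleR[of c z] in \<open>auto elim!: eventually_elim2 simp: abs_mult\<close>)
  then show ?thesis using assms(1) by (simp add: N_scaleR)
qed

text \<open>For a single set, the block-diagonal part of \<open>S\<close> is the average of
  \<open>S\<close> and \<open>U S U\<close>, where \<open>U\<close> changes the sign off the set and
  does not increase the norm. Induction peels off one set at a time; the remainder
  \<open>R F\<close> is carried along so that the statement reproduces itself.\<close>

lemma pinching:
  assumes F: "finite F" and A: "\<And>i. A i \<in> sets unit_leb" and disj: "\<And>i j. i \<noteq> j \<Longrightarrow> A i \<inter> A j = {}"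
    and add: "\<And>x y. N x < \<infinity> \<Longrightarrow> N y < \<infinity> \<Longrightarrow> S (x + y) = S x + S y"
    and scale: "\<And>c x. N x < \<infinity> \<Longrightarrow> S (c *\<^sub>R x) = c *\<^sub>R S x"
    and le: "\<And>x. N x < \<infinity> \<Longrightarrow> N (S x) \<le> N x" and z: "N z < \<infinity>"
  defines "R \<equiv> \<lambda>F. ind ({0..1} - (\<Union>i\<in>F. A i))"
  shows "N ((\<Sum>i\<in>F. ind (A i) * S (ind (A i) * z)) + R F * S (R F * z)) \<le> N z"
  using F add scale le
proof (induction F arbitrary: S rule: finite_induct)
  case empty
  then show ?case using z by (simp add: R_def)
next
  case (insert k F)
  let ?P = "ind (A k)" and ?Q = "ind ({0..1} - A k)"
  have Qs: "{0..1} - A k \<in> sets unit_leb" using A by auto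
  have Rs: "{0..1} - (\<Union>i\<in>G. A i) \<in> sets unit_leb" if "finite G" for G using A that by auto
  have RF: "R F = ind ({0..1} - (\<Union>i\<in>F. A i))" by (simp add: R_def)
  have PQ: "?P * u + ?Q * u = u" for u by (rule ind_complement[OF A])
  define U where "U u = ?P * u + (-1) *\<^sub>R (?Q * u)" for u
  have NU: "N (U u) \<le> N u" for u
  proof (rule N_solid)
    note AE_unit
    then show "AE t in unit_leb. \<bar>rep_L0 (U u) t\<bar> \<le> \<bar>rep_L0 u t\<bar>"
      using rep_L0_ind_times[OF A[of k], of u] rep_L0_ind_times[OF Qs, of u]
        rep_L0_plus[of "?P * u" "(-1) *\<^sub>R (?Q * u)"] rep_L0_scaleR[of "-1" "?Q * u"]
      unfolding U_def by eventually_elim (auto simp: indicator_def)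
  qed
  have finP: "N (ind B * u) < \<infinity>" if "N u < \<infinity>" "B \<in> sets unit_leb" for B u
    using N_ind_le[OF that(2), of u] that(1) by (rule le_less_trans)
  note Sadd = insert.prems(1) and Sscale = insert.prems(2) and Sle = insert.prems(3)
  have S0: "S 0 = 0" using Sscale[of 0 0] by simp
  \<comment> \<open>\<open>S'\<close> inherits linearity and the norm bound from \<open>S\<close>
    and has the same diagonal entries on the sets still to be treated, so the induction hypothesis
    is applied to \<open>S'\<close>.\<close>
  define S' where "S' u = ?P * S (?P * u) + ?Q * S (?Q * u)" for u
  have S'_avg: "S' u = (1/2) *\<^sub>R (S u + U (S (U u)))" if u: "N u < \<infinity>" for u
  proof -
    let ?a = "S (?P * u)" and ?b = "S (?Q * u)"
    have f: "N (?P * u) < \<infinity>" "N (?Q * u) < \<infinity>" using finP u A Qs by auto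
    have f': "N ((-1) *\<^sub>R (?Q * u)) < \<infinity>" using f(2) by (simp only: N_scaleR) simp
    have 1: "S u = ?a + ?b" using Sadd[OF f] PQ[of u] by simp
    have 2: "S (U u) = ?a - ?b" unfolding U_def Sadd[OF f(1) f'] Sscale[OF f(2)] by simp
    have "S u + U (S (U u)) = (?P * (?a + ?b) + ?Q * (?a + ?b)) + (?P * (?a - ?b) - ?Q * (?a - ?b))"
    proof -
      have "U (S (U u)) = ?P * (?a - ?b) - ?Q * (?a - ?b)" unfolding 2 by (simp add: U_def)
      then show ?thesis unfolding 1 PQ by simp
    qed
    also have "\<dots> = 2 *\<^sub>R S' u" by (simp add: S'_def algebra_simps scaleR_2)
    finally show ?thesis by simp
  qed
  have IH: "N ((\<Sum>i\<in>F. ind (A i) * S' (ind (A i) * z)) + R F * S' (R F * z)) \<le> N z"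
  proof (rule insert.IH)
    fix x y c assume x: "N x < \<infinity>"
    show "S' (x + y) = S' x + S' y" if y: "N y < \<infinity>"
      unfolding S'_def distrib_left Sadd[OF finP[OF x A] finP[OF y A]] Sadd[OF finP[OF x Qs] finP[OF y Qs]]
      by (simp add: algebra_simps)
    show "S' (c *\<^sub>R x) = c *\<^sub>R S' x"
      unfolding S'_def mult_scaleR_right Sscale[OF finP[OF x A]] Sscale[OF finP[OF x Qs]] scaleR_add_right ..
    have "N (S' x) \<le> ennreal (1/2) * (N (S x) + N (U (S (U x))))"
      unfolding S'_avg[OF x] N_scaleR by (intro mult_mono N_triangle) auto
    also have "\<dots> \<le> ennreal (1/2) * (N x + N x)"
    proof (intro mult_left_mono add_mono Sle x)
      have "N (U x) < \<infinity>" using NU x by (rule le_less_trans)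
      then have "N (U (S (U x))) \<le> N (U x)" using order_trans[OF NU Sle] by blast
      also have "\<dots> \<le> N x" by (rule NU)
      finally show "N (U (S (U x))) \<le> N x" .
    qed simp
    also have "\<dots> = N x"
    proof -
      have "ennreal (1/2) * (N x + N x) = (ennreal (1/2) * ennreal 2) * N x"
        by (simp only: mult_2[symmetric] mult.assoc ennreal_numeral)
      also have "ennreal (1/2) * ennreal 2 = 1" by (subst ennreal_mult[symmetric]) auto
      finally show ?thesis by simp
    qed
    finally show "N (S' x) \<le> N x" .
  qed
  have i: "ind (A i) * S' (ind (A i) * z) = ind (A i) * S (ind (A i) * z)" if "i \<in> F" for i
  proof -
    have ik: "i \<noteq> k" using that insert.hyps by auto
    have "?P * (ind (A i) * z) = 0" using disj[OF ik] by (simp add: mult.assoc[symmetric] ind_mult_ind A ind_empty Int_commute)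
    moreover have "?Q * (ind (A i) * z) = ind (A i) * z"
    proof -
      have "({0..1} - A k) \<inter> A i = A i" using disj[OF ik] sets.sets_into_space[OF A[of i]] by auto
      then show ?thesis by (simp add: mult.assoc[symmetric] ind_mult_ind A Qs)
    qed
    moreover have "ind (A i) * (?Q * u) = ind (A i) * u" for u
    proof -
      have "A i \<inter> ({0..1} - A k) = A i" using disj[OF ik] sets.sets_into_space[OF A[of i]] by auto
      then show ?thesis by (simp add: mult.assoc[symmetric] ind_mult_ind A Qs)
    qed
    ultimately show ?thesis by (simp add: S'_def S0)
  qed
  have r: "R F * S' (R F * z) = ?P * S (?P * z) + R (insert k F) * S (R (insert k F) * z)"
  proof -
    have "A k \<inter> A i = {}" if "i \<in> F" for i using disj[of k i] that insert.hyps by blast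
    then have nk: "A k \<inter> (\<Union>i\<in>F. A i) = {}" by blast
    have "?P * (R F * u) = ?P * u" "R F * (?P * u) = ?P * u" for u
    proof -
      have "A k \<inter> ({0..1} - (\<Union>i\<in>F. A i)) = A k" "({0..1} - (\<Union>i\<in>F. A i)) \<inter> A k = A k"
        using nk sets.sets_into_space[OF A[of k]] by auto
      then show "?P * (R F * u) = ?P * u" "R F * (?P * u) = ?P * u"
        unfolding RF by (simp_all add: mult.assoc[symmetric] ind_mult_ind A Rs[OF insert.hyps(1)])
    qed
    moreover have "?Q * (R F * u) = R (insert k F) * u" "R F * (?Q * u) = R (insert k F) * u" for u
    proof -
      have "({0..1} - A k) \<inter> ({0..1} - (\<Union>i\<in>F. A i)) = {0..1} - (\<Union>i\<in>insert k F. A i)"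
        "({0..1} - (\<Union>i\<in>F. A i)) \<inter> ({0..1} - A k) = {0..1} - (\<Union>i\<in>insert k F. A i)" by auto
      then show "?Q * (R F * u) = R (insert k F) * u" "R F * (?Q * u) = R (insert k F) * u"
        unfolding R_def by (simp_all only: mult.assoc[symmetric] ind_mult_ind[OF Qs Rs[OF insert.hyps(1)]]
          ind_mult_ind[OF Rs[OF insert.hyps(1)] Qs])
    qed
    ultimately show ?thesis by (simp add: S'_def distrib_left)
  qed
  have "(\<Sum>i\<in>insert k F. ind (A i) * S (ind (A i) * z)) + R (insert k F) * S (R (insert k F) * z)
    = (\<Sum>i\<in>F. ind (A i) * S' (ind (A i) * z)) + R F * S' (R F * z)"
    using insert.hyps by (simp add: i r add_ac)
  then show ?case using IH by simp
qed

end

text \<open>The parameter is the square root of the level, matching the coefficients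
  \<open>1 / e j\<close> used later. The factor 2 allows countably many such sets to cover the range
  of a positive weight.\<close>

definition level_set :: "L0 \<Rightarrow> real \<Rightarrow> real set"
  where "level_set w e = {t \<in> {0..1}. e\<^sup>2 \<le> rep_L0 w t \<and> rep_L0 w t \<le> 2 * e\<^sup>2}"

lemma sets_level_set: "level_set w e \<in> sets unit_leb"
proof -
  have "{t \<in> space unit_leb. e\<^sup>2 \<le> rep_L0 w t \<and> rep_L0 w t \<le> 2 * e\<^sup>2} \<in> sets unit_leb" by measurable
  then show ?thesis by (simp add: level_set_def)
qed

text \<open>By \<open>e_ends\<close> the levels tend to 0 or infinity so fast that series with
  coefficients \<open>1 / e j\<close> converge in the sum of the couple and the batch seminorms are
  uniformly controlled on the intersection. In \<open>e_sep\<close> the exponent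
  \<open>i + j + 2\<close> leaves a factor \<open>(1/4) ^ i\<close> after summation over
  \<open>j\<close>, so the errors stay summable over \<open>i\<close>.\<close>

locale separated_levels = parameter_fn +
  fixes w :: L0 and e :: "nat \<Rightarrow> real"
  assumes w: "weight w" and e_pos: "0 < e j"
    and e_ends: "min (e j) (1 / e j) \<le> (1/4) ^ (j + 2)"
    and e_sep: "i \<noteq> j \<Longrightarrow> min (e i / e j) (e j / e i) \<le> (1/4) ^ (i + j + 2)"
begin

definition A :: "nat \<Rightarrow> real set"
  where "A j = level_set w (e j)"

definition Hi :: "real \<Rightarrow> real set" where "Hi c = {t \<in> {0..1}. c \<le> rep_L0 w t}"

definition Lo :: "real \<Rightarrow> real set" where "Lo c = {t \<in> {0..1}. rep_L0 w t < c}"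

text \<open>Almost everywhere the minimum of 1 and \<open>w\<close>; \<open>N (v * z)\<close> is a
  norm equivalent to that of the sum of the couple.\<close>

definition v :: L0 where "v = ind (Hi 1) + ind (Lo 1) * w"

lemma sets_A [simp]: "A j \<in> sets unit_leb"
  by (simp add: A_def sets_level_set)

lemma sets_Hi [simp]: "Hi c \<in> sets unit_leb"
proof -
  have "{t \<in> space unit_leb. c \<le> rep_L0 w t} \<in> sets unit_leb" by measurable
  then show ?thesis by (simp add: Hi_def)
qed

lemma sets_Lo [simp]: "Lo c \<in> sets unit_leb"
proof -
  have "{t \<in> space unit_leb. rep_L0 w t < c} \<in> sets unit_leb" by measurable
  then show ?thesis by (simp add: Lo_def)
qed

lemma AE_w: "AE t in unit_leb. 0 < rep_L0 w t"
  using w by (simp add: weight_iff)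

lemma Hi_Lo: "ind (Hi c) * z + ind (Lo c) * z = z"
proof (rule L0_eqI)
  show "AE t in unit_leb. rep_L0 (ind (Hi c) * z + ind (Lo c) * z) t = rep_L0 z t"
    using AE_unit rep_L0_plus[of "ind (Hi c) * z" "ind (Lo c) * z"] rep_L0_ind_times[OF sets_Hi[of c], of z]
      rep_L0_ind_times[OF sets_Lo[of c], of z]
    by eventually_elim (auto simp: Hi_def Lo_def indicator_def)
qed

text \<open>The hypothesis on the squares forces \<open>e j / e i > 1/16\<close>, so the minimum in
  \<open>e_sep\<close> can only be \<open>e i / e j\<close>.\<close>

lemma e_less_if_ratio:
  assumes "i \<noteq> j" "(e i)\<^sup>2 \<le> 2 * (e j)\<^sup>2"
  shows "e i / e j \<le> (1/4) ^ (i + j + 2)" "e i < e j"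
proof -
  have small: "(1/4::real) ^ (i + j + 2) \<le> 1/16"
    using power_decreasing[of 2 "i + j + 2" "1/4::real"] by (simp add: power2_eq_square)
  have "\<not> e j / e i \<le> 1/16"
  proof
    assume "e j / e i \<le> 1/16"
    then have "16 * e j \<le> e i" using e_pos[of i] by (simp add: field_simps)
    then have "(16 * e j)\<^sup>2 \<le> (e i)\<^sup>2" using e_pos[of j] by (intro power_mono) auto
    then have "256 * (e j)\<^sup>2 \<le> 2 * (e j)\<^sup>2" using assms(2) by (simp add: power2_eq_square)
    then show False using e_pos[of j] by simp
  qed
  then show 1: "e i / e j \<le> (1/4) ^ (i + j + 2)"
    using e_sep[OF assms(1)] small by (auto simp: min_def split: if_splits)
  then have "e i / e j < 1" using small by linarith
  then show "e i < e j" using e_pos[of j] by simp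
qed

lemma A_disjoint: "i \<noteq> j \<Longrightarrow> A i \<inter> A j = {}"
proof (rule ccontr)
  assume ij: "i \<noteq> j" "A i \<inter> A j \<noteq> {}"
  then obtain t where "(e i)\<^sup>2 \<le> rep_L0 w t" "rep_L0 w t \<le> 2 * (e j)\<^sup>2" "(e j)\<^sup>2 \<le> rep_L0 w t" "rep_L0 w t \<le> 2 * (e i)\<^sup>2"
    by (auto simp: A_def level_set_def)
  then have "e i < e j" "e j < e i" using e_less_if_ratio(2)[of i j] e_less_if_ratio(2)[of j i] ij by auto
  then show False by simp
qed

lemma N_A_weighted: "N (ind (A j) * z * w) \<le> ennreal (2 * (e j)\<^sup>2) * N (ind (A j) * z)"
proof (rule N_le_scale)
  show "AE t in unit_leb. \<bar>rep_L0 (ind (A j) * z * w) t\<bar> \<le> 2 * (e j)\<^sup>2 * \<bar>rep_L0 (ind (A j) * z) t\<bar>"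
    using rep_L0_times[of "ind (A j) * z" w] rep_L0_ind_times[OF sets_A[of j], of z] AE_w
  proof eventually_elim
    case (elim t)
    show ?case
    proof (cases "t \<in> A j")
      case True
      then have "\<bar>rep_L0 z t\<bar> * rep_L0 w t \<le> \<bar>rep_L0 z t\<bar> * (2 * (e j)\<^sup>2)" by (intro mult_left_mono) (auto simp: A_def level_set_def)
      then show ?thesis using elim True by (simp add: abs_mult mult_ac)
    qed (use elim in simp)
  qed
qed simp

lemma N_A_le_weighted: "N (ind (A j) * z) \<le> ennreal (1 / (e j)\<^sup>2) * N (z * w)"
proof (rule N_le_scale)
  show "AE t in unit_leb. \<bar>rep_L0 (ind (A j) * z) t\<bar> \<le> 1 / (e j)\<^sup>2 * \<bar>rep_L0 (z * w) t\<bar>"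
    using rep_L0_times[of z w] rep_L0_ind_times[OF sets_A[of j], of z] AE_w
  proof eventually_elim
    case (elim t)
    show ?case
    proof (cases "t \<in> A j")
      case True
      then have "\<bar>rep_L0 z t\<bar> * (e j)\<^sup>2 \<le> \<bar>rep_L0 z t\<bar> * rep_L0 w t" by (intro mult_left_mono) (auto simp: A_def level_set_def)
      then show ?thesis using elim True e_pos[of j] by (simp add: abs_mult field_simps)
    qed (use elim in simp)
  qed
qed simp

lemma AE_v: "AE t in unit_leb. rep_L0 v t = min 1 (rep_L0 w t)"
  using AE_unit rep_L0_plus[of "ind (Hi 1)" "ind (Lo 1) * w"] rep_L0_ind[OF sets_Hi[of 1]]
    rep_L0_ind_times[OF sets_Lo[of 1], of w]
  unfolding v_def[symmetric] by eventually_elim (auto simp: Hi_def Lo_def min_def indicator_def)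

lemma weight_v: "weight v"
  unfolding weight_iff using AE_v AE_w by eventually_elim simp

lemma N_v_le: "N (v * z) \<le> N z"
proof (rule N_solid)
  show "AE t in unit_leb. \<bar>rep_L0 (v * z) t\<bar> \<le> \<bar>rep_L0 z t\<bar>"
    using AE_v AE_w rep_L0_times[of v z]
    by eventually_elim (auto simp: abs_mult intro!: mult_left_le_one_le)
qed

lemma N_v_le_weighted: "N (v * z) \<le> N (z * w)"
proof (rule N_solid)
  show "AE t in unit_leb. \<bar>rep_L0 (v * z) t\<bar> \<le> \<bar>rep_L0 (z * w) t\<bar>"
    using AE_v AE_w rep_L0_times[of v z] rep_L0_times[of z w]
    by eventually_elim (auto simp: abs_mult mult.commute[of "\<bar>rep_L0 z _\<bar>"] intro!: mult_right_mono)
qed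

lemma N_Hi_le: "N (ind (Hi 1) * z) \<le> N (v * z)"
proof (rule N_solid)
  show "AE t in unit_leb. \<bar>rep_L0 (ind (Hi 1) * z) t\<bar> \<le> \<bar>rep_L0 (v * z) t\<bar>"
    using AE_v AE_w rep_L0_times[of v z] rep_L0_ind_times[OF sets_Hi[of 1], of z]
    by eventually_elim (auto simp: abs_mult Hi_def indicator_def)
qed

lemma N_Lo_le: "N (ind (Lo 1) * z * w) \<le> N (v * z)"
proof (rule N_solid)
  show "AE t in unit_leb. \<bar>rep_L0 (ind (Lo 1) * z * w) t\<bar> \<le> \<bar>rep_L0 (v * z) t\<bar>"
    using AE_v AE_w rep_L0_times[of v z] rep_L0_times[of "ind (Lo 1) * z" w] rep_L0_ind_times[OF sets_Lo[of 1], of z]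
    by eventually_elim (auto simp: abs_mult Lo_def indicator_def)
qed

lemma N_A_le_v: "N (ind (A j) * z) \<le> ennreal (1 / min 1 ((e j)\<^sup>2)) * N (v * z)"
proof (rule N_le_scale)
  have p: "0 < min 1 ((e j)\<^sup>2)" using e_pos[of j] by simp
  then show "0 \<le> 1 / min 1 ((e j)\<^sup>2)" by simp
  show "AE t in unit_leb. \<bar>rep_L0 (ind (A j) * z) t\<bar> \<le> 1 / min 1 ((e j)\<^sup>2) * \<bar>rep_L0 (v * z) t\<bar>"
    using rep_L0_times[of v z] rep_L0_ind_times[OF sets_A[of j], of z] AE_v AE_w
  proof eventually_elim
    case (elim t)
    show ?case
    proof (cases "t \<in> A j")
      case True
      then have "\<bar>rep_L0 z t\<bar> * min 1 ((e j)\<^sup>2) \<le> \<bar>rep_L0 z t\<bar> * min 1 (rep_L0 w t)" by (intro mult_left_mono) (auto simp: A_def level_set_def)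
      moreover have "\<bar>rep_L0 (v * z) t\<bar> = \<bar>rep_L0 z t\<bar> * min 1 (rep_L0 w t)" using elim by (simp add: abs_mult)
      ultimately show ?thesis using elim True p by (simp add: pos_le_divide_eq)
    qed (use elim p in simp)
  qed
qed

abbreviation X where "X \<equiv> marcinkiewicz \<phi>"
abbreviation Y where "Y \<equiv> weighted (marcinkiewicz \<phi>) w"

lemma pts_sum: "z \<in> pts (couple_sum X Y) \<longleftrightarrow> N (v * z) < \<infinity>"
proof
  assume "z \<in> pts (couple_sum X Y)"
  then obtain z0 z1 where z: "z = z0 + z1" "N z0 < \<infinity>" "N (z1 * w) < \<infinity>"
    by (auto simp: couple_sum_def pts_marcinkiewicz pts_weighted)
  have "N (v * z) \<le> N (v * z0) + N (v * z1)" unfolding z distrib_left by (rule N_triangle)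
  also have "\<dots> \<le> N z0 + N (z1 * w)" by (intro add_mono N_v_le N_v_le_weighted)
  also have "\<dots> < \<infinity>" using z by simp
  finally show "N (v * z) < \<infinity>" .
next
  assume "N (v * z) < \<infinity>"
  then have "ind (Hi 1) * z \<in> pts X \<and> ind (Lo 1) * z \<in> pts Y \<and> z = ind (Hi 1) * z + ind (Lo 1) * z"
    using N_Hi_le[of z] N_Lo_le[of z] by (auto simp: pts_marcinkiewicz pts_weighted Hi_Lo intro: le_less_trans)
  then show "z \<in> pts (couple_sum X Y)" unfolding couple_sum_def nspace.simps mem_Collect_eq by blast
qed

lemma nrm_sum_le:
  assumes "N (v * z) < \<infinity>"
  shows "nrm (couple_sum X Y) z \<le> 2 * enn2real (N (v * z))"
proof -
  have "K_functional 1 (ind (Hi 1) * z + ind (Lo 1) * z) X Y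
    \<le> enn2real (N (ind (Hi 1) * z)) + 1 * enn2real (N (ind (Lo 1) * z * w))"
    by (rule K_functional_upper) (use assms N_Hi_le[of z] N_Lo_le[of z] in \<open>auto intro: le_less_trans\<close>)
  also have "\<dots> \<le> enn2real (N (v * z)) + 1 * enn2real (N (v * z))"
    using assms N_Hi_le[of z] N_Lo_le[of z] by (intro add_mono mult_left_mono enn2real_mono) auto
  finally show ?thesis by (simp add: Hi_Lo couple_sum_def)
qed

lemma linear_operator_sumD:
  assumes "linear_operator_on T (couple_sum X Y)"
  shows "N (v * x) < \<infinity> \<Longrightarrow> N (v * T x) < \<infinity>"
    and "N (v * x) < \<infinity> \<Longrightarrow> N (v * y) < \<infinity> \<Longrightarrow> T (x + y) = T x + T y"
    and "N (v * x) < \<infinity> \<Longrightarrow> T (c *\<^sub>R x) = c *\<^sub>R T x"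
  using assms unfolding linear_operator_on_def pts_sum[symmetric] by blast+

text \<open>Cutting at \<open>w = 1\<close> puts each part into one of the two spaces with norm at
  most \<open>N (v * z)\<close>; the two parts give the factor 2.\<close>

lemma N_v_operator:
  assumes T: "linear_operator_on T (couple_sum X Y)" and C: "0 \<le> C"
    and b0: "\<And>z. N z < \<infinity> \<Longrightarrow> N (T z) \<le> ennreal C * N z"
    and b1: "\<And>z. N (z * w) < \<infinity> \<Longrightarrow> N (T z * w) \<le> ennreal C * N (z * w)"
    and z: "N (v * z) < \<infinity>"
  shows "N (v * T z) \<le> ennreal (2 * C) * N (v * z)"
proof -
  let ?a = "ind (Hi 1) * z" and ?b = "ind (Lo 1) * z"
  have a: "N ?a < \<infinity>" using N_Hi_le z by (rule le_less_trans)
  have b: "N (?b * w) < \<infinity>" using N_Lo_le z by (rule le_less_trans)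
  have "T z = T ?a + T ?b"
    using linear_operator_sumD(2)[OF T le_less_trans[OF N_v_le a] le_less_trans[OF N_v_le_weighted b]] by (simp add: Hi_Lo)
  then have "N (v * T z) \<le> N (v * T ?a) + N (v * T ?b)" by (simp add: distrib_left N_triangle)
  also have "\<dots> \<le> ennreal C * N ?a + ennreal C * N (?b * w)"
    by (intro add_mono order_trans[OF N_v_le b0[OF a]] order_trans[OF N_v_le_weighted b1[OF b]])
  also have "\<dots> \<le> ennreal C * N (v * z) + ennreal C * N (v * z)"
    by (intro add_mono mult_left_mono N_Hi_le N_Lo_le) auto
  also have "\<dots> = ennreal (2 * C) * N (v * z)"
    using C by (simp add: distrib_right[symmetric] ennreal_plus[symmetric] del: ennreal_plus)
  finally show ?thesis .
qed

end

section \<open>Batch seminorms and the co-orbit norm\<close>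

locale coorbit_space = separated_levels +
  fixes F :: "nat \<Rightarrow> nat set"
  assumes finite_F: "finite (F m)"
begin

text \<open>The factor \<open>e i\<close> undoes the coefficient \<open>1 / e i\<close> in
  \<open>lsum\<close>, so that on such an element \<open>q m\<close> is the norm of the plain batch
  sum.\<close>

definition q :: "nat \<Rightarrow> L0 \<Rightarrow> ennreal"
  where "q m z = N (\<Sum>i\<in>F m. e i *\<^sub>R (ind (A i) * z))"

lemma q_triangle: "q m (x + y) \<le> q m x + q m y"
proof -
  have "(\<Sum>i\<in>F m. e i *\<^sub>R (ind (A i) * (x + y)))
    = (\<Sum>i\<in>F m. e i *\<^sub>R (ind (A i) * x)) + (\<Sum>i\<in>F m. e i *\<^sub>R (ind (A i) * y))"
    by (simp add: distrib_left scaleR_add_right sum.distrib)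
  then show ?thesis by (simp add: q_def N_triangle)
qed

lemma q_scaleR: "q m (c *\<^sub>R x) = ennreal \<bar>c\<bar> * q m x"
proof -
  have "(\<Sum>i\<in>F m. e i *\<^sub>R (ind (A i) * (c *\<^sub>R x))) = c *\<^sub>R (\<Sum>i\<in>F m. e i *\<^sub>R (ind (A i) * x))"
    by (simp add: scaleR_sum_right mult.commute)
  then show ?thesis by (simp add: q_def N_scaleR)
qed

lemma q_le_sum: "q m z \<le> (\<Sum>i\<in>F m. ennreal (e i) * N (ind (A i) * z))"
proof -
  have "q m z \<le> (\<Sum>i\<in>F m. N (e i *\<^sub>R (ind (A i) * z)))"
    unfolding q_def by (rule N_sum_le[OF finite_F])
  then show ?thesis using e_pos by (simp add: N_scaleR less_imp_le)
qed

lemma q_continuous: "q m z \<le> ennreal (\<Sum>i\<in>F m. e i / min 1 ((e i)\<^sup>2)) * N (v * z)"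
proof -
  have p: "0 < min 1 ((e i)\<^sup>2)" for i using e_pos[of i] by simp
  have "q m z \<le> (\<Sum>i\<in>F m. ennreal (e i) * (ennreal (1 / min 1 ((e i)\<^sup>2)) * N (v * z)))"
    by (rule order_trans[OF q_le_sum]) (intro sum_mono mult_left_mono N_A_le_v, simp)
  also have "\<dots> = (\<Sum>i\<in>F m. ennreal (e i / min 1 ((e i)\<^sup>2)) * N (v * z))"
    using e_pos p by (intro sum.cong refl) (simp add: mult.assoc[symmetric] ennreal_mult[symmetric] less_imp_le)
  also have "\<dots> = ennreal (\<Sum>i\<in>F m. e i / min 1 ((e i)\<^sup>2)) * N (v * z)"
    using e_pos p by (simp add: sum_distrib_right[symmetric] sum_ennreal less_imp_le)
  finally show ?thesis .
qed

text \<open>If \<open>e i\<close> is small, the unweighted norm suffices; if it is large, the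
  weighted norm contributes \<open>1 / (e i)\<^sup>2\<close> and leaves \<open>1 / e i\<close>. By
  \<open>e_ends\<close> either factor is below a term of a geometric series, so the bound is uniform
  over batches of any size.\<close>

lemma q_le_intersection: "q m z \<le> N z + N (z * w)"
proof -
  have "q m z \<le> (\<Sum>i\<in>F m. ennreal ((1/4) ^ Suc i) * (N z + N (z * w)))"
  proof (rule order_trans[OF q_le_sum], rule sum_mono)
    fix i
    have le: "ennreal (min (e i) (1 / e i)) \<le> ennreal ((1/4) ^ Suc i)"
    proof (rule ennreal_leI)
      have "(1/4::real) ^ (i + 2) \<le> (1/4) ^ Suc i" by (rule power_decreasing) auto
      then show "min (e i) (1 / e i) \<le> (1/4) ^ Suc i" using e_ends[of i] by linarith
    qed
    show "ennreal (e i) * N (ind (A i) * z) \<le> ennreal ((1/4) ^ Suc i) * (N z + N (z * w))"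
    proof (cases "e i \<le> 1 / e i")
      case True
      then have "ennreal (e i) \<le> ennreal ((1/4) ^ Suc i)" using le by (simp add: min_def)
      moreover have "N (ind (A i) * z) \<le> N z + N (z * w)" using N_ind_le[OF sets_A[of i], of z] by (simp add: add_increasing2)
      ultimately show ?thesis by (intro mult_mono) auto
    next
      case False
      then have l: "ennreal (1 / e i) \<le> ennreal ((1/4) ^ Suc i)" using le by (simp add: min_def)
      have "ennreal (e i) * N (ind (A i) * z) \<le> ennreal (e i) * (ennreal (1 / (e i)\<^sup>2) * N (z * w))"
        by (intro mult_left_mono N_A_le_weighted) auto
      also have "\<dots> = ennreal (1 / e i) * N (z * w)"
        using e_pos[of i] by (simp add: mult.assoc[symmetric] ennreal_mult[symmetric] power2_eq_square)
      also have "\<dots> \<le> ennreal ((1/4) ^ Suc i) * (N z + N (z * w))"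
        by (intro mult_mono l) (auto simp: add_increasing)
      finally show ?thesis .
    qed
  qed
  also have "\<dots> = ennreal (\<Sum>i\<in>F m. (1/4) ^ Suc i) * (N z + N (z * w))"
    by (simp add: sum_distrib_right[symmetric] sum_ennreal)
  finally have 1: "q m z \<le> ennreal (\<Sum>i\<in>F m. (1/4) ^ Suc i) * (N z + N (z * w))" .
  have "(\<Sum>i\<in>F m. (1/4::real) ^ Suc i) = 1/4 * (\<Sum>i\<in>F m. (1/4) ^ i)" by (simp add: sum_distrib_left)
  also have "\<dots> \<le> 1" using sum_geometric_le[OF finite_F[of m]] by linarith
  finally have "ennreal (\<Sum>i\<in>F m. (1/4) ^ Suc i) * (N z + N (z * w)) \<le> 1 * (N z + N (z * w))"
    by (intro mult_right_mono) auto
  then show ?thesis using 1 by simp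
qed

definition Adm :: "(L0 \<Rightarrow> L0) set"
  where "Adm = {T. linear_operator_on T (couple_sum X Y) \<and> (\<forall>z. N z < \<infinity> \<longrightarrow> N (T z) \<le> N z) \<and>
    (\<forall>z. N (z * w) < \<infinity> \<longrightarrow> N (T z * w) \<le> N (z * w))}"

lemma AdmD:
  assumes "T \<in> Adm"
  shows "linear_operator_on T (couple_sum X Y)"
    and "N z < \<infinity> \<Longrightarrow> N (T z) \<le> N z" and "N (z * w) < \<infinity> \<Longrightarrow> N (T z * w) \<le> N (z * w)"
    and "N (v * z) < \<infinity> \<Longrightarrow> N (v * T z) \<le> 2 * N (v * z)"
proof -
  show 1: "linear_operator_on T (couple_sum X Y)"
    and 2: "\<And>z. N z < \<infinity> \<Longrightarrow> N (T z) \<le> N z" and 3: "\<And>z. N (z * w) < \<infinity> \<Longrightarrow> N (T z * w) \<le> N (z * w)"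
    using assms by (auto simp: Adm_def)
  show "N (v * T z) \<le> 2 * N (v * z)" if "N (v * z) < \<infinity>"
    using N_v_operator[OF 1, of 1 z] 2 3 that by simp
qed

lemma id_Adm: "(\<lambda>z. z) \<in> Adm"
  by (auto simp: Adm_def linear_operator_on_def)

lemma Adm_zero: "T \<in> Adm \<Longrightarrow> T 0 = 0"
  using linear_operator_sumD(3)[OF AdmD(1), of T 0 0] by simp

text \<open>The supremum over \<open>Adm\<close> absorbs composition with any operator of the couple
  up to its norm, which gives the interpolation property. The term \<open>N (v * z)\<close> embeds
  the space into the sum of the couple.\<close>

definition NE :: "L0 \<Rightarrow> ennreal"
  where "NE z = (SUP (T, m)\<in>Adm \<times> UNIV. N (v * z) + q m (T z))"

definition E :: "L0 nspace"
  where "E = \<lparr>pts = {z. NE z < \<infinity>}, nrm = (\<lambda>z. enn2real (NE z))\<rparr>"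

lemma NE_upper: "T \<in> Adm \<Longrightarrow> N (v * z) + q m (T z) \<le> NE z"
  unfolding NE_def by (rule SUP_upper2[of "(T, m)"]) auto

lemma NE_least: "(\<And>T m. T \<in> Adm \<Longrightarrow> N (v * z) + q m (T z) \<le> c) \<Longrightarrow> NE z \<le> c"
  unfolding NE_def by (rule SUP_least) auto

lemma N_v_le_NE: "N (v * z) \<le> NE z"
  using NE_upper[OF id_Adm, of z 0] by (meson le_iff_add order_trans)

lemma q_le_NE: "T \<in> Adm \<Longrightarrow> q m (T z) \<le> NE z"
  by (rule order_trans[OF _ NE_upper[of T z m]]) (auto simp: add_increasing)

lemma NE_finite: "NE z < \<infinity> \<Longrightarrow> N (v * z) < \<infinity>"
  using N_v_le_NE by (rule le_less_trans)

lemma NE_triangle: "NE (x + y) \<le> NE x + NE y"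
proof (cases "NE x < \<infinity> \<and> NE y < \<infinity>")
  case True
  then have x: "N (v * x) < \<infinity>" and y: "N (v * y) < \<infinity>" using NE_finite by auto
  show ?thesis
  proof (rule NE_least)
    fix T m assume T: "T \<in> Adm"
    have "N (v * (x + y)) + q m (T (x + y)) \<le> (N (v * x) + N (v * y)) + (q m (T x) + q m (T y))"
      unfolding linear_operator_sumD(2)[OF AdmD(1)[OF T] x y] distrib_left
      by (intro add_mono N_triangle q_triangle)
    also have "\<dots> = (N (v * x) + q m (T x)) + (N (v * y) + q m (T y))" by (simp add: ac_simps)
    also have "\<dots> \<le> NE x + NE y" by (intro add_mono NE_upper T)
    finally show "N (v * (x + y)) + q m (T (x + y)) \<le> NE x + NE y" .
  qed
next
  case False
  then show ?thesis by (auto simp: less_top[symmetric])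
qed

lemma NE_zero [simp]: "NE 0 = 0"
proof -
  have "NE 0 \<le> 0" by (rule NE_least) (simp add: Adm_zero q_def)
  then show ?thesis by simp
qed

lemma NE_scaleR: "NE (c *\<^sub>R x) = ennreal \<bar>c\<bar> * NE x"
proof -
  have le: "NE (c *\<^sub>R x) \<le> ennreal \<bar>c\<bar> * NE x" if "c \<noteq> 0" for c x
  proof (cases "N (v * x) < \<infinity>")
    case True
    show ?thesis
    proof (rule NE_least)
      fix T m assume T: "T \<in> Adm"
      have "N (v * (c *\<^sub>R x)) + q m (T (c *\<^sub>R x)) = ennreal \<bar>c\<bar> * (N (v * x) + q m (T x))"
        unfolding linear_operator_sumD(3)[OF AdmD(1)[OF T] True]
        by (simp add: N_scaleR q_scaleR distrib_left)
      also have "\<dots> \<le> ennreal \<bar>c\<bar> * NE x" by (intro mult_left_mono NE_upper T) simp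
      finally show "N (v * (c *\<^sub>R x)) + q m (T (c *\<^sub>R x)) \<le> ennreal \<bar>c\<bar> * NE x" .
    qed
  next
    case False
    then have "NE x = \<infinity>" using NE_finite[of x] by (auto simp: less_top[symmetric])
    then show ?thesis using that by (simp add: ennreal_mult_top)
  qed
  show ?thesis
  proof (cases "c = 0")
    case False
    have "ennreal \<bar>c\<bar> * NE x = ennreal \<bar>c\<bar> * NE ((1 / c) *\<^sub>R (c *\<^sub>R x))" using False by simp
    also have "\<dots> \<le> ennreal \<bar>c\<bar> * (ennreal \<bar>1 / c\<bar> * NE (c *\<^sub>R x))" by (intro mult_left_mono le) (use False in auto)
    also have "\<dots> = NE (c *\<^sub>R x)" using False by (simp add: mult.assoc[symmetric] ennreal_mult[symmetric])
    finally show ?thesis using le[OF False, of x] by simp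
  qed simp
qed

lemma NE_minus_commute: "NE (x - y) = NE (y - x)"
  using NE_scaleR[of "-1" "x - y"] by simp

lemma NE_eq_0_iff: "NE x = 0 \<longleftrightarrow> x = 0"
proof
  assume "NE x = 0"
  then have "v * x = 0" using N_v_le_NE[of x] N_eq_0_iff by simp
  then have "AE t in unit_leb. rep_L0 v t * rep_L0 x t = 0"
    using rep_L0_times[of v x] rep_L0_zero by (auto elim: eventually_elim2)
  then have "AE t in unit_leb. rep_L0 x t = rep_L0 0 t"
    using AE_v AE_w rep_L0_zero by eventually_elim (auto simp: min_def split: if_splits)
  then show "x = 0" by (rule L0_eqI)
qed simp

text \<open>For fixed \<open>T\<close> and \<open>m\<close> the expression under the supremum is
  continuous in the norm of the sum, by \<open>q_continuous\<close>, and a supremum of continuous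
  functions is lower semicontinuous.\<close>

lemma NE_lower_semicontinuous:
  assumes u: "\<And>k. N (v * u k) < \<infinity>" and lim: "\<And>k. N (v * (x - u k)) \<le> ennreal (d k)" "d \<longlonglongrightarrow> 0"
    and bd: "\<And>k. k0 \<le> k \<Longrightarrow> NE (u k) \<le> c"
  shows "NE x \<le> c"
proof (rule NE_least)
  fix T m assume T: "T \<in> Adm"
  define CF where "CF = (\<Sum>i\<in>F m. e i / min 1 ((e i)\<^sup>2))"
  have xu: "N (v * (x - u k)) < \<infinity>" for k using lim(1)[of k] by (rule le_less_trans) simp
  have est: "N (v * x) + q m (T x) \<le> c + (ennreal (d k) + ennreal CF * (2 * ennreal (d k)))" if k: "k0 \<le> k" for k
  proof -
    have eq: "x = u k + (x - u k)" by simp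
    have "N (v * x) \<le> N (v * u k) + N (v * (x - u k))"
      using N_triangle[of "v * u k" "v * (x - u k)"] by (simp add: distrib_left[symmetric])
    moreover have "q m (T x) \<le> q m (T (u k)) + q m (T (x - u k))"
    proof -
      have "T x = T (u k) + T (x - u k)"
        using linear_operator_sumD(2)[OF AdmD(1)[OF T] u[of k] xu[of k]] by simp
      then show ?thesis by (simp add: q_triangle)
    qed
    ultimately have "N (v * x) + q m (T x) \<le> (N (v * u k) + N (v * (x - u k))) + (q m (T (u k)) + q m (T (x - u k)))"
      by (rule add_mono)
    also have "\<dots> = (N (v * u k) + q m (T (u k))) + (N (v * (x - u k)) + q m (T (x - u k)))" by (simp add: ac_simps)
    also have "\<dots> \<le> c + (ennreal (d k) + ennreal CF * (2 * ennreal (d k)))"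
    proof (intro add_mono lim)
      show "N (v * u k) + q m (T (u k)) \<le> c" using NE_upper[OF T, of "u k" m] bd[OF k] by (rule order_trans)
      have "q m (T (x - u k)) \<le> ennreal CF * N (v * T (x - u k))" unfolding CF_def by (rule q_continuous)
      also have "\<dots> \<le> ennreal CF * (2 * ennreal (d k))"
        by (intro mult_left_mono order_trans[OF AdmD(4)[OF T xu[of k]]] lim) auto
      finally show "q m (T (x - u k)) \<le> ennreal CF * (2 * ennreal (d k))" .
    qed
    finally show ?thesis .
  qed
  have "(\<lambda>k. c + (ennreal (d k) + ennreal CF * (2 * ennreal (d k)))) \<longlonglongrightarrow> c + (ennreal 0 + ennreal CF * (2 * ennreal 0))"
    using lim(2) by (intro tendsto_add tendsto_const ennreal_tendsto_cmult tendsto_ennrealI) auto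
  then show "N (v * x) + q m (T x) \<le> c"
    by (intro LIMSEQ_le_const[of _ c]) (use est in auto)
qed

lemma pts_E: "z \<in> pts E \<longleftrightarrow> NE z < \<infinity>" and nrm_E: "nrm E z = enn2real (NE z)"
  by (simp_all add: E_def)

lemma NE_eq_nrm: "NE z < \<infinity> \<Longrightarrow> NE z = ennreal (nrm E z)"
  by (simp add: nrm_E)

lemma subspace_E: "subspace (pts E)"
proof (rule subspaceI)
  show "x + y \<in> pts E" if "x \<in> pts E" "y \<in> pts E" for x y
    using NE_triangle[of x y] that unfolding pts_E by (auto elim!: le_less_trans)
  show "c *\<^sub>R x \<in> pts E" if "x \<in> pts E" for c x
    using that unfolding pts_E NE_scaleR by (simp add: ennreal_mult_less_top)
qed (simp add: pts_E)

lemma nrm_E_triangle: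
  assumes "x \<in> pts E" "y \<in> pts E"
  shows "nrm E (x + y) \<le> nrm E x + nrm E y"
proof -
  have "enn2real (NE (x + y)) \<le> enn2real (NE x + NE y)"
    using assms unfolding pts_E by (intro enn2real_mono NE_triangle) auto
  then show ?thesis using assms by (simp add: pts_E nrm_E enn2real_plus)
qed

lemma Metric_space_E: "Metric_space (pts E) (\<lambda>x y. nrm E (x - y))"
proof
  fix x y z
  show "0 \<le> nrm E (x - y)" by (simp add: nrm_E)
  show "nrm E (x - y) = nrm E (y - x)" by (simp add: nrm_E NE_minus_commute[of x])
  show "nrm E (x - y) = 0 \<longleftrightarrow> x = y" if "x \<in> pts E" "y \<in> pts E"
  proof -
    have "NE (x - y) < \<infinity>" using subspace_diff[OF subspace_E that] by (simp add: pts_E)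
    then show ?thesis by (simp add: nrm_E enn2real_eq_0_iff NE_eq_0_iff less_top[symmetric])
  qed
  show "nrm E (x - z) \<le> nrm E (x - y) + nrm E (y - z)" if "x \<in> pts E" "y \<in> pts E" "z \<in> pts E"
    using nrm_E_triangle[of "x - y" "y - z"] subspace_diff[OF subspace_E] that by simp
qed

lemma mcomplete_E: "Metric_space.mcomplete (pts E) (\<lambda>x y. nrm E (x - y))"
proof -
  interpret ME: Metric_space "pts E" "\<lambda>x y. nrm E (x - y)" by (rule Metric_space_E)
  show ?thesis
    unfolding ME.mcomplete_def
  proof (intro allI impI)
    fix \<sigma> :: "nat \<Rightarrow> L0" assume "ME.MCauchy \<sigma>"
    then have s: "\<And>n. NE (\<sigma> n) < \<infinity>"
      and c: "\<And>\<epsilon>. 0 < \<epsilon> \<Longrightarrow> \<exists>M. \<forall>n n'. M \<le> n \<longrightarrow> M \<le> n' \<longrightarrow> nrm E (\<sigma> n - \<sigma> n') < \<epsilon>"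
      unfolding ME.MCauchy_def pts_E[symmetric] by auto
    have sd: "NE (\<sigma> n - \<sigma> n') < \<infinity>" for n n'
      using subspace_diff[OF subspace_E] s by (simp add: pts_E)
    have "\<forall>k. \<exists>M. \<forall>n n'. M \<le> n \<longrightarrow> M \<le> n' \<longrightarrow> nrm E (\<sigma> n - \<sigma> n') < (1/2) ^ k"
      using c by simp
    then obtain f where f: "\<And>k n n'. f k \<le> n \<Longrightarrow> f k \<le> n' \<Longrightarrow> nrm E (\<sigma> n - \<sigma> n') < (1/2) ^ k"
      by metis
    \<comment> \<open>Indices beyond the Cauchy thresholds, increasing and at least
      \<open>k\<close>, so that late members of the subsequence are also late members of the
      sequence.\<close>
    define r where "r k = (\<Sum>i\<le>k. f i) + k" for k
    have r: "f k \<le> r k" "k \<le> r k" "r k \<le> r (Suc k)" for k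
      using member_le_sum[of k "{..k}" f] by (auto simp: r_def)
    define y where "y k = \<sigma> (r (Suc k)) - \<sigma> (r k)" for k
    have Ny: "N (v * y k) \<le> ennreal ((1/2) ^ k)" for k
    proof -
      have "N (v * y k) \<le> NE (y k)" by (rule N_v_le_NE)
      also have "\<dots> = ennreal (nrm E (y k))" unfolding y_def by (rule NE_eq_nrm[OF sd])
      also have "\<dots> \<le> ennreal ((1/2) ^ k)"
        unfolding y_def
        by (intro ennreal_leI less_imp_le, rule f) (use r(1)[of k] r(3)[of k] in auto)
      finally show ?thesis .
    qed
    have geo: "(\<Sum>j. ennreal ((1/2) ^ (j + m))) = ennreal (2 * (1/2) ^ m)" for m
    proof -
      have "(\<Sum>j. ennreal ((1/2) ^ (j + m))) = ennreal (\<Sum>j. (1/2) ^ m * (1/2) ^ j)"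
        by (subst suminf_ennreal2[symmetric]) (auto simp: power_add mult.commute intro!: summable_mult2 summable_geometric)
      also have "(\<Sum>j. (1/2::real) ^ m * (1/2) ^ j) = 2 * (1/2) ^ m"
        by (subst suminf_mult) (auto simp: suminf_geometric summable_geometric)
      finally show ?thesis .
    qed
    have "(\<Sum>n. N (v * y n)) \<le> (\<Sum>n. ennreal ((1/2) ^ (n + 0)))" using Ny by (intro suminf_le) auto
    also have "\<dots> < \<infinity>" unfolding geo by simp
    finally have summ: "AE t in unit_leb. summable (\<lambda>n. \<bar>rep_L0 (y n) t\<bar>)"
      by (rule AE_summable_L0[OF weight_v])
    \<comment> \<open>The limit is built pointwise and approached in the norm of the sum; lower
      semicontinuity then upgrades the Cauchy property to convergence in \<open>NE\<close>.\<close>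
    define z where "z = \<sigma> (r 0) + L0_sum y"
    have zr: "N (v * (z - \<sigma> (r m))) \<le> ennreal (2 * (1/2) ^ m)" for m
    proof -
      have "(\<Sum>k<m. y k) = \<sigma> (r m) - \<sigma> (r 0)"
        unfolding y_def by (rule sum_lessThan_telescope)
      then have "z - \<sigma> (r m) = L0_sum y - (\<Sum>k<m. y k)" by (simp add: z_def)
      then have "N (v * (z - \<sigma> (r m))) \<le> (\<Sum>j. N (v * y (j + m)))" using N_L0_sum_le[OF summ, of v m] by simp
      also have "\<dots> \<le> (\<Sum>j. ennreal ((1/2) ^ (j + m)))" using Ny by (intro suminf_le) auto
      finally show ?thesis unfolding geo .
    qed
    have close: "NE (\<sigma> n - z) \<le> ennreal \<epsilon>" if n: "\<And>n'. M \<le> n' \<Longrightarrow> nrm E (\<sigma> n - \<sigma> n') \<le> \<epsilon>" for n M \<epsilon>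
    proof (rule NE_lower_semicontinuous[where u = "\<lambda>k. \<sigma> n - \<sigma> (r k)" and d = "\<lambda>k. 2 * (1/2) ^ k" and ?k0.0 = M])
      show "N (v * (\<sigma> n - \<sigma> (r k))) < \<infinity>" for k by (rule NE_finite[OF sd])
      show "N (v * (\<sigma> n - z - (\<sigma> n - \<sigma> (r k)))) \<le> ennreal (2 * (1/2) ^ k)" for k
        using zr[of k] N_minus_commute[of "v * z" "v * \<sigma> (r k)"] by (simp add: right_diff_distrib)
      show "(\<lambda>k. 2 * (1/2::real) ^ k) \<longlonglongrightarrow> 0"
        using tendsto_mult[OF tendsto_const LIMSEQ_power_zero[of "1/2::real"], of 2] by simp
      show "NE (\<sigma> n - \<sigma> (r k)) \<le> ennreal \<epsilon>" if "M \<le> k" for k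
        unfolding NE_eq_nrm[OF sd] using n[of "r k"] that r(2)[of k] by (intro ennreal_leI) auto
    qed
    have z: "NE z < \<infinity>"
    proof -
      have "NE (\<sigma> (f 0) - z) \<le> ennreal ((1/2) ^ 0)" by (rule close[of "f 0"]) (use f[of 0 "f 0"] in \<open>auto intro: less_imp_le\<close>)
      then have "NE (z - \<sigma> (f 0)) < \<infinity>" unfolding NE_minus_commute[of z] by (rule le_less_trans) simp
      then show ?thesis using NE_triangle[of "z - \<sigma> (f 0)" "\<sigma> (f 0)"] s[of "f 0"] by (auto elim!: le_less_trans)
    qed
    have "limitin ME.mtopology \<sigma> z sequentially"
      unfolding ME.limitin_metric
    proof (intro conjI allI impI)
      show "z \<in> pts E" using z by (simp add: pts_E)
      fix \<epsilon> :: real assume eps: "0 < \<epsilon>"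
      obtain M where M: "\<And>n n'. M \<le> n \<Longrightarrow> M \<le> n' \<Longrightarrow> nrm E (\<sigma> n - \<sigma> n') < \<epsilon> / 2" using c[of "\<epsilon>/2"] eps by auto
      show "\<forall>\<^sub>F n in sequentially. \<sigma> n \<in> pts E \<and> nrm E (\<sigma> n - z) < \<epsilon>"
        unfolding eventually_sequentially
      proof (intro exI[of _ M] allI impI conjI)
        fix n assume n: "M \<le> n"
        show "\<sigma> n \<in> pts E" using s by (simp add: pts_E)
        have "NE (\<sigma> n - z) \<le> ennreal (\<epsilon> / 2)" by (rule close[of M]) (use M[OF n] in \<open>auto intro: less_imp_le\<close>)
        then have "nrm E (\<sigma> n - z) \<le> \<epsilon> / 2" unfolding nrm_E using eps by (intro enn2real_leI) auto
        then show "nrm E (\<sigma> n - z) < \<epsilon>" using eps by simp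
      qed
    qed
    then show "\<exists>x. limitin ME.mtopology \<sigma> x sequentially" by blast
  qed
qed

lemma banach_E: "banach_space E"
  unfolding banach_space_def
  using subspace_E mcomplete_E nrm_E_triangle
  by (auto simp: nrm_E pts_E NE_scaleR enn2real_mult enn2real_eq_0_iff NE_eq_0_iff)

lemma interpolation_space_E: "interpolation_space E X Y"
  unfolding interpolation_space_def
proof (intro conjI allI impI)
  show "banach_space E" by (rule banach_E)
  \<comment> \<open>\<open>q_le_intersection\<close> is applied to \<open>T z\<close>, whose two
    norms are no larger than those of \<open>z\<close>.\<close>
  have cap: "NE z \<le> 3 * (N z + N (z * w))" if z: "N z < \<infinity>" "N (z * w) < \<infinity>" for z
  proof (rule NE_least)
    fix T m assume T: "T \<in> Adm"
    have "q m (T z) \<le> N (T z) + N (T z * w)" by (rule q_le_intersection)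
    also have "\<dots> \<le> N z + N (z * w)" by (intro add_mono AdmD[OF T] z)
    finally have "N (v * z) + q m (T z) \<le> (N z + N (z * w)) + (N z + N (z * w))"
      using N_v_le[of z] by (intro add_mono) (auto simp: add_increasing2)
    also have "\<dots> = 2 * (N z + N (z * w))" by (simp add: mult_2)
    also have "\<dots> \<le> 3 * (N z + N (z * w))" by (intro mult_right_mono) auto
    finally show "N (v * z) + q m (T z) \<le> 3 * (N z + N (z * w))" .
  qed
  show "cont_embedded (couple_inter X Y) E"
    unfolding cont_embedded_def
  proof (intro conjI exI ballI subsetI)
    fix z assume "z \<in> pts (couple_inter X Y)"
    then have z: "N z < \<infinity>" "N (z * w) < \<infinity>" by (auto simp: couple_inter_def pts_marcinkiewicz pts_weighted)
    have f: "3 * (N z + N (z * w)) < \<infinity>" using z by (simp add: ennreal_mult_less_top)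
    show "z \<in> pts E" unfolding pts_E by (rule le_less_trans[OF cap[OF z] f])
    have "nrm E z \<le> enn2real (3 * (N z + N (z * w)))" unfolding nrm_E using f by (intro enn2real_mono cap z) auto
    also have "\<dots> = 3 * (enn2real (N z) + enn2real (N (z * w)))" unfolding enn2real_mult using z by (simp add: enn2real_plus)
    also have "\<dots> \<le> 6 * nrm (couple_inter X Y) z"
      by (simp add: couple_inter_def nrm_marcinkiewicz nrm_weighted max_def)
    finally show "nrm E z \<le> 6 * nrm (couple_inter X Y) z" .
  qed
  show "cont_embedded E (couple_sum X Y)"
    unfolding cont_embedded_def
  proof (intro conjI exI ballI subsetI)
    fix z assume "z \<in> pts E"
    then have z: "NE z < \<infinity>" by (simp add: pts_E)
    show "z \<in> pts (couple_sum X Y)" unfolding pts_sum by (rule NE_finite[OF z])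
    have "nrm (couple_sum X Y) z \<le> 2 * enn2real (N (v * z))" by (rule nrm_sum_le[OF NE_finite[OF z]])
    also have "\<dots> \<le> 2 * nrm E z" unfolding nrm_E using z by (intro mult_left_mono enn2real_mono N_v_le_NE) auto
    finally show "nrm (couple_sum X Y) z \<le> 2 * nrm E z" .
  qed
  fix S assume S: "linear_operator_on S (couple_sum X Y) \<and> maps_boundedly S X \<and> maps_boundedly S Y"
  then have lin: "linear_operator_on S (couple_sum X Y)" by simp
  obtain C0 C1 where C0: "\<And>z. N z < \<infinity> \<Longrightarrow> N (S z) < \<infinity> \<and> enn2real (N (S z)) \<le> C0 * enn2real (N z)"
    and C1: "\<And>z. N (z * w) < \<infinity> \<Longrightarrow> N (S z * w) < \<infinity> \<and> enn2real (N (S z * w)) \<le> C1 * enn2real (N (z * w))"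
  proof -
    obtain C0 C1 where "S ` pts X \<subseteq> pts X" "\<forall>z\<in>pts X. nrm X (S z) \<le> C0 * nrm X z"
      "S ` pts Y \<subseteq> pts Y" "\<forall>z\<in>pts Y. nrm Y (S z) \<le> C1 * nrm Y z"
      using S unfolding maps_boundedly_def by blast
    then show ?thesis
      unfolding image_subset_iff pts_marcinkiewicz nrm_marcinkiewicz pts_weighted nrm_weighted Ball_def
      by (intro that[of C0 C1]) blast+
  qed
  define C where "C = max 1 (max C0 C1)"
  have C: "1 \<le> C" "C0 \<le> C" "C1 \<le> C" by (auto simp: C_def)
  have conv: "a \<le> ennreal C * b" if "a < \<infinity>" "b < \<infinity>" "enn2real a \<le> C' * enn2real b" "C' \<le> C" for a b :: ennreal and C'
  proof -
    have "enn2real a \<le> C * enn2real b" using that(3,4) by (meson enn2real_nonneg mult_right_mono order_trans)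
    then have "ennreal (enn2real a) \<le> ennreal (C * enn2real b)" by (rule ennreal_leI)
    then show ?thesis using that(1,2) C by (simp add: ennreal_mult)
  qed
  have b0: "N (S z) \<le> ennreal C * N z" if "N z < \<infinity>" for z using conv[of "N (S z)" "N z" C0] C0[OF that] C that by simp
  have b1: "N (S z * w) \<le> ennreal C * N (z * w)" if "N (z * w) < \<infinity>" for z
    using conv[of "N (S z * w)" "N (z * w)" C1] C1[OF that] C that by simp
  have main: "NE (S z) \<le> ennreal (3 * C) * NE z" if z: "NE z < \<infinity>" for z
  proof (rule NE_least)
    fix T m assume T: "T \<in> Adm"
    have vz: "N (v * z) < \<infinity>" by (rule NE_finite[OF z])
    \<comment> \<open>Composition with \<open>S\<close>, divided by a bound for \<open>S\<close>, is
      again admissible and so already takes part in the supremum that defines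
      \<open>NE z\<close>.\<close>
    define T' where "T' u = (1 / C) *\<^sub>R T (S u)" for u
    have half: "ennreal (1 / C) * (ennreal C * b) = b" for b
      using C by (simp add: mult.assoc[symmetric] ennreal_mult[symmetric])
    have "T' \<in> Adm"
      unfolding Adm_def mem_Collect_eq
    proof (intro conjI allI impI)
      show "linear_operator_on T' (couple_sum X Y)"
        using linear_operator_sumD[OF lin] linear_operator_sumD[OF AdmD(1)[OF T]]
        unfolding linear_operator_on_def
        by (auto simp: pts_sum T'_def N_scaleR ennreal_mult_less_top scaleR_add_right)
      show "N (T' u) \<le> N u" if u: "N u < \<infinity>" for u
      proof -
        have "N (T' u) \<le> ennreal (1 / C) * N (S u)"
          unfolding T'_def N_scaleR using C C0[OF u] by (intro mult_mono AdmD(2)[OF T]) auto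
        also have "\<dots> \<le> ennreal (1 / C) * (ennreal C * N u)" by (intro mult_left_mono b0 u) simp
        finally show ?thesis unfolding half .
      qed
      show "N (T' u * w) \<le> N (u * w)" if u: "N (u * w) < \<infinity>" for u
      proof -
        have "N (T' u * w) = ennreal (1 / C) * N (T (S u) * w)" using C by (simp add: T'_def N_scaleR)
        also have "\<dots> \<le> ennreal (1 / C) * N (S u * w)" using C1[OF u] by (intro mult_left_mono AdmD(3)[OF T]) auto
        also have "\<dots> \<le> ennreal (1 / C) * (ennreal C * N (u * w))" by (intro mult_left_mono b1 u) simp
        finally show ?thesis unfolding half .
      qed
    qed
    then have "q m (T' z) \<le> NE z" by (rule q_le_NE)
    moreover have "T (S z) = C *\<^sub>R T' z" using C by (simp add: T'_def)
    ultimately have "q m (T (S z)) \<le> ennreal C * NE z" using C by (simp add: q_scaleR mult_left_mono)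
    moreover have "N (v * S z) \<le> ennreal (2 * C) * NE z"
      using N_v_operator[OF lin _ b0 b1 vz] C order_trans[OF _ mult_left_mono[OF N_v_le_NE[of z]]] by auto
    ultimately have "N (v * S z) + q m (T (S z)) \<le> ennreal (2 * C) * NE z + ennreal C * NE z" by (intro add_mono)
    also have "\<dots> = ennreal (3 * C) * NE z"
      using C by (simp add: distrib_right[symmetric] ennreal_plus[symmetric] del: ennreal_plus)
    finally show "N (v * S z) + q m (T (S z)) \<le> ennreal (3 * C) * NE z" .
  qed
  show "maps_boundedly S E"
    unfolding maps_boundedly_def
  proof (intro conjI exI ballI subsetI)
    have f: "ennreal (3 * C) * NE z < \<infinity>" if "NE z < \<infinity>" for z using that by (simp add: ennreal_mult_less_top)
    show "u \<in> pts E" if "u \<in> S ` pts E" for u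
    proof -
      obtain x where x: "u = S x" "NE x < \<infinity>" using \<open>u \<in> S ` pts E\<close> by (auto simp: pts_E)
      show ?thesis unfolding pts_E x(1) by (rule le_less_trans[OF main[OF x(2)] f[OF x(2)]])
    qed
    fix z assume "z \<in> pts E"
    then have z: "NE z < \<infinity>" by (simp add: pts_E)
    have "nrm E (S z) \<le> enn2real (ennreal (3 * C) * NE z)" unfolding nrm_E using f[OF z] by (intro enn2real_mono main z) auto
    then show "nrm E (S z) \<le> 3 * C * nrm E z" using C by (simp add: enn2real_mult nrm_E)
  qed
qed

end

section \<open>Sums across levels and their K-functionals\<close>

context separated_levels
begin

definition lsum :: "(nat \<Rightarrow> L0) \<Rightarrow> L0"
  where "lsum u = L0_sum (\<lambda>j. (1 / e j) *\<^sub>R u j)"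

definition K :: "real \<Rightarrow> L0 \<Rightarrow> real"
  where "K t z = K_functional t z X Y"

lemma ind_A_other:
  assumes "ind (A j) * u = u" "i \<noteq> j"
  shows "ind (A i) * u = 0"
proof -
  have "ind (A i) * u = ind (A i) * (ind (A j) * u)" using assms(1) by simp
  also have "\<dots> = 0" using A_disjoint[OF assms(2)] by (simp add: mult.assoc[symmetric] ind_mult_ind ind_empty)
  finally show ?thesis .
qed

lemma ind_disjoint_A:
  assumes "ind (A j) * u = u" "B \<in> sets unit_leb" "B \<inter> A j = {}"
  shows "ind B * u = 0"
proof -
  have "ind B * u = ind B * (ind (A j) * u)" using assms(1) by simp
  also have "\<dots> = 0" using assms(2,3) by (simp add: mult.assoc[symmetric] ind_mult_ind ind_empty)
  finally show ?thesis .
qed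

lemma suminf_geometric_quarter:
  assumes "0 \<le> c"
  shows "(\<Sum>j. ennreal (c * (1/4) ^ j)) = ennreal (4/3 * c)"
proof -
  have "(\<Sum>j. ennreal (c * (1/4) ^ j)) = ennreal (\<Sum>j. c * (1/4) ^ j)"
    using assms by (intro suminf_ennreal2) (auto intro!: summable_mult summable_geometric)
  also have "(\<Sum>j. c * (1/4) ^ j) = 4/3 * c"
    by (subst suminf_mult) (auto simp: suminf_geometric summable_geometric)
  finally show ?thesis .
qed

context
  fixes u :: "nat \<Rightarrow> L0" and b :: real
  assumes supp: "\<And>j. ind (A j) * u j = u j" and bound: "\<And>j. N (u j) \<le> ennreal b" and b: "0 \<le> b"
begin

lemma N_level_weighted: "N (u j * w) \<le> ennreal (2 * (e j)\<^sup>2 * b)"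
proof -
  have "N (u j * w) \<le> ennreal (2 * (e j)\<^sup>2) * N (u j)" using N_A_weighted[of j "u j"] by (simp add: supp)
  also have "\<dots> \<le> ennreal (2 * (e j)\<^sup>2) * ennreal b" by (intro mult_left_mono bound) simp
  also have "\<dots> = ennreal (2 * (e j)\<^sup>2 * b)" using b by (simp add: ennreal_mult)
  finally show ?thesis .
qed

text \<open>With the coefficient \<open>1 / e j\<close>, the weighted norm gives a bound of order
  \<open>e j\<close> and the unweighted norm one of order \<open>1 / e j\<close>; by
  \<open>e_ends\<close> the smaller of the two is at most \<open>(1/4) ^ j\<close>.\<close>

lemma N_v_level: "N (v * ((1 / e j) *\<^sub>R u j)) \<le> ennreal (2 * b * (1/4) ^ j)"
proof -
  have small: "min (e j) (1 / e j) \<le> (1/4) ^ j"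
    by (rule order_trans[OF e_ends[of j]], rule power_decreasing) auto
  have n: "N (v * ((1 / e j) *\<^sub>R u j)) = ennreal (1 / e j) * N (v * u j)"
    using e_pos[of j] by (simp add: N_scaleR)
  show ?thesis
  proof (cases "e j \<le> 1 / e j")
    case True
    have "ennreal (1 / e j) * N (v * u j) \<le> ennreal (1 / e j) * ennreal (2 * (e j)\<^sup>2 * b)"
      by (intro mult_left_mono order_trans[OF N_v_le_weighted N_level_weighted]) auto
    also have "\<dots> = ennreal (2 * b * e j)"
      using e_pos[of j] b by (simp add: ennreal_mult[symmetric] power2_eq_square mult_ac)
    also have "\<dots> \<le> ennreal (2 * b * (1/4) ^ j)"
      using small True b by (intro ennreal_leI mult_left_mono) (auto simp: min_def)
    finally show ?thesis unfolding n .
  next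
    case False
    have "ennreal (1 / e j) * N (v * u j) \<le> ennreal (1 / e j) * ennreal b"
      by (intro mult_left_mono order_trans[OF N_v_le bound]) auto
    also have "\<dots> = ennreal (b * (1 / e j))"
      using e_pos[of j] b by (simp add: ennreal_mult[symmetric])
    also have "\<dots> \<le> ennreal (2 * b * (1/4) ^ j)"
    proof (rule ennreal_leI)
      have "b * (1 / e j) \<le> b * (1/4) ^ j" using small False b by (intro mult_left_mono) (auto simp: min_def)
      also have "\<dots> \<le> 2 * (b * (1/4) ^ j)" using b by simp
      finally show "b * (1 / e j) \<le> 2 * b * (1/4) ^ j" by simp
    qed
    finally show ?thesis unfolding n .
  qed
qed

lemma suminf_N_v_level: "(\<Sum>j. N (v * ((1 / e j) *\<^sub>R u j))) \<le> ennreal (4/3 * (2 * b))"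
proof -
  have "(\<Sum>j. N (v * ((1 / e j) *\<^sub>R u j))) \<le> (\<Sum>j. ennreal (2 * b * (1/4) ^ j))"
    by (intro suminf_le N_v_level) auto
  also have "\<dots> = ennreal (4/3 * (2 * b))" using b by (intro suminf_geometric_quarter) simp
  finally show ?thesis .
qed

lemma lsum_summable: "AE t in unit_leb. summable (\<lambda>j. \<bar>rep_L0 ((1 / e j) *\<^sub>R u j) t\<bar>)"
  using suminf_N_v_level by (intro AE_summable_L0[OF weight_v]) (auto elim!: le_less_trans)

lemma N_mult_lsum_le: "N (m * lsum u) \<le> (\<Sum>j. N (m * ((1 / e j) *\<^sub>R u j)))"
  using N_L0_sum_le[OF lsum_summable, of m 0] by (simp add: lsum_def)

lemma N_v_lsum: "N (v * lsum u) < \<infinity>"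
  by (rule le_less_trans[OF order_trans[OF N_mult_lsum_le suminf_N_v_level]]) simp

text \<open>All terms beyond index \<open>i\<close> vanish on \<open>A i\<close>, which reduces the
  infinite sum to a finite one.\<close>

lemma ind_A_lsum: "ind (A i) * lsum u = (1 / e i) *\<^sub>R u i"
proof -
  let ?s = "\<Sum>j<Suc i. (1 / e j) *\<^sub>R u j"
  have "N (ind (A i) * (lsum u - ?s)) \<le> (\<Sum>j. N (ind (A i) * ((1 / e (j + Suc i)) *\<^sub>R u (j + Suc i))))"
    unfolding lsum_def by (rule N_L0_sum_le[OF lsum_summable])
  also have "\<dots> = 0" by (simp add: ind_A_other[OF supp])
  finally have "ind (A i) * (lsum u - ?s) = 0" by (simp add: N_eq_0_iff)
  then have "ind (A i) * lsum u = ind (A i) * ?s" by (simp add: right_diff_distrib)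
  also have "\<dots> = (\<Sum>j<Suc i. (1 / e j) *\<^sub>R (ind (A i) * u j))"
    by (simp only: sum_distrib_left mult_scaleR_right)
  also have "\<dots> = (\<Sum>j\<in>{i}. (1 / e j) *\<^sub>R (ind (A i) * u j))"
    by (rule sum.mono_neutral_right) (auto simp: ind_A_other[OF supp])
  finally show ?thesis by (simp add: supp)
qed

text \<open>Cutting at the level \<open>1 / t\<close> of \<open>w\<close> bounds the K-functional by
  a multiple of the sum of \<open>1 / e j * min 1 (t * (e j)\<^sup>2)\<close>. As the
  \<open>e j\<close> are widely separated, this sum is comparable to its largest term: where
  \<open>t * (e j)\<^sup>2 \<ge> 1\<close> the smallest \<open>e j\<close> dominates, elsewhere the
  largest. The pieces enter only through \<open>b\<close>.\<close>

lemma K_lsum_upper: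
  assumes t: "0 < t" and \<kappa>: "\<And>j. 1 / e j * min 1 (t * (e j)\<^sup>2) \<le> \<kappa>"
  shows "K t (lsum u) \<le> 24 * b * \<kappa>"
proof -
  define k where "k j = 1 / e j * min 1 (t * (e j)\<^sup>2)" for j
  have k0: "0 < k j" "k j \<le> \<kappa>" for j using \<kappa>[of j] t e_pos[of j] by (auto simp: k_def)
  have \<kappa>0: "0 \<le> \<kappa>" using k0[of 0] by simp
  \<comment> \<open>A dominant term plus a geometric remainder: 1 + 4/3 is at most 3.\<close>
  have part: "(\<Sum>j\<in>G. k j) \<le> 3 * \<kappa>" if G: "finite G" and i: "i \<in> G" and d: "\<And>j. j \<in> G \<Longrightarrow> j \<noteq> i \<Longrightarrow> k j \<le> (1/4) ^ j * k i" for G i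
  proof -
    have "(\<Sum>j\<in>G. k j) = k i + (\<Sum>j\<in>G - {i}. k j)" using G i by (simp add: sum.remove)
    also have "(\<Sum>j\<in>G - {i}. k j) \<le> (\<Sum>j\<in>G - {i}. (1/4) ^ j * \<kappa>)"
    proof (rule sum_mono)
      fix j assume "j \<in> G - {i}"
      then have "k j \<le> (1/4) ^ j * k i" using d by auto
      also have "\<dots> \<le> (1/4) ^ j * \<kappa>" using k0 by (intro mult_left_mono) auto
      finally show "k j \<le> (1/4) ^ j * \<kappa>" .
    qed
    also have "\<dots> = (\<Sum>j\<in>G - {i}. (1/4) ^ j) * \<kappa>" by (simp add: sum_distrib_right)
    also have "\<dots> \<le> 4/3 * \<kappa>" using G \<kappa>0 by (intro mult_right_mono sum_geometric_le) auto
    finally show ?thesis using k0(2)[of i] \<kappa>0 by simp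
  qed
  have ratio: "e i / e j \<le> (1/4) ^ j" "e i / e j \<le> (1/4) ^ i" if "e i \<le> e j" "i \<noteq> j" for i j
  proof -
    have "e i / e j \<le> e j / e i" using that e_pos[of i] e_pos[of j] by (simp add: divide_le_eq_1 frac_le)
    then have "e i / e j \<le> (1/4) ^ (i + j + 2)" using e_sep[OF that(2)] by (simp add: min_def)
    moreover have "(1/4::real) ^ (i + j + 2) \<le> (1/4) ^ j" "(1/4::real) ^ (i + j + 2) \<le> (1/4) ^ i"
      by (rule power_decreasing; simp)+
    ultimately show "e i / e j \<le> (1/4) ^ j" "e i / e j \<le> (1/4) ^ i" by (blast intro: order_trans)+
  qed
  have fin: "(\<Sum>j\<in>G. k j) \<le> 6 * \<kappa>" if G: "finite G" for G
  proof -
    let ?G1 = "{j \<in> G. 1 \<le> t * (e j)\<^sup>2}" and ?G2 = "{j \<in> G. \<not> 1 \<le> t * (e j)\<^sup>2}"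
    have "(\<Sum>j\<in>?G1. k j) \<le> 3 * \<kappa>"
    proof (cases "?G1 = {}")
      case True
      show ?thesis unfolding True using \<kappa>0 by simp
    next
      case False
      have "Min (e ` ?G1) \<in> e ` ?G1" using False G by (intro Min_in) auto
      then obtain i where i: "i \<in> ?G1" "e i = Min (e ` ?G1)" by auto
      show ?thesis
      proof (rule part[OF _ i(1)])
        fix j assume j: "j \<in> ?G1" "j \<noteq> i"
        have "e i \<le> e j" unfolding i(2) using G j by (intro Min_le) auto
        then have "e i / e j \<le> (1/4) ^ j" using j by (intro ratio) auto
        then have "e i / e j * (1 / e i) \<le> (1/4) ^ j * (1 / e i)" using e_pos[of i] by (intro mult_right_mono) auto
        then show "k j \<le> (1/4) ^ j * k i" using i(1) j(1) e_pos[of i] by (simp add: k_def min_def)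
      qed (use G in auto)
    qed
    moreover have "(\<Sum>j\<in>?G2. k j) \<le> 3 * \<kappa>"
    proof (cases "?G2 = {}")
      case True
      show ?thesis unfolding True using \<kappa>0 by simp
    next
      case False
      have "Max (e ` ?G2) \<in> e ` ?G2" using False G by (intro Max_in) auto
      then obtain i where i: "i \<in> ?G2" "e i = Max (e ` ?G2)" by auto
      have k2: "k j = t * e j" if "j \<in> ?G2" for j
        using that e_pos[of j] by (simp add: k_def min_def power2_eq_square)
      show ?thesis
      proof (rule part[OF _ i(1)])
        fix j assume j: "j \<in> ?G2" "j \<noteq> i"
        have "e j \<le> e i" unfolding i(2) using G j by (intro Max_ge) auto
        then have "e j / e i \<le> (1/4) ^ j" using j by (intro ratio) auto
        then have "e j / e i * (t * e i) \<le> (1/4) ^ j * (t * e i)" using e_pos[of i] t by (intro mult_right_mono) auto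
        then show "k j \<le> (1/4) ^ j * k i" unfolding k2[OF i(1)] k2[OF j(1)] using e_pos[of i] by (simp add: mult.commute[of t "e j"])
      qed (use G in auto)
    qed
    moreover have "(\<Sum>j\<in>G. k j) = (\<Sum>j\<in>?G1. k j) + (\<Sum>j\<in>?G2. k j)"
      using G by (subst sum.union_disjoint[symmetric]) (auto intro!: sum.cong)
    ultimately show ?thesis by linarith
  qed
  have sumk: "(\<Sum>j. ennreal (2 * b * k j)) \<le> ennreal (12 * b * \<kappa>)"
  proof -
    have "(\<Sum>j<n. ennreal (2 * b * k j)) \<le> ennreal (12 * b * \<kappa>)" for n
    proof -
      have "(\<Sum>j<n. ennreal (2 * b * k j)) = ennreal (2 * b * (\<Sum>j<n. k j))"
        using b k0 by (subst sum_ennreal) (auto simp: sum_distrib_left less_imp_le)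
      also have "\<dots> \<le> ennreal (2 * b * (6 * \<kappa>))" using b by (intro ennreal_leI mult_left_mono fin) auto
      finally show ?thesis by (simp add: mult_ac)
    qed
    then show ?thesis unfolding suminf_eq_SUP by (rule SUP_least)
  qed
  let ?a = "ind (Hi (1 / t)) * lsum u" and ?c = "ind (Lo (1 / t)) * lsum u"
  have na: "N ?a \<le> ennreal (12 * b * \<kappa>)"
  proof (rule order_trans[OF N_mult_lsum_le order_trans[OF suminf_le sumk]])
    fix j
    show "N (ind (Hi (1 / t)) * ((1 / e j) *\<^sub>R u j)) \<le> ennreal (2 * b * k j)"
    proof (cases "Hi (1 / t) \<inter> A j = {}")
      case True
      then show ?thesis by (simp add: ind_disjoint_A[OF supp])
    next
      case False
      \<comment> \<open>A piece reaching above the cut may begin below it; since \<open>w\<close>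
        varies there by at most a factor 2, \<open>min 1 (t * (e j)\<^sup>2)\<close> is still at
        least 1/2.\<close>
      then obtain s where "1 / t \<le> rep_L0 w s" "rep_L0 w s \<le> 2 * (e j)\<^sup>2" by (auto simp: Hi_def A_def level_set_def)
      then have "1 / t \<le> 2 * (e j)\<^sup>2" by simp
      then have "1 \<le> 2 * (t * (e j)\<^sup>2)" using t by (simp add: field_simps)
      then have "1 \<le> 2 * min 1 (t * (e j)\<^sup>2)" by (simp add: min_def)
      then have "1 / e j * b * 1 \<le> 1 / e j * b * (2 * min 1 (t * (e j)\<^sup>2))"
        using e_pos[of j] b by (intro mult_left_mono) auto
      then have le: "1 / e j * b \<le> 2 * b * k j" by (simp add: k_def mult_ac)
      have "N (ind (Hi (1 / t)) * ((1 / e j) *\<^sub>R u j)) \<le> N ((1 / e j) *\<^sub>R u j)" by (rule N_ind_le) simp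
      also have "\<dots> \<le> ennreal (1 / e j) * ennreal b"
        unfolding N_scaleR using e_pos[of j] bound by (intro mult_mono) auto
      also have "\<dots> = ennreal (1 / e j * b)" using e_pos[of j] b by (subst ennreal_mult) auto
      also have "\<dots> \<le> ennreal (2 * b * k j)" using le by (rule ennreal_leI)
      finally show ?thesis .
    qed
  qed auto
  have nc: "ennreal t * N (?c * w) \<le> ennreal (12 * b * \<kappa>)"
  proof -
    have "ennreal t * N (?c * w) = N ((t *\<^sub>R (w * ind (Lo (1 / t)))) * lsum u)"
      using t by (simp add: N_scaleR mult_ac)
    also have "\<dots> \<le> (\<Sum>j. N ((t *\<^sub>R (w * ind (Lo (1 / t)))) * ((1 / e j) *\<^sub>R u j)))"
      by (rule N_mult_lsum_le)
    also have "\<dots> \<le> (\<Sum>j. ennreal (2 * b * k j))"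
    proof (intro suminf_le)
      fix j
      have eq: "N ((t *\<^sub>R (w * ind (Lo (1 / t)))) * ((1 / e j) *\<^sub>R u j)) = ennreal t * (ennreal (1 / e j) * N (ind (Lo (1 / t)) * (u j * w)))"
      proof -
        have "(t *\<^sub>R (w * ind (Lo (1 / t)))) * ((1 / e j) *\<^sub>R u j) = t *\<^sub>R ((1 / e j) *\<^sub>R (ind (Lo (1 / t)) * (u j * w)))"
          by (simp add: mult_ac)
        then show ?thesis using t e_pos[of j] by (simp only: N_scaleR) simp
      qed
      show "N ((t *\<^sub>R (w * ind (Lo (1 / t)))) * ((1 / e j) *\<^sub>R u j)) \<le> ennreal (2 * b * k j)"
      proof (cases "Lo (1 / t) \<inter> A j = {}")
        case True
        then have "ind (Lo (1 / t)) * u j = 0" by (simp add: ind_disjoint_A[OF supp])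
        then show ?thesis unfolding eq by (simp add: mult.assoc[symmetric])
      next
        case False
        then obtain s where "rep_L0 w s < 1 / t" "(e j)\<^sup>2 \<le> rep_L0 w s" by (auto simp: Lo_def A_def level_set_def)
        then have "(e j)\<^sup>2 < 1 / t" by simp
        then have "t * (e j)\<^sup>2 \<le> 1" using t by (simp add: field_simps)
        then have kj: "k j = t * e j" using e_pos[of j] by (simp add: k_def min_def power2_eq_square)
        have "ennreal t * (ennreal (1 / e j) * N (ind (Lo (1 / t)) * (u j * w))) \<le> ennreal t * (ennreal (1 / e j) * ennreal (2 * (e j)\<^sup>2 * b))"
          by (intro mult_left_mono order_trans[OF N_ind_le N_level_weighted]) auto
        also have "\<dots> = ennreal (2 * b * k j)"
          using t e_pos[of j] b unfolding kj by (simp add: ennreal_mult[symmetric] power2_eq_square mult_ac)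
        finally show ?thesis unfolding eq .
      qed
    qed auto
    also have "\<dots> \<le> ennreal (12 * b * \<kappa>)" by (rule sumk)
    finally show ?thesis .
  qed
  have fa: "N ?a < \<infinity>" using na by (rule le_less_trans) simp
  have fc: "N (?c * w) < \<infinity>"
  proof -
    have "ennreal t * N (?c * w) < \<infinity>" using nc by (rule le_less_trans) simp
    then show ?thesis using t by (auto simp: ennreal_mult_less_top)
  qed
  have "K t (?a + ?c) \<le> enn2real (N ?a) + t * enn2real (N (?c * w))"
    unfolding K_def by (rule K_functional_upper) (use t fa fc in auto)
  also have "t * enn2real (N (?c * w)) = enn2real (ennreal t * N (?c * w))" using t by (simp add: enn2real_mult)
  also have "enn2real (N ?a) + \<dots> \<le> 12 * b * \<kappa> + 12 * b * \<kappa>"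
    using na nc b \<kappa>0 by (intro add_mono enn2real_leI) auto
  finally show ?thesis unfolding Hi_Lo by (simp add: mult_ac)
qed

text \<open>Restricting a decomposition to \<open>A j\<close> isolates the piece \<open>u j\<close>.
  There the weighted norm is at least \<open>(e j)\<^sup>2\<close> times the plain one, and
  multiplication by \<open>min 1 (t * (e j)\<^sup>2)\<close> fits both terms under those of the
  K-functional.\<close>

lemma K_lsum_lower:
  assumes t: "0 < t" and lower: "1 \<le> N (u j)"
  shows "1 / e j * min 1 (t * (e j)\<^sup>2) \<le> K t (lsum u)"
  unfolding K_def
proof (rule K_functional_lower)
  show "lsum u \<in> pts (couple_sum X Y)" unfolding pts_sum by (rule N_v_lsum)
  fix x0 x1 assume d: "N x0 < \<infinity>" "N (x1 * w) < \<infinity>" "lsum u = x0 + x1"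
  define m where "m = min 1 (t * (e j)\<^sup>2)"
  have m: "0 < m" "m \<le> 1" "m * (1 / (e j)\<^sup>2) \<le> t" using t e_pos[of j] by (auto simp: m_def field_simps min_def)
  have "ennreal (1 / e j) \<le> ennreal (1 / e j) * N (u j)" using mult_left_mono[OF lower, of "ennreal (1 / e j)"] by simp
  also have "\<dots> = N (ind (A j) * lsum u)" unfolding ind_A_lsum N_scaleR using e_pos[of j] by simp
  also have "\<dots> \<le> N (ind (A j) * x0) + N (ind (A j) * x1)" unfolding d(3) distrib_left by (rule N_triangle)
  also have "\<dots> \<le> N x0 + ennreal (1 / (e j)\<^sup>2) * N (x1 * w)" by (intro add_mono N_ind_le N_A_le_weighted) simp
  also have "\<dots> = ennreal (enn2real (N x0) + 1 / (e j)\<^sup>2 * enn2real (N (x1 * w)))"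
  proof -
    obtain a0 a1 where a: "0 \<le> a0" "N x0 = ennreal a0" "0 \<le> a1" "N (x1 * w) = ennreal a1"
      using d(1,2) by (cases "N x0"; cases "N (x1 * w)") auto
    show ?thesis unfolding a(2,4) using a(1,3) by (simp add: ennreal_mult[symmetric] ennreal_plus[symmetric] del: ennreal_plus)
  qed
  finally have "1 / e j \<le> enn2real (N x0) + 1 / (e j)\<^sup>2 * enn2real (N (x1 * w))"
    by (subst (asm) ennreal_le_iff) auto
  then have "m * (1 / e j) \<le> m * (enn2real (N x0) + 1 / (e j)\<^sup>2 * enn2real (N (x1 * w)))" using m by (intro mult_left_mono) auto
  also have "\<dots> = m * enn2real (N x0) + (m * (1 / (e j)\<^sup>2)) * enn2real (N (x1 * w))" by (simp add: distrib_left)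
  also have "\<dots> \<le> 1 * enn2real (N x0) + t * enn2real (N (x1 * w))" using m by (intro add_mono mult_right_mono) auto
  finally show "1 / e j * min 1 (t * (e j)\<^sup>2) \<le> enn2real (N x0) + t * enn2real (N (x1 * w))" by (simp add: m_def)
qed

end

end

context coorbit_space
begin

lemma q_lsum:
  assumes supp: "\<And>j. ind (A j) * u j = u j" and bound: "\<And>j. N (u j) \<le> ennreal b" and b: "0 \<le> b"
  shows "q m (lsum u) = N (\<Sum>i\<in>F m. u i)"
proof -
  have "e i *\<^sub>R (ind (A i) * lsum u) = u i" for i
    using e_pos[of i] by (simp add: ind_A_lsum[OF supp bound b])
  then show ?thesis by (simp add: q_def)
qed

text \<open>Off-diagonal entries of an admissible operator are negligible because the levels of the weight are
  far apart; the diagonal part is controlled by pinching.\<close>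

lemma NE_lsum_finite:
  assumes supp: "\<And>j. ind (A j) * x j = x j" and bound: "\<And>j. N (x j) \<le> 1"
    and batch: "\<And>m. N (\<Sum>i\<in>F m. x i) \<le> ennreal D" and D: "0 \<le> D"
  shows "NE (lsum x) < \<infinity>"
proof -
  have bound': "N (x j) \<le> ennreal 1" for j using bound by simp
  note x_props = supp bound' zero_le_one
  let ?x = "lsum x"
  have vx: "N (v * ?x) < \<infinity>" by (rule N_v_lsum[OF x_props])
  \<comment> \<open>Pinching is applied to the batch sum \<open>?g\<close>: its restriction to
    \<open>A i\<close> is \<open>x i\<close>, and the remainder off the batch vanishes.\<close>
  have diag: "N (\<Sum>i\<in>F m. ind (A i) * T (x i)) \<le> ennreal D" if T: "T \<in> Adm" for T m
  proof -
    let ?g = "\<Sum>i\<in>F m. x i" and ?R = "ind ({0..1} - (\<Union>i\<in>F m. A i))"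
    have g: "N ?g < \<infinity>" using batch[of m] by (rule le_less_trans) simp
    have P: "ind (A i) * ?g = x i" if "i \<in> F m" for i
    proof -
      have "ind (A i) * ?g = (\<Sum>j\<in>F m. ind (A i) * x j)" by (simp add: sum_distrib_left)
      also have "\<dots> = (\<Sum>j\<in>{i}. ind (A i) * x j)"
        using finite_F that by (intro sum.mono_neutral_right) (auto simp: ind_A_other[OF supp])
      finally show ?thesis by (simp add: supp)
    qed
    have R: "?R * ?g = 0"
    proof -
      have "?R * x j = 0" if "j \<in> F m" for j
        by (rule ind_disjoint_A[OF supp])
          (use that in \<open>auto intro!: sets.Diff sets_unit_interval sets.finite_UN finite_F sets_A simp del: UN_simps\<close>)
      then show ?thesis by (simp add: sum_distrib_left)
    qed
    have vN: "N (v * z) < \<infinity>" if "N z < \<infinity>" for z using N_v_le that by (rule le_less_trans)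
    have "N ((\<Sum>i\<in>F m. ind (A i) * T (ind (A i) * ?g)) + ?R * T (?R * ?g)) \<le> N ?g"
      by (rule pinching[OF finite_F sets_A A_disjoint])
        (use linear_operator_sumD[OF AdmD(1)[OF T]] vN AdmD(2)[OF T] g in auto)
    then show ?thesis using batch[of m] by (simp add: P R Adm_zero[OF T])
  qed
  have err: "N (e i *\<^sub>R (ind (A i) * T ?x) - ind (A i) * T (x i)) \<le> ennreal ((1/4) ^ i)" if T: "T \<in> Adm" for T i
  proof -
    let ?B = "{0..1} - A i"
    have Bs: "?B \<in> sets unit_leb" by auto
    define x' where "x' = ind ?B * ?x"
    have split: "?x = (1 / e i) *\<^sub>R x i + x'"
    proof -
      have "ind (A i) * ?x + ind ?B * ?x = ?x" by (rule ind_complement[OF sets_A])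
      then show ?thesis unfolding ind_A_lsum[OF x_props] by (simp add: x'_def)
    qed
    \<comment> \<open>The other levels are separated at the level \<open>(e i)\<^sup>2\<close> of
      \<open>w\<close>. The upper part is small in the unweighted norm, of order
      \<open>1 / e i\<close> times \<open>(1/4) ^ i\<close>; the lower part is small in the weighted
      norm, of order \<open>e i\<close> times \<open>(1/4) ^ i\<close>. Both estimates are
      \<open>e_sep\<close> summed over \<open>j\<close>.\<close>
    let ?h = "ind (Hi ((e i)\<^sup>2)) * x'" and ?l = "ind (Lo ((e i)\<^sup>2)) * x'"
    \<comment> \<open>The factor 1/12 is 1/16, from the exponent 2, times the sum 4/3 of the
      geometric series.\<close>
    have geo: "(\<Sum>j. ennreal (c * (1/4) ^ (i + j + 2))) = ennreal (c * (1/12) * (1/4) ^ i)" if "0 \<le> c" for c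
    proof -
      have "(\<Sum>j. ennreal (c * (1/4) ^ (i + j + 2))) = (\<Sum>j. ennreal (c * (1/4) ^ i * (1/16) * (1/4) ^ j))"
        by (simp add: power_add power2_eq_square mult_ac)
      also have "\<dots> = ennreal (4/3 * (c * (1/4) ^ i * (1/16)))" using that by (intro suminf_geometric_quarter) auto
      finally show ?thesis by (simp add: mult_ac)
    qed
    have zero_i: "ind ?B * x i = 0" by (rule ind_disjoint_A[OF supp]) auto
    have h: "N ?h \<le> ennreal (1 / e i * (1/12) * (1/4) ^ i)"
    proof -
      have "N ?h = N ((ind (Hi ((e i)\<^sup>2)) * ind ?B) * ?x)" by (simp add: x'_def mult.assoc)
      also have "\<dots> \<le> (\<Sum>j. N ((ind (Hi ((e i)\<^sup>2)) * ind ?B) * ((1 / e j) *\<^sub>R x j)))"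
        by (rule N_mult_lsum_le[OF x_props])
      also have "\<dots> \<le> (\<Sum>j. ennreal (1 / e i * (1/4) ^ (i + j + 2)))"
      proof (intro suminf_le)
        fix j
        show "N ((ind (Hi ((e i)\<^sup>2)) * ind ?B) * ((1 / e j) *\<^sub>R x j)) \<le> ennreal (1 / e i * (1/4) ^ (i + j + 2))"
        proof (cases "j = i \<or> Hi ((e i)\<^sup>2) \<inter> A j = {}")
          case True
          then have "ind (Hi ((e i)\<^sup>2)) * (ind ?B * x j) = 0"
          proof
            assume "Hi ((e i)\<^sup>2) \<inter> A j = {}"
            then have "ind (Hi ((e i)\<^sup>2)) * x j = 0" by (intro ind_disjoint_A[OF supp]) auto
            then show ?thesis by (simp add: mult.left_commute)
          qed (simp add: zero_i)
          then show ?thesis by (simp add: mult.assoc)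
        next
          case False
          then obtain s where "(e i)\<^sup>2 \<le> rep_L0 w s" "rep_L0 w s \<le> 2 * (e j)\<^sup>2" by (auto simp: Hi_def A_def level_set_def)
          then have "e i / e j \<le> (1/4) ^ (i + j + 2)" using False by (intro e_less_if_ratio) auto
          then have "1 / e i * (e i / e j) \<le> 1 / e i * (1/4) ^ (i + j + 2)" using e_pos[of i] by (intro mult_left_mono) auto
          then have le: "1 / e j \<le> 1 / e i * (1/4) ^ (i + j + 2)" using e_pos[of i] by simp
          have "N ((ind (Hi ((e i)\<^sup>2)) * ind ?B) * ((1 / e j) *\<^sub>R x j)) \<le> N ((1 / e j) *\<^sub>R x j)"
            unfolding ind_mult_ind[OF sets_Hi Bs] by (rule N_ind_le) (use Bs in auto)
          also have "\<dots> \<le> ennreal (1 / e j) * 1" unfolding N_scaleR using e_pos[of j] bound by (intro mult_mono) auto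
          also have "\<dots> \<le> ennreal (1 / e i * (1/4) ^ (i + j + 2))" using le by (simp add: ennreal_leI)
          finally show ?thesis .
        qed
      qed auto
      also have "\<dots> = ennreal (1 / e i * (1/12) * (1/4) ^ i)" using e_pos[of i] by (intro geo) auto
      finally show ?thesis .
    qed
    have l: "N (?l * w) \<le> ennreal (2 * e i * (1/12) * (1/4) ^ i)"
    proof -
      have "N (?l * w) = N ((w * (ind (Lo ((e i)\<^sup>2)) * ind ?B)) * ?x)" by (simp add: x'_def mult_ac)
      also have "\<dots> \<le> (\<Sum>j. N ((w * (ind (Lo ((e i)\<^sup>2)) * ind ?B)) * ((1 / e j) *\<^sub>R x j)))"
        by (rule N_mult_lsum_le[OF x_props])
      also have "\<dots> \<le> (\<Sum>j. ennreal (2 * e i * (1/4) ^ (i + j + 2)))"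
      proof (intro suminf_le)
        fix j
        have eq: "(w * (ind (Lo ((e i)\<^sup>2)) * ind ?B)) * ((1 / e j) *\<^sub>R x j) = (1 / e j) *\<^sub>R (ind (Lo ((e i)\<^sup>2) \<inter> ?B) * (x j * w))"
          unfolding ind_mult_ind[OF sets_Lo Bs, symmetric] by (simp add: mult_ac)
        show "N ((w * (ind (Lo ((e i)\<^sup>2)) * ind ?B)) * ((1 / e j) *\<^sub>R x j)) \<le> ennreal (2 * e i * (1/4) ^ (i + j + 2))"
        proof (cases "j = i \<or> Lo ((e i)\<^sup>2) \<inter> A j = {}")
          case True
          then have "ind (Lo ((e i)\<^sup>2) \<inter> ?B) * x j = 0" using Bs by (intro ind_disjoint_A[OF supp]) auto
          then show ?thesis unfolding eq by (simp add: mult.assoc[symmetric])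
        next
          case False
          then obtain s where s: "rep_L0 w s < (e i)\<^sup>2" "(e j)\<^sup>2 \<le> rep_L0 w s" by (auto simp: Lo_def A_def level_set_def)
          then have "(e j)\<^sup>2 \<le> 2 * (e i)\<^sup>2" using zero_le_power2[of "e i"] by linarith
          then have "e j / e i \<le> (1/4) ^ (j + i + 2)" using False by (intro e_less_if_ratio) auto
          then have "2 * e i * (e j / e i) \<le> 2 * e i * (1/4) ^ (i + j + 2)"
            using e_pos[of i] by (intro mult_left_mono) (auto simp: add.commute)
          then have le: "2 * e j \<le> 2 * e i * (1/4) ^ (i + j + 2)" using e_pos[of i] by simp
          have "N ((w * (ind (Lo ((e i)\<^sup>2)) * ind ?B)) * ((1 / e j) *\<^sub>R x j)) \<le> ennreal (1 / e j) * ennreal (2 * (e j)\<^sup>2 * 1)"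
            unfolding eq N_scaleR using e_pos[of j] Bs
            by (intro mult_mono order_trans[OF N_ind_le N_level_weighted[OF x_props]]) auto
          also have "\<dots> = ennreal (2 * e j)" using e_pos[of j] by (simp add: ennreal_mult[symmetric] power2_eq_square)
          also have "\<dots> \<le> ennreal (2 * e i * (1/4) ^ (i + j + 2))" using le by (rule ennreal_leI)
          finally show ?thesis .
        qed
      qed auto
      also have "\<dots> = ennreal (2 * e i * (1/12) * (1/4) ^ i)" using e_pos[of i] by (intro geo) auto
      finally show ?thesis .
    qed
    have fh: "N ?h < \<infinity>" using h by (rule le_less_trans) simp
    have fl: "N (?l * w) < \<infinity>" using l by (rule le_less_trans) simp
    have vh: "N (v * ?h) < \<infinity>" using N_v_le fh by (rule le_less_trans)
    have vl: "N (v * ?l) < \<infinity>" using N_v_le_weighted fl by (rule le_less_trans)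
    have vhl: "N (v * (?h + ?l)) < \<infinity>"
      unfolding distrib_left[of v] by (rule le_less_trans[OF N_triangle]) (use vh vl in simp)
    have vxi: "N (v * x i) < \<infinity>" by (rule le_less_trans[OF N_v_le le_less_trans[OF bound[of i]]]) simp
    have vxi': "N (v * ((1 / e i) *\<^sub>R x i)) < \<infinity>" using vxi by (simp add: N_scaleR ennreal_mult_less_top)
    note Tadd = linear_operator_sumD(2)[OF AdmD(1)[OF T]] and Tsc = linear_operator_sumD(3)[OF AdmD(1)[OF T]]
    have "T ?x = T ((1 / e i) *\<^sub>R x i + (?h + ?l))" by (subst split) (simp only: Hi_Lo)
    also have "\<dots> = (1 / e i) *\<^sub>R T (x i) + (T ?h + T ?l)"
      by (simp only: Tadd[OF vxi' vhl] Tadd[OF vh vl] Tsc[OF vxi])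
    finally have "e i *\<^sub>R (ind (A i) * T ?x) - ind (A i) * T (x i) = e i *\<^sub>R (ind (A i) * T ?h) + e i *\<^sub>R (ind (A i) * T ?l)"
      using e_pos[of i] by (simp add: distrib_left scaleR_add_right)
    then have "N (e i *\<^sub>R (ind (A i) * T ?x) - ind (A i) * T (x i)) \<le> N (e i *\<^sub>R (ind (A i) * T ?h)) + N (e i *\<^sub>R (ind (A i) * T ?l))"
      by (simp add: N_triangle)
    also have "\<dots> = ennreal (e i) * N (ind (A i) * T ?h) + ennreal (e i) * N (ind (A i) * T ?l)"
      using e_pos[of i] by (simp add: N_scaleR)
    also have "\<dots> \<le> ennreal (e i) * ennreal (1 / e i * (1/12) * (1/4) ^ i)
      + ennreal (e i) * (ennreal (1 / (e i)\<^sup>2) * ennreal (2 * e i * (1/12) * (1/4) ^ i))"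
    proof (intro add_mono mult_left_mono)
      show "N (ind (A i) * T ?h) \<le> ennreal (1 / e i * (1/12) * (1/4) ^ i)"
        by (rule order_trans[OF N_ind_le[OF sets_A] order_trans[OF AdmD(2)[OF T fh] h]])
      have "N (ind (A i) * T ?l) \<le> ennreal (1 / (e i)\<^sup>2) * N (T ?l * w)" by (rule N_A_le_weighted)
      also have "\<dots> \<le> ennreal (1 / (e i)\<^sup>2) * ennreal (2 * e i * (1/12) * (1/4) ^ i)"
        by (intro mult_left_mono order_trans[OF AdmD(3)[OF T fl] l]) simp
      finally show "N (ind (A i) * T ?l) \<le> ennreal (1 / (e i)\<^sup>2) * ennreal (2 * e i * (1/12) * (1/4) ^ i)" .
    qed auto
    also have "\<dots> = ennreal (1/12 * (1/4) ^ i + 2 * (1/12) * (1/4) ^ i)"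
      using e_pos[of i] by (simp add: ennreal_mult[symmetric] ennreal_plus[symmetric] power2_eq_square del: ennreal_plus)
    also have "\<dots> \<le> ennreal ((1/4) ^ i)" by (intro ennreal_leI) simp
    finally show ?thesis .
  qed
  have "NE ?x \<le> N (v * ?x) + (ennreal D + ennreal (4/3))"
  proof (rule NE_least)
    fix T m assume T: "T \<in> Adm"
    have "(\<Sum>i\<in>F m. e i *\<^sub>R (ind (A i) * T ?x))
      = (\<Sum>i\<in>F m. ind (A i) * T (x i)) + (\<Sum>i\<in>F m. e i *\<^sub>R (ind (A i) * T ?x) - ind (A i) * T (x i))"
      by (simp add: sum_subtractf)
    then have "q m (T ?x) \<le> N (\<Sum>i\<in>F m. ind (A i) * T (x i)) + N (\<Sum>i\<in>F m. e i *\<^sub>R (ind (A i) * T ?x) - ind (A i) * T (x i))"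
      unfolding q_def by (simp only: N_triangle)
    also have "\<dots> \<le> ennreal D + (\<Sum>i\<in>F m. ennreal ((1/4) ^ i))"
      by (intro add_mono diag[OF T] order_trans[OF N_sum_le[OF finite_F]] sum_mono err[OF T])
    also have "(\<Sum>i\<in>F m. ennreal ((1/4) ^ i)) \<le> ennreal (4/3)"
    proof -
      have "(\<Sum>i\<in>F m. ennreal ((1/4) ^ i)) = ennreal (\<Sum>i\<in>F m. (1/4) ^ i)" by (rule sum_ennreal) simp
      then show ?thesis using ennreal_leI[OF sum_geometric_le[OF finite_F[of m]]] by simp
    qed
    finally have "q m (T ?x) \<le> ennreal D + ennreal (4/3)" by (simp add: add_left_mono)
    then show "N (v * ?x) + q m (T ?x) \<le> N (v * ?x) + (ennreal D + ennreal (4/3))" by (rule add_left_mono)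
  qed
  also have "\<dots> < \<infinity>" using vx by simp
  finally show ?thesis .
qed

text \<open>The K-functional of \<open>lsum\<close> registers only the norms of single pieces, which
  are 1 for \<open>x\<close> and at most 1 for \<open>y\<close>, whereas \<open>NE\<close> registers
  the batch sums, which are bounded for \<open>x\<close> and unbounded for \<open>y\<close>.\<close>

lemma not_K_monotone_couple:
  assumes suppx: "\<And>j. ind (A j) * x j = x j" and x: "\<And>j. N (x j) = 1"
    and batchx: "\<And>m. N (\<Sum>i\<in>F m. x i) \<le> ennreal D" and D: "0 \<le> D"
    and suppy: "\<And>j. ind (A j) * y j = y j" and y: "\<And>j. N (y j) \<le> 1"
    and batchy: "\<And>m. ennreal (real m) \<le> N (\<Sum>i\<in>F m. y i)"
  shows "\<not> K_monotone_couple X Y"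
proof
  assume "K_monotone_couple X Y"
  then have "K_monotone_space E X Y" using interpolation_space_E by (simp add: K_monotone_couple_def)
  then have KM: "z \<in> pts E"
    if "u \<in> pts E" "z \<in> pts (couple_sum X Y)" "\<And>t. 0 < t \<Longrightarrow> K t z \<le> K t u" for u z
    using that unfolding K_monotone_space_def K_def by blast
  \<comment> \<open>The scaling cancels the constant 24 of \<open>K_lsum_upper\<close>, because
    K-monotonicity compares K-functionals with constant 1.\<close>
  define y' where "y' j = (1/24) *\<^sub>R y j" for j
  have suppx': "N (x j) \<le> ennreal 1" "1 \<le> N (x j)" for j using x by auto
  have suppy': "ind (A j) * y' j = y' j" for j by (simp add: y'_def suppy)
  have y'b: "N (y' j) \<le> ennreal (1/24)" for j
    using mult_left_mono[OF y[of j], of "ennreal (1/24)"] by (simp add: y'_def N_scaleR)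
  have "lsum y' \<in> pts E"
  proof (rule KM)
    show "lsum x \<in> pts E" unfolding pts_E by (rule NE_lsum_finite[OF suppx _ batchx D]) (simp add: x)
    show "lsum y' \<in> pts (couple_sum X Y)" unfolding pts_sum by (rule N_v_lsum[OF suppy' y'b]) simp
    fix t :: real assume t: "0 < t"
    have "K t (lsum y') \<le> 24 * (1/24) * K t (lsum x)"
    proof (rule K_lsum_upper[OF suppy' y'b _ t])
      show "1 / e j * min 1 (t * (e j)\<^sup>2) \<le> K t (lsum x)" for j
        by (rule K_lsum_lower[OF suppx suppx'(1) _ t suppx'(2)]) simp
    qed simp
    then show "K t (lsum y') \<le> K t (lsum x)" by simp
  qed
  then have fin: "NE (lsum y') < \<infinity>" by (simp add: pts_E)
  have "ennreal (real m / 24) \<le> NE (lsum y')" for m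
  proof -
    have "ennreal (real m / 24) = ennreal (1/24) * ennreal (real m)" by (simp add: ennreal_mult[symmetric])
    also have "\<dots> \<le> ennreal (1/24) * N (\<Sum>i\<in>F m. y i)" by (intro mult_left_mono batchy) simp
    also have "\<dots> = N ((1/24) *\<^sub>R (\<Sum>i\<in>F m. y i))" by (simp add: N_scaleR)
    also have "(1/24) *\<^sub>R (\<Sum>i\<in>F m. y i) = (\<Sum>i\<in>F m. y' i)" by (simp add: y'_def scaleR_sum_right)
    also have "N (\<Sum>i\<in>F m. y' i) = q m (lsum y')" by (rule q_lsum[OF suppy' y'b, symmetric]) simp
    also have "\<dots> \<le> NE (lsum y')" using q_le_NE[OF id_Adm] by simp
    finally show ?thesis .
  qed
  then have "real m / 24 \<le> nrm E (lsum y')" for m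
    using NE_eq_nrm[OF fin] by (metis ennreal_le_iff enn2real_nonneg nrm_E)
  moreover obtain m :: nat where "24 * nrm E (lsum y') < m" using reals_Archimedean2 by blast
  ultimately show False by (metis divide_le_eq_numeral1(1) mult.commute not_less)
qed

end

section \<open>Necessity of slow variation\<close>

lemma exists_power_2_between:
  fixes x :: real
  assumes "1 \<le> x"
  shows "\<exists>k::nat. 2 ^ k \<le> x \<and> x \<le> 2 * 2 ^ k"
proof -
  obtain n0 where n0: "x < 2 ^ n0" using real_arch_pow[of 2 x] by auto
  define n where "n = (LEAST n. x < 2 ^ n)"
  have n: "x < 2 ^ n" unfolding n_def by (rule LeastI[where P = "\<lambda>n. x < 2 ^ n", OF n0])
  then have "n \<noteq> 0" using assms by (cases n) auto
  then obtain k where k: "n = Suc k" by (cases n) auto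
  have "\<not> x < 2 ^ k" using not_less_Least[of k "\<lambda>n. x < 2 ^ n"] k by (simp add: n_def)
  then show ?thesis using n k by (intro exI[of _ k]) auto
qed

text \<open>Otherwise all dyadic level sets above \<open>R\<^sup>2\<close> and below its reciprocal
  would be null. As they cover these ranges, both \<open>w\<close> and \<open>1 / w\<close> would be
  bounded by \<open>R\<^sup>2\<close>.\<close>

lemma nontrivial_weight_level:
  assumes "nontrivial_weight w" and R: "1 \<le> R"
  shows "\<exists>e>0. R \<le> max e (1 / e) \<and> 0 < measure unit_leb (level_set w e)"
proof (rule ccontr)
  assume no: "\<not> ?thesis"
  have null: "AE t in unit_leb. t \<notin> level_set w e" if "0 < e" "R \<le> max e (1 / e)" for e
  proof -
    have "\<not> 0 < measure unit_leb (level_set w e)" using no that by blast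
    then have "measure unit_leb (level_set w e) = 0" by (simp add: zero_less_measure_iff)
    then have "emeasure unit_leb (level_set w e) = 0" by (simp add: unit_leb.emeasure_eq_measure)
    then show ?thesis using sets_level_set by (intro AE_not_in) (auto simp: null_sets_def)
  qed
  have hi: "AE t in unit_leb. \<forall>k::nat. t \<notin> level_set w (R * sqrt (2 ^ k))"
    unfolding AE_all_countable
  proof
    fix k :: nat
    have "R * 1 \<le> R * sqrt (2 ^ k)" using R by (intro mult_left_mono) auto
    then have "R \<le> max (R * sqrt (2 ^ k)) (1 / (R * sqrt (2 ^ k)))" by (simp only: mult_1_right le_max_iff_disj simp_thms)
    then show "AE t in unit_leb. t \<notin> level_set w (R * sqrt (2 ^ k))" using R by (intro null) auto
  qed
  \<comment> \<open>A level set starts at the square of its parameter and ends at twice that, so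
    \<open>2 * 2 ^ k\<close> makes this one end at \<open>1 / (R\<^sup>2 * 2 ^ k)\<close>.\<close>
  have lo: "AE t in unit_leb. \<forall>k::nat. t \<notin> level_set w (1 / (R * sqrt (2 * 2 ^ k)))"
    unfolding AE_all_countable
  proof
    fix k :: nat
    have "(1::real) \<le> 2 ^ k" by simp
    then have "(1::real) \<le> 2 * 2 ^ k" by linarith
    then have "1 \<le> sqrt (2 * 2 ^ k)" using real_sqrt_ge_1_iff by blast
    then have "R * 1 \<le> R * sqrt (2 * 2 ^ k)" using R by (intro mult_left_mono) auto
    then have "R \<le> max (1 / (R * sqrt (2 * 2 ^ k))) (1 / (1 / (R * sqrt (2 * 2 ^ k))))" by simp
    then show "AE t in unit_leb. t \<notin> level_set w (1 / (R * sqrt (2 * 2 ^ k)))" using R by (intro null) auto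
  qed
  have w: "AE t in unit_leb. 0 < rep_L0 w t" using assms(1) by (simp add: nontrivial_weight_def weight_iff)
  have R2: "0 < R\<^sup>2" using R by simp
  have "AE t in unit_leb. rep_L0 w t \<le> R\<^sup>2"
    using hi AE_unit
  proof eventually_elim
    case (elim t)
    show ?case
    proof (rule ccontr)
      assume "\<not> rep_L0 w t \<le> R\<^sup>2"
      then have "1 \<le> rep_L0 w t / R\<^sup>2" using R2 by simp
      then obtain k :: nat where k: "2 ^ k \<le> rep_L0 w t / R\<^sup>2" "rep_L0 w t / R\<^sup>2 \<le> 2 * 2 ^ k"
        using exists_power_2_between by blast
      have "(R * sqrt (2 ^ k))\<^sup>2 = R\<^sup>2 * 2 ^ k" by (simp add: power_mult_distrib)
      then have "t \<in> level_set w (R * sqrt (2 ^ k))"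
        using elim(2) k R2 unfolding level_set_def by (auto simp: field_simps)
      then show False using elim(1) by blast
    qed
  qed
  then have 1: "ess_bounded_above w" unfolding ess_bounded_above_iff by blast
  have "AE t in unit_leb. 1 / rep_L0 w t \<le> R\<^sup>2"
    using lo AE_unit w
  proof eventually_elim
    case (elim t)
    show ?case
    proof (rule ccontr)
      assume "\<not> 1 / rep_L0 w t \<le> R\<^sup>2"
      then have "1 \<le> 1 / rep_L0 w t / R\<^sup>2" unfolding pos_le_divide_eq[OF R2] by linarith
      then obtain k :: nat where k: "2 ^ k \<le> 1 / rep_L0 w t / R\<^sup>2" "1 / rep_L0 w t / R\<^sup>2 \<le> 2 * 2 ^ k"
        using exists_power_2_between by blast
      have eq: "(1 / (R * sqrt (2 * 2 ^ k)))\<^sup>2 = 1 / (R\<^sup>2 * (2 * 2 ^ k))" by (simp add: power_mult_distrib power_divide)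
      have wt: "0 < rep_L0 w t" by fact
      have "R\<^sup>2 * 2 ^ k * rep_L0 w t \<le> 1" "1 \<le> R\<^sup>2 * (2 * 2 ^ k) * rep_L0 w t"
        using k wt R2 by (simp_all add: field_simps)
      then have "t \<in> level_set w (1 / (R * sqrt (2 * 2 ^ k)))"
        using elim(2) R2 unfolding level_set_def eq by (auto simp: field_simps)
      then show False using elim(1) by blast
    qed
  qed
  then have "ess_bounded_above (reciprocal w)"
    unfolding ess_bounded_above_iff using rep_L0_reciprocal[of w] by (intro exI[of _ "R\<^sup>2"]) (auto elim: eventually_elim2)
  with 1 show False using assms(1) by (auto simp: nontrivial_weight_def)
qed

text \<open>Let \<open>M n = max (e n) (1 / e n)\<close> grow by at least
  \<open>16 ^ (n + 2)\<close> at each step. For \<open>i < j\<close>, whether \<open>e j\<close> is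
  large or small, one of the two ratios is at most \<open>M i / M j\<close>, hence at most
  \<open>1 / 16 ^ (j + 1) = (1/4) ^ (2 * j + 2)\<close>, which is below
  \<open>(1/4) ^ (i + j + 2)\<close>.\<close>

lemma separated_sequence:
  assumes "\<And>R::real. 1 \<le> R \<Longrightarrow> \<exists>e>0. R \<le> max e (1 / e) \<and> P e"
  obtains e where "\<And>j. 0 < e j" "\<And>j. P (e j)" "\<And>j. min (e j) (1 / e j) \<le> (1/4) ^ (j + 2)"
    "\<And>i j. i \<noteq> j \<Longrightarrow> min (e i / e j) (e j / e i) \<le> (1/4) ^ (i + j + 2)"
proof -
  let ?m = "\<lambda>e. max e (1 / e) :: real"
  have m1: "1 \<le> ?m e" if "0 < e" for e :: real using that by (auto simp: le_max_iff_disj field_simps)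
  have "\<exists>e. \<forall>n. (0 < e n \<and> P (e n) \<and> 16 \<le> ?m (e n)) \<and> 16 ^ (n + 2) * ?m (e n) \<le> ?m (e (Suc n))"
  proof (rule dependent_nat_choice)
    show "\<exists>e. 0 < e \<and> P e \<and> 16 \<le> ?m e" using assms[of 16] by auto
    fix x n assume x: "0 < x \<and> P x \<and> 16 \<le> ?m x"
    have ge: "16 * 1 \<le> 16 ^ (n + 2) * ?m x"
      using m1[of x] x power_increasing[of 1 "n + 2" "16::real"] by (intro mult_mono) auto
    then have "1 \<le> 16 ^ (n + 2) * ?m x" by linarith
    then obtain y where "0 < y" "16 ^ (n + 2) * ?m x \<le> ?m y" "P y" using assms by blast
    then show "\<exists>y. (0 < y \<and> P y \<and> 16 \<le> ?m y) \<and> 16 ^ (n + 2) * ?m x \<le> ?m y"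
      using ge by (intro exI[of _ y] conjI) linarith+
  qed
  then obtain e where e: "\<And>n. 0 < e n" "\<And>n. P (e n)" "\<And>n. 16 \<le> ?m (e n)"
    "\<And>n. 16 ^ (n + 2) * ?m (e n) \<le> ?m (e (Suc n))" by blast
  define M where "M n = ?m (e n)" for n
  have M1: "1 \<le> M n" for n using m1[OF e(1)] by (simp add: M_def)
  have Mstep: "16 ^ (n + 2) * M n \<le> M (Suc n)" for n using e(4) by (simp add: M_def)
  have M_mono: "M i \<le> M j" if "i \<le> j" for i j
  proof (rule lift_Suc_mono_le[OF _ that])
    fix n
    have "1 * M n \<le> 16 ^ (n + 2) * M n" using M1[of n] by (intro mult_right_mono one_le_power) auto
    then show "M n \<le> M (Suc n)" using Mstep[of n] by linarith
  qed
  have M_sep: "16 ^ (j + 1) * M i \<le> M j" if "i < j" for i j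
  proof -
    obtain k where k: "j = Suc k" using \<open>i < j\<close> by (cases j) auto
    have "16 ^ (j + 1) * M i \<le> 16 ^ (k + 2) * M k" using M_mono[of i k] M1[of i] that k by (intro mult_mono) auto
    also have "\<dots> \<le> M j" unfolding k by (rule Mstep)
    finally show ?thesis .
  qed
  have M_ge: "16 ^ (j + 1) \<le> M j" for j
  proof (cases j)
    case 0 then show ?thesis using e(3)[of 0] by (simp add: M_def)
  next
    case (Suc k)
    have "16 ^ (j + 1) * 1 \<le> 16 ^ (j + 1) * M 0" using M1[of 0] by (intro mult_left_mono) auto
    also have "\<dots> \<le> M j" using M_sep[of 0 j] Suc by simp
    finally show ?thesis by simp
  qed
  have quarter: "1 / 16 ^ (j + 1) \<le> (1/4::real) ^ k" if "k \<le> 2 * j + 2" for j k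
  proof -
    have "1 / 16 ^ (j + 1) = ((1/4::real)\<^sup>2) ^ (j + 1)" by (simp add: power2_eq_square power_one_over)
    also have "\<dots> = (1/4) ^ (2 * j + 2)" unfolding power_mult[symmetric] by simp
    also have "\<dots> \<le> (1/4) ^ k" using that by (intro power_decreasing) auto
    finally show ?thesis .
  qed
  have sep: "min (e i / e j) (e j / e i) \<le> (1/4) ^ (i + j + 2)" if ij: "i < j" for i j
  proof -
    have "min (e i / e j) (e j / e i) \<le> M i / M j"
    proof (cases "1 / e j \<le> e j")
      case True
      then have "M j = e j" by (simp add: M_def max_def)
      moreover have "e i / e j \<le> M i / e j" using e(1)[of j] by (intro divide_right_mono) (auto simp: M_def)
      ultimately show ?thesis by (simp add: min_le_iff_disj)
    next
      case False
      then have "M j = 1 / e j" by (simp add: M_def max_def)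
      moreover have "1 / e i * e j \<le> M i * e j" using e(1)[of j] by (intro mult_right_mono) (auto simp: M_def)
      ultimately show ?thesis by (simp add: min_le_iff_disj)
    qed
    also have "\<dots> \<le> 1 / 16 ^ (j + 1)"
      using M_sep[OF ij] M1[of j] by (simp add: field_simps)
    also have "\<dots> \<le> (1/4) ^ (i + j + 2)" using ij by (intro quarter) auto
    finally show ?thesis .
  qed
  show ?thesis
  proof (rule that)
    show "min (e j) (1 / e j) \<le> (1/4) ^ (j + 2)" for j
    proof -
      have "min (e j) (1 / e j) \<le> 1 / M j" using e(1)[of j] by (cases "1 / e j \<le> e j") (auto simp: M_def)
      also have "\<dots> \<le> 1 / 16 ^ (j + 1)" using M_ge[of j] M1[of j] by (intro divide_left_mono) auto
      also have "\<dots> \<le> (1/4) ^ (j + 2)" by (rule quarter) simp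
      finally show ?thesis .
    qed
    show "min (e i / e j) (e j / e i) \<le> (1/4) ^ (i + j + 2)" if "i \<noteq> j" for i j
      using sep[of i j] sep[of j i] that by (cases "i < j") (auto simp: min.commute add.commute)
  qed (rule e)+
qed

lemma sum_ind_disjoint:
  assumes "finite G" "\<And>i. B i \<in> sets unit_leb" "\<And>i j. i \<noteq> j \<Longrightarrow> B i \<inter> B j = {}"
  shows "(\<Sum>i\<in>G. ind (B i)) = ind (\<Union>i\<in>G. B i)"
  using assms(1)
proof (induction G rule: finite_induct)
  case (insert k G)
  have U: "(\<Union>i\<in>G. B i) \<in> sets unit_leb" using insert.hyps assms(2) by auto
  have U': "B k \<union> (\<Union>i\<in>G. B i) \<in> sets unit_leb" using U assms(2) by auto
  have "B k \<inter> B i = {}" if "i \<in> G" for i using assms(3)[of k i] that insert.hyps by blast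
  then have disj: "B k \<inter> (\<Union>i\<in>G. B i) = {}" by blast
  have "ind (B k) + ind (\<Union>i\<in>G. B i) = ind (B k \<union> (\<Union>i\<in>G. B i))"
  proof (rule L0_eqI)
    show "AE t in unit_leb. rep_L0 (ind (B k) + ind (\<Union>i\<in>G. B i)) t = rep_L0 (ind (B k \<union> (\<Union>i\<in>G. B i))) t"
      using rep_L0_plus[of "ind (B k)" "ind (\<Union>i\<in>G. B i)"] rep_L0_ind[OF assms(2)[of k]] rep_L0_ind[OF U] rep_L0_ind[OF U']
    proof eventually_elim
      case (elim t)
      have "t \<notin> B k \<or> t \<notin> (\<Union>i\<in>G. B i)" using disj by blast
      then show ?case using elim by (auto simp only: indicator_def Un_iff of_bool_eq simp_thms add_0_left add_0_right)
    qed
  qed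
  then show ?case using insert by simp
qed (simp add: ind_empty)

context parameter_fn_index
begin

text \<open>The supports are disjoint, so up to a null set a superlevel set is covered by the
  \<open>B j\<close> with \<open>1 / \<phi> (b j) > l\<close>. As the measures at least halve, these
  have total measure at most twice that of the first one, and concavity gives the weak-type bound
  2.\<close>

lemma N_sparse_sum:
  obtains D where "0 \<le> D"
    "\<And>B b G. finite G \<Longrightarrow> (\<And>j::nat. B j \<in> sets unit_leb) \<Longrightarrow> (\<And>i j. i \<noteq> j \<Longrightarrow> B i \<inter> B j = {}) \<Longrightarrow>
      (\<And>j. measure unit_leb (B j) = b j) \<Longrightarrow> (\<And>j. 0 < b j) \<Longrightarrow> (\<And>j. b (Suc j) \<le> b j / 2) \<Longrightarrow>
      N (\<Sum>j\<in>G. (1 / \<phi> (b j)) *\<^sub>R ind (B j)) \<le> ennreal D"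
proof -
  obtain K where K: "0 < K"
    "\<And>x q. 0 \<le> q \<Longrightarrow> (\<And>l. 0 < l \<Longrightarrow> l * \<phi> (distr_fn (rep_L0 x) l) \<le> q) \<Longrightarrow> N x \<le> ennreal (K * q)"
    using N_weak_type by blast
  show ?thesis
  proof (rule that[of "K * 2"])
    show "0 \<le> K * 2" using K by simp
    fix B b and G :: "nat set"
    assume G: "finite G" and B: "\<And>j. B j \<in> sets unit_leb" and disj: "\<And>i j. i \<noteq> j \<Longrightarrow> B i \<inter> B j = {}"
      and mB: "\<And>j. measure unit_leb (B j) = b j" and b0: "\<And>j. 0 < b j" and half: "\<And>j. b (Suc j) \<le> b j / 2"
    let ?x = "\<Sum>j\<in>G. (1 / \<phi> (b j)) *\<^sub>R ind (B j)"
    have b1: "b j \<le> 1" for j using mB[of j] measure_unit_leb_le_1[of "B j"] by simp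
    have phib: "0 < \<phi> (b j)" for j using b0 b1 by (intro phi_gt_0)
    have rep: "AE t in unit_leb. rep_L0 ?x t = (\<Sum>j\<in>G. 1 / \<phi> (b j) * indicator (B j) t)"
    proof -
      have "AE t in unit_leb. \<forall>j. rep_L0 ((1 / \<phi> (b j)) *\<^sub>R ind (B j)) t = 1 / \<phi> (b j) * rep_L0 (ind (B j)) t"
        unfolding AE_all_countable by (intro allI rep_L0_scaleR)
      moreover have "AE t in unit_leb. \<forall>j. rep_L0 (ind (B j)) t = indicator (B j) t"
        unfolding AE_all_countable by (intro allI rep_L0_ind B)
      ultimately show ?thesis
        using rep_L0_sum[OF G, of "\<lambda>j. (1 / \<phi> (b j)) *\<^sub>R ind (B j)"] by eventually_elim simp
    qed
    \<comment> \<open>Halving gives \<open>b j \<le> 2 * (b j - b (Suc j))\<close>, and the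
      right-hand sides telescope.\<close>
    have tail: "(\<Sum>j\<in>{j0..<j0 + n}. b j) \<le> 2 * (b j0 - b (j0 + n))" for j0 n
    proof (induction n)
      case (Suc n)
      then show ?case using half[of "j0 + n"] by simp
    qed simp
    show "N ?x \<le> ennreal (K * 2)"
    proof (rule K(2))
      fix l :: real assume l: "0 < l"
      define S where "S = {j \<in> G. l < 1 / \<phi> (b j)}"
      have S: "finite S" using G by (simp add: S_def)
      have "distr_fn (rep_L0 ?x) l \<le> measure unit_leb (\<Union>j\<in>S. B j)"
        unfolding distr_fn_def
      proof (rule unit_leb.finite_measure_mono_AE)
        show "AE t in unit_leb. t \<in> {s \<in> {0..1}. l < \<bar>rep_L0 ?x s\<bar>} \<longrightarrow> t \<in> (\<Union>j\<in>S. B j)"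
          using rep
        proof eventually_elim
          case (elim t)
          show ?case
          proof
            assume "t \<in> {s \<in> {0..1}. l < \<bar>rep_L0 ?x s\<bar>}"
            then have lt: "l < \<bar>\<Sum>j\<in>G. 1 / \<phi> (b j) * indicator (B j) t\<bar>" using elim by simp
            show "t \<in> (\<Union>j\<in>S. B j)"
            proof (cases "\<exists>k\<in>G. t \<in> B k")
              case True
              then obtain k where k: "k \<in> G" "t \<in> B k" by blast
              have "t \<notin> B j" if "j \<noteq> k" for j using disj[OF that] k by blast
              then have "(\<Sum>j\<in>G. 1 / \<phi> (b j) * indicator (B j) t) = (\<Sum>j\<in>{k}. 1 / \<phi> (b j) * indicator (B j) t)"
                using G k by (intro sum.mono_neutral_right) auto
              then have "l < 1 / \<phi> (b k)" using lt k phib[of k] by simp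
              then show ?thesis using k by (auto simp: S_def)
            next
              case False
              then have "(\<Sum>j\<in>G. 1 / \<phi> (b j) * indicator (B j) t) = 0" by (intro sum.neutral) auto
              then show ?thesis using lt l by simp
            qed
          qed
        qed
      qed (use S B in auto)
      also have "\<dots> \<le> (\<Sum>j\<in>S. measure unit_leb (B j))"
        by (rule unit_leb.finite_measure_subadditive_finite) (use S B in auto)
      finally have D: "distr_fn (rep_L0 ?x) l \<le> (\<Sum>j\<in>S. b j)" by (simp add: mB)
      show "l * \<phi> (distr_fn (rep_L0 ?x) l) \<le> 2"
      proof (cases "S = {}")
        case True
        then have "distr_fn (rep_L0 ?x) l = 0" using D distr_fn_nonneg[of "rep_L0 ?x" l] by simp
        then show ?thesis by (simp add: phi_0)
      next
        case False
        define j0 where "j0 = Min S"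
        have j0: "j0 \<in> S" using False S by (simp add: j0_def)
        have sub: "S \<subseteq> {j0..<j0 + Suc (Max S)}"
        proof
          fix j assume "j \<in> S"
          then have "j0 \<le> j" "j \<le> Max S" using S by (auto simp: j0_def)
          then show "j \<in> {j0..<j0 + Suc (Max S)}" by auto
        qed
        have "(\<Sum>j\<in>S. b j) \<le> (\<Sum>j\<in>{j0..<j0 + Suc (Max S)}. b j)"
          using sub b0 by (intro sum_mono2) (auto intro: less_imp_le)
        also have "\<dots> \<le> 2 * b j0" by (rule order_trans[OF tail]) (use b0 in \<open>simp add: less_imp_le\<close>)
        finally have le: "distr_fn (rep_L0 ?x) l / 2 \<le> b j0" using D by linarith
        have d1: "distr_fn (rep_L0 ?x) l \<le> 1" unfolding distr_fn_def by (rule measure_unit_leb_le_1)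
        have "\<phi> (2 * (distr_fn (rep_L0 ?x) l / 2)) \<le> 2 * \<phi> (distr_fn (rep_L0 ?x) l / 2)"
          using d1 by (intro phi_scale) auto
        also have "\<dots> \<le> 2 * \<phi> (b j0)" using b1 le by (intro mult_left_mono phi_le) auto
        finally have "l * \<phi> (distr_fn (rep_L0 ?x) l) \<le> l * (2 * \<phi> (b j0))" using l by (intro mult_left_mono) auto
        moreover have "l * \<phi> (b j0) \<le> 1" using j0 phib[of j0] by (simp add: S_def field_simps)
        ultimately show ?thesis by linarith
      qed
    qed simp
  qed
qed

text \<open>Negating the condition gives, for each \<open>m\<close>, a number \<open>n m\<close> and
  arbitrarily small \<open>s\<close> with \<open>\<phi> (n m * s) > m * \<phi> s\<close>. The m-th
  batch consists of \<open>n m\<close> sets of measure \<open>s\<close> in different levels; the sum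
  of their normalized indicators has norm \<open>\<phi> (n m * s) / \<phi> s\<close>, which exceeds
  \<open>m\<close>.\<close>

lemma almost_slowly_varying_if_K_monotone:
  assumes w: "nontrivial_weight w"
    and KM: "K_monotone_couple (marcinkiewicz \<phi>) (weighted (marcinkiewicz \<phi>) w)"
  shows "almost_slowly_varying \<phi>"
proof (rule ccontr)
  assume "\<not> almost_slowly_varying \<phi>"
  then have "\<forall>C. \<exists>n::nat. \<forall>d>0. \<exists>s::real. 0 < s \<and> s \<le> d \<and> n * s \<le> 1 \<and> C * \<phi> s < \<phi> (n * s)"
    unfolding almost_slowly_varying_def by (meson not_le)
  then have "\<forall>m::nat. \<exists>n::nat. \<forall>d>0. \<exists>s::real. 0 < s \<and> s \<le> d \<and> n * s \<le> 1 \<and> m * \<phi> s < \<phi> (n * s)"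
    by blast
  then obtain n :: "nat \<Rightarrow> nat" where
    n: "\<And>m d. 0 < d \<Longrightarrow> \<exists>s::real. 0 < s \<and> s \<le> d \<and> n m * s \<le> 1 \<and> m * \<phi> s < \<phi> (n m * s)"
    by metis
  obtain e where e: "\<And>j. 0 < e j" "\<And>j. 0 < measure unit_leb (level_set w (e j))" "\<And>j. min (e j) (1 / e j) \<le> (1/4) ^ (j + 2)"
    "\<And>i j. i \<noteq> j \<Longrightarrow> min (e i / e j) (e j / e i) \<le> (1/4) ^ (i + j + 2)"
    using separated_sequence[of "\<lambda>e. 0 < measure unit_leb (level_set w e)"] nontrivial_weight_level[OF w] by blast
  \<comment> \<open>\<open>prod_encode\<close> reserves \<open>n m\<close> indices for the m-th
    batch, disjoint from those of the others, so that each piece has a level of its own.\<close>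
  define F where "F m = (\<lambda>i. prod_encode (m, i)) ` {..<n m}" for m
  interpret coorbit_space \<phi> w e F
    by unfold_locales (use w e in \<open>auto simp: nontrivial_weight_def F_def\<close>)
  define a where "a j = measure unit_leb (A j)" for j
  have a: "0 < a j" for j using e(2)[of j] by (simp add: a_def A_def)
  have subset: "\<exists>D. D \<in> sets unit_leb \<and> D \<subseteq> A j \<and> measure unit_leb D = s" if "0 \<le> s" "s \<le> a j" for j s
    by (rule unit_leb_exists_between[OF sets_A[of j], of "{}" s]) (use that in \<open>auto simp: a_def\<close>)
  \<comment> \<open>As \<open>n m\<close> is fixed before \<open>s\<close>, the measure can be taken
    small enough to fit into all the finitely many level sets of the batch.\<close>
  have "\<exists>s::real. 0 < s \<and> s \<le> 1 \<and> (\<forall>i\<in>F m. s \<le> a i) \<and> n m * s \<le> 1 \<and> m * \<phi> s < \<phi> (n m * s)" for m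
  proof -
    have "0 < Min (insert 1 (a ` F m))" using finite_F[of m] a by (subst Min_gr_iff) auto
    then obtain s :: real where s: "0 < s" "s \<le> Min (insert 1 (a ` F m))" "n m * s \<le> 1" "m * \<phi> s < \<phi> (n m * s)"
      using n by blast
    have "s \<le> a i" if "i \<in> F m" for i
      using s(2) Min_le[of "insert 1 (a ` F m)" "a i"] finite_F[of m] that by auto
    moreover have "s \<le> 1" using s(2) Min_le[of "insert 1 (a ` F m)" 1] finite_F[of m] by auto
    ultimately show ?thesis using s by blast
  qed
  then obtain s :: "nat \<Rightarrow> real" where s: "\<And>m. 0 < s m" "\<And>m i. i \<in> F m \<Longrightarrow> s m \<le> a i" "\<And>m. n m * s m \<le> (1::real)"
    "\<And>m::nat. m * \<phi> (s m) < \<phi> (n m * s m)" "\<And>m. s m \<le> 1" by metis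
  define batch where "batch j = fst (prod_decode j)" for j
  have batch: "batch j = m" if "j \<in> F m" for j m using that by (auto simp: F_def batch_def)
  have "\<forall>j. \<exists>D. D \<in> sets unit_leb \<and> D \<subseteq> A j \<and> (j \<in> F (batch j) \<longrightarrow> measure unit_leb D = s (batch j))"
  proof
    fix j
    show "\<exists>D. D \<in> sets unit_leb \<and> D \<subseteq> A j \<and> (j \<in> F (batch j) \<longrightarrow> measure unit_leb D = s (batch j))"
    proof (cases "j \<in> F (batch j)")
      case True
      then show ?thesis using subset[of "s (batch j)" j] s(1)[of "batch j"] s(2)[OF True] by auto
    next
      case False
      then show ?thesis by (intro exI[of _ "{}"]) auto
    qed
  qed
  then obtain Dy where Dy: "\<And>j. Dy j \<in> sets unit_leb" "\<And>j. Dy j \<subseteq> A j"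
    "\<And>j. j \<in> F (batch j) \<Longrightarrow> measure unit_leb (Dy j) = s (batch j)" by metis
  have Dy_disj: "Dy i \<inter> Dy j = {}" if "i \<noteq> j" for i j using Dy(2)[of i] Dy(2)[of j] A_disjoint[OF that] by blast
  \<comment> \<open>Indices belonging to no batch carry 0, which keeps the bound on single
    pieces.\<close>
  define y where "y j = (if j \<in> F (batch j) then (1 / \<phi> (s (batch j))) *\<^sub>R ind (Dy j) else 0)" for j
  \<comment> \<open>Halving brings the sums of the \<open>x j\<close> under
    \<open>N_sparse_sum\<close>; the minimum with \<open>a (Suc j)\<close> lets the sets fit into
    their levels.\<close>
  define b where "b = rec_nat (a 0) (\<lambda>j t. min (t / 2) (a (Suc j)))"
  have b: "b 0 = a 0" "b (Suc j) = min (b j / 2) (a (Suc j))" for j by (simp_all add: b_def)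
  have b0: "0 < b j" for j by (induction j) (use a in \<open>auto simp: b\<close>)
  have ba: "b j \<le> a j" for j by (cases j) (auto simp: b)
  have "\<forall>j. \<exists>D. D \<in> sets unit_leb \<and> D \<subseteq> A j \<and> measure unit_leb D = b j"
    using subset b0 ba by (simp add: less_imp_le)
  then obtain Bx where Bx: "\<And>j. Bx j \<in> sets unit_leb" "\<And>j. Bx j \<subseteq> A j" "\<And>j. measure unit_leb (Bx j) = b j" by metis
  have Bx_disj: "Bx i \<inter> Bx j = {}" if "i \<noteq> j" for i j using Bx(2)[of i] Bx(2)[of j] A_disjoint[OF that] by blast
  define x where "x j = (1 / \<phi> (b j)) *\<^sub>R ind (Bx j)" for j
  have a1: "a j \<le> 1" for j unfolding a_def by (rule measure_unit_leb_le_1)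
  have phib: "0 < \<phi> (b j)" for j using b0[of j] ba[of j] a1[of j] by (intro phi_gt_0) auto
  have phis: "0 < \<phi> (s (batch j))" if "j \<in> F (batch j)" for j
    using s(1)[of "batch j"] s(2)[OF that] a1[of j] by (intro phi_gt_0) auto
  have ind_sub: "ind (A j) * ind D = ind D" if "D \<in> sets unit_leb" "D \<subseteq> A j" for j D
    using that by (simp add: ind_mult_ind Int_absorb1)
  obtain D where D: "0 \<le> D"
    "\<And>B b G. finite G \<Longrightarrow> (\<And>j::nat. B j \<in> sets unit_leb) \<Longrightarrow> (\<And>i j. i \<noteq> j \<Longrightarrow> B i \<inter> B j = {}) \<Longrightarrow>
      (\<And>j. measure unit_leb (B j) = b j) \<Longrightarrow> (\<And>j. 0 < b j) \<Longrightarrow> (\<And>j. b (Suc j) \<le> b j / 2) \<Longrightarrow>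
      N (\<Sum>j\<in>G. (1 / \<phi> (b j)) *\<^sub>R ind (B j)) \<le> ennreal D"
    using N_sparse_sum by blast
  have "\<not> K_monotone_couple X Y"
  proof (rule not_K_monotone_couple[of x D y])
    fix j m
    show "ind (A j) * x j = x j" by (simp add: x_def ind_sub Bx)
    show "N (x j) = 1"
      using phib[of j] by (simp add: x_def N_scaleR N_ind[OF Bx(1)] Bx(3) ennreal_mult[symmetric])
    show "N (\<Sum>i\<in>F m. x i) \<le> ennreal D"
      unfolding x_def by (rule D(2)[OF finite_F]) (use Bx Bx_disj b0 b in auto)
    show "0 \<le> D" by (rule D(1))
    show "ind (A j) * y j = y j" by (simp add: y_def ind_sub Dy)
    show "N (y j) \<le> 1"
    proof (cases "j \<in> F (batch j)")
      case True
      then show ?thesis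
        using phis[OF True] by (simp add: y_def N_scaleR N_ind[OF Dy(1)] Dy(3) ennreal_mult[symmetric])
    qed (simp add: y_def)
    show "ennreal (real m) \<le> N (\<Sum>i\<in>F m. y i)"
    proof -
      have y: "y i = (1 / \<phi> (s m)) *\<^sub>R ind (Dy i)" if "i \<in> F m" for i
        using that batch[OF that] by (simp add: y_def)
      have "(\<Sum>i\<in>F m. y i) = (1 / \<phi> (s m)) *\<^sub>R (\<Sum>i\<in>F m. ind (Dy i))"
        unfolding scaleR_sum_right by (rule sum.cong[OF refl y])
      also have "(\<Sum>i\<in>F m. ind (Dy i)) = ind (\<Union>i\<in>F m. Dy i)"
        by (rule sum_ind_disjoint[OF finite_F Dy(1) Dy_disj])
      finally have sum: "(\<Sum>i\<in>F m. y i) = (1 / \<phi> (s m)) *\<^sub>R ind (\<Union>i\<in>F m. Dy i)" .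
      have "measure unit_leb (\<Union>i\<in>F m. Dy i) = (\<Sum>i\<in>F m. measure unit_leb (Dy i))"
        by (rule unit_leb.finite_measure_finite_Union)
          (use finite_F Dy(1) Dy_disj in \<open>auto simp: disjoint_family_on_def\<close>)
      also have "\<dots> = (\<Sum>i\<in>F m. s m)"
      proof (rule sum.cong[OF refl])
        fix i assume i: "i \<in> F m"
        show "measure unit_leb (Dy i) = s m" using Dy(3)[of i] i batch[OF i] by simp
      qed
      also have "\<dots> = n m * s m"
        by (simp add: F_def card_image inj_on_def)
      finally have meas: "measure unit_leb (\<Union>i\<in>F m. Dy i) = n m * s m" .
      have U: "(\<Union>i\<in>F m. Dy i) \<in> sets unit_leb" using finite_F Dy(1) by blast
      have sm: "0 < \<phi> (s m)" by (rule phi_gt_0[OF s(1) s(5)])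
      have "real m \<le> 1 / \<phi> (s m) * \<phi> (n m * s m)" using s(4)[of m] sm by (simp add: field_simps)
      then have "ennreal (real m) \<le> ennreal (1 / \<phi> (s m) * \<phi> (n m * s m))" by (rule ennreal_leI)
      also have "\<dots> = N (\<Sum>i\<in>F m. y i)"
        using sm phi_nonneg[of "n m * s m"] s(1)[of m] s(3)[of m] unfolding sum N_scaleR N_ind[OF U] meas by (subst ennreal_mult) auto
      finally show ?thesis .
    qed
  qed
  then show False using KM by contradiction
qed

end

theorem theorem4p12:
  fixes \<phi> :: "real \<Rightarrow> real"
  assumes "mono_on {0..1} \<phi>"
    and "concave_on {0..1} \<phi>"
    and "\<phi> 0 = 0"
    and "\<forall>t\<in>{0<..1}. 0 < \<phi> t"
    and "upper_dilation_index \<phi> < 1"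
  shows "(\<exists>w. nontrivial_weight w \<and>
            K_monotone_couple (marcinkiewicz \<phi>) (weighted (marcinkiewicz \<phi>) w)) \<longleftrightarrow>
         (\<exists>\<psi>. quasi_concave \<psi> \<and> regularly_varying_order_infinity \<psi> \<and>
            equivalent_functions \<phi> \<psi>)"
proof -
  interpret parameter_fn_index \<phi>
    using assms by unfold_locales
  show ?thesis
    using almost_slowly_varying_if_K_monotone exists_K_monotone_weight
      almost_slowly_varying_if_regularly_varying regularly_varying_if_almost_slowly_varying by metis
qed

end
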